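(* There exists $\rho_0>0$ such that the following holds for every $\rho\geq\rho_0$. Let $u_0\in L^2(\mathbb{R})\cap\dot H^{\rho}(\mathbb{R})$ be a (real-valued) initial data and let $u\in L^\infty_t(L^2_x)\cap L^2_t(\mathcal{N}_x)$ be an associated weak solution of the equation $$\partial_t u=-(-\Delta)^{\frac12}\mathcal{M}(u)+\partial_x\left(\frac{u^2}{2}\right),\qquad u(0,x)=u_0(x),\quad x\in\mathbb{R}.$$ Assume moreover that $u\in L^\infty_t(L^\infty_x)$. Then $u\in L^\infty_t(\dot H^{\rho}_x)$.
   Context: The operators are Fourier multipliers on $\mathbb{R}$: $\widehat{(-\Delta)^{a}f}(\xi)=|\xi|^{2a}\widehat f(\xi)$, and $\widehat{\mathcal{M}(f)}(\xi)=\mathfrak{m}(\xi)\widehat f(\xi)$ with $\mathfrak{m}(\xi)=\sqrt{(1+\xi^2)\frac{\tanh(\xi)}{\xi}}$ (so $\mathfrak m(0)=1$). $\mathcal{M}^{\frac12}$ is the multiplier with symbol $\mathfrak{m}(\xi)^{\frac12}$. The functional $\|\cdot\|_{\mathcal{N}}$ is $\|f\|_{\mathcal{N}}=\left(\int_{\mathbb{R}}\left|(-\Delta)^{\frac14}\mathcal{M}^{\frac12}(f)\right|^2dx\right)^{\frac12}$, where $(-\Delta)^{\frac14}\mathcal{M}^{\frac12}$ has symbol $|\xi|^{\frac12}\mathfrak m(\xi)^{\frac12}$, and $\mathcal{N}(\mathbb{R})$ is the set of real functions $f$ with $\|f\|_{\mathcal{N}}<+\infty$. For $\sigma>0$, $\dot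 H^\sigma(\mathbb{R})$ is the homogeneous Sobolev space with $\|f\|_{\dot H^\sigma}=\|(-\Delta)^{\frac{\sigma}{2}}f\|_{L^2}$. The notation $L^p_t(X_x)$ means $L^p\big((0,+\infty),X(\mathbb{R})\big)$. A weak solution is understood in the usual distributional sense: for all $\phi\in C_c^\infty([0,+\infty)\times\mathbb{R})$, $$\int_0^{+\infty}\!\!\int_{\mathbb{R}}\Big(u\,\partial_t\phi-u\,(-\Delta)^{\frac12}\mathcal{M}(\phi)-\frac{u^2}{2}\partial_x\phi\Big)dx\,dt+\int_{\mathbb{R}}u_0(x)\phi(0,x)\,dx=0.$$ *)

theory Defs
  imports "HOL-Probability.Essential_Supremum"
begin

section \<open>Square-integrable functions and the Fourier transform\<close>

definition square_integrable :: "(real \<Rightarrow> 'a::{banach, second_countable_topology}) \<Rightarrow> bool" where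
  "square_integrable f \<longleftrightarrow>
     f \<in> borel_measurable lborel \<and> integrable lborel (\<lambda>x. (norm (f x))\<^sup>2)"

text \<open>All norms take values in the extended nonnegative reals, so that membership in a
  space is finiteness of its norm.\<close>

definition L2_norm :: "(real \<Rightarrow> 'a::{banach, second_countable_topology}) \<Rightarrow> ennreal" where
  "L2_norm f =
     (if square_integrable f then ennreal (sqrt (LINT x|lborel. (norm (f x))\<^sup>2)) else \<infinity>)"

definition Linf_norm :: "(real \<Rightarrow> real) \<Rightarrow> ennreal" where
  "Linf_norm f = esssup lborel (\<lambda>x. ennreal \<bar>f x\<bar>)"

definition truncated_fourier :: "nat \<Rightarrow> (real \<Rightarrow> complex) \<Rightarrow> real \<Rightarrow> complex" where
  "truncated_fourier n f \<xi> = (LINT x:{- real n..real n}|lborel. f x * cis (- (x * \<xi>)))"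

text \<open>The Fourier transform on \<open>L\<^sup>2\<close>: the limit in \<open>L\<^sup>2\<close> of the truncated Fourier integrals.
  It is determined up to null sets; \<open>fourier f\<close> is a representative. The normalisation
  \<open>\<integral> f(x) exp(-i x \<xi>) dx\<close> is the one for which \<open>-\<Delta>\<close> has the symbol \<open>|\<xi>|\<^sup>2\<close>.\<close>

definition fourier :: "(real \<Rightarrow> complex) \<Rightarrow> real \<Rightarrow> complex" where
  "fourier f = (SOME F. square_integrable F \<and>
     (\<lambda>n. L2_norm (\<lambda>\<xi>. truncated_fourier n f \<xi> - F \<xi>)) \<longlonglongrightarrow> 0)"


section \<open>Fourier multipliers\<close>

text \<open>\<open>is_multiplier s f g\<close> says that the multiplier with symbol \<open>s\<close>, as an unbounded operator
  on \<open>L\<^sup>2\<close>, maps \<open>f\<close> to (the class of) \<open>g\<close>.\<close>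

definition is_multiplier :: "(real \<Rightarrow> real) \<Rightarrow> (real \<Rightarrow> complex) \<Rightarrow> (real \<Rightarrow> complex) \<Rightarrow> bool" where
  "is_multiplier s f g \<longleftrightarrow> square_integrable f \<and> square_integrable g \<and>
     (AE \<xi> in lborel. fourier g \<xi> = complex_of_real (s \<xi>) * fourier f \<xi>)"

definition multiplier :: "(real \<Rightarrow> real) \<Rightarrow> (real \<Rightarrow> complex) \<Rightarrow> real \<Rightarrow> complex" where
  "multiplier s f = (SOME g. is_multiplier s f g)"

definition multiplier_norm :: "(real \<Rightarrow> real) \<Rightarrow> (real \<Rightarrow> complex) \<Rightarrow> ennreal" where
  "multiplier_norm s f =
     (if \<exists>g. is_multiplier s f g then L2_norm (multiplier s f) else \<infinity>)"

definition frac_laplacian_symbol :: "real \<Rightarrow> real \<Rightarrow> real" where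
  "frac_laplacian_symbol a \<xi> = \<bar>\<xi>\<bar> powr (2 * a)"

definition M_symbol :: "real \<Rightarrow> real" where
  "M_symbol \<xi> = (if \<xi> = 0 then 1 else sqrt ((1 + \<xi>\<^sup>2) * (tanh \<xi> / \<xi>)))"

definition N_norm :: "(real \<Rightarrow> real) \<Rightarrow> ennreal" where
  "N_norm f = multiplier_norm
     (\<lambda>\<xi>. frac_laplacian_symbol (1/4) \<xi> * M_symbol \<xi> powr (1/2)) (\<lambda>x. complex_of_real (f x))"

definition Hdot_norm :: "real \<Rightarrow> (real \<Rightarrow> real) \<Rightarrow> ennreal" where
  "Hdot_norm \<sigma> f = multiplier_norm (frac_laplacian_symbol (\<sigma>/2)) (\<lambda>x. complex_of_real (f x))"

text \<open>The symbol is real and even, so the operator maps real functions to real functions (up to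
  null sets); the real part only adjusts the type.\<close>

definition sqrt_laplacian_M :: "(real \<Rightarrow> real) \<Rightarrow> real \<Rightarrow> real" where
  "sqrt_laplacian_M f x =
     Re (multiplier (\<lambda>\<xi>. frac_laplacian_symbol (1/2) \<xi> * M_symbol \<xi>)
           (\<lambda>y. complex_of_real (f y)) x)"


section \<open>Functions of time and space\<close>

text \<open>Functions of \<open>(t, x)\<close> are curried, with \<open>t\<close> first; only their values for \<open>t > 0\<close> matter.
  As usual for \<open>L\<^sup>\<infinity>\<close> spaces in time, \<open>u\<close> is required to be jointly measurable,
  not strongly measurable as a map into \<open>L\<^sup>\<infinity>\<close>.\<close>

definition time_measure :: "real measure" where
  "time_measure = restrict_space lborel {0<..}"

definition Linf_time :: "((real \<Rightarrow> real) \<Rightarrow> ennreal) \<Rightarrow> (real \<Rightarrow> real \<Rightarrow> real) set" where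
  "Linf_time N = {u. case_prod u \<in> borel_measurable (time_measure \<Otimes>\<^sub>M lborel) \<and>
     esssup time_measure (\<lambda>t. N (u t)) < \<infinity>}"

definition L2_time :: "((real \<Rightarrow> real) \<Rightarrow> ennreal) \<Rightarrow> (real \<Rightarrow> real \<Rightarrow> real) set" where
  "L2_time N = {u. case_prod u \<in> borel_measurable (time_measure \<Otimes>\<^sub>M lborel) \<and>
     (\<lambda>t. N (u t)) \<in> borel_measurable time_measure \<and>
     (\<integral>\<^sup>+t. (N (u t))\<^sup>2 \<partial>time_measure) < \<infinity>}"


section \<open>Weak solutions\<close>

text \<open>\<open>k\<close> times continuously differentiable on the closed half-plane \<open>t \<ge> 0\<close>, with one-sided
  time derivatives at \<open>t = 0\<close>.\<close>

primrec Ck_halfplane :: "nat \<Rightarrow> (real \<Rightarrow> real \<Rightarrow> real) \<Rightarrow> bool" where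
  "Ck_halfplane 0 \<phi> \<longleftrightarrow> continuous_on ({0..} \<times> UNIV) (case_prod \<phi>)"
| "Ck_halfplane (Suc k) \<phi> \<longleftrightarrow>
     (\<exists>\<phi>\<^sub>t \<phi>\<^sub>x. (\<forall>t\<ge>0. \<forall>x.
          ((\<lambda>s. \<phi> s x) has_vector_derivative \<phi>\<^sub>t t x) (at t within {0..}) \<and>
          ((\<lambda>y. \<phi> t y) has_vector_derivative \<phi>\<^sub>x t x) (at x)) \<and>
        Ck_halfplane k \<phi>\<^sub>t \<and> Ck_halfplane k \<phi>\<^sub>x)"

definition test_function :: "(real \<Rightarrow> real \<Rightarrow> real) \<Rightarrow> bool" where
  "test_function \<phi> \<longleftrightarrow> (\<forall>k. Ck_halfplane k \<phi>) \<and>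
     compact (closure {(t, x). t \<ge> 0 \<and> \<phi> t x \<noteq> 0})"

definition weak_solution :: "(real \<Rightarrow> real) \<Rightarrow> (real \<Rightarrow> real \<Rightarrow> real) \<Rightarrow> bool" where
  "weak_solution u\<^sub>0 u \<longleftrightarrow> (\<forall>\<phi>. test_function \<phi> \<longrightarrow>
     (LINT t|time_measure. LINT x|lborel.
         u t x * vector_derivative (\<lambda>s. \<phi> s x) (at t within {0..})
         - u t x * sqrt_laplacian_M (\<phi> t) x
         - (u t x)\<^sup>2 / 2 * vector_derivative (\<phi> t) (at x))
     + (LINT x|lborel. u\<^sub>0 x * \<phi> 0 x) = 0)"

end

theory Submission
  imports Defs "HOL-Probability.Levy"
begin

text \<open>
  Fix a frequency \<open>\<xi>\<close>. Testing the equation against a function of time times a modulated bump turns it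
  into \<open>U' = - d U + i \<xi> F / 2\<close>, where \<open>U\<close> and \<open>F\<close> are the transforms of \<open>u\<close> and \<open>u\<^sup>2\<close> and
  \<open>d = \<bar>\<xi>\<bar> m(\<xi>)\<close>, so \<open>\<bar>U\<bar>\<close> is bounded by Duhamel's formula. Since \<open>d\<close> dominates \<open>\<bar>\<xi>\<bar> powr (3/2)\<close> for
  \<open>\<bar>\<xi>\<bar> \<ge> 1\<close>, the integral in time gains almost half a derivative over \<open>F\<close>. Boundedness of \<open>u\<close>
  puts \<open>u\<^sup>2\<close> into \<open>L\<^sup>2\<close> uniformly in time, which starts a bootstrap; each round recovers the regularity of
  \<open>u\<^sup>2\<close> from the one of \<open>u\<close> by a weighted convolution estimate, which costs less than the smoothing
  gains. Frequencies \<open>\<bar>\<xi>\<bar> \<le> 1\<close> are controlled by the \<open>L\<^sup>2\<close> norm.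
\<close>

subsection \<open>Square-integrable functions\<close>

text \<open>Two obstacles shape the proof. \<open>fourier\<close> and \<open>multiplier\<close> are
  chosen by \<open>SOME\<close>, separately for every argument: they are known only up to null sets,
  and nothing says that they depend measurably on time. Plancherel's theorem and surjectivity
  therefore come first; they turn every multiplier norm into a weighted integral of the transform,
  and a jointly measurable version of the transform replaces the chosen one. The weak formulation is
  one identity per test function, whereas Duhamel's formula needs a single frequency. Time profiles
  with rational endpoints leave one null set of frequencies; Fubini then exchanges "almost every
  frequency, almost every time" with the reverse order, which the energy estimate needs. On the
  exponents: with w = 1 + |\<xi>|, the squared derivative costs w^2 and Cauchy-Schwarz in time
  returns w^(-3/2). The exponential may absorb a further w^p, with singularity \<tau>^(-2p/3) at
  time 0, integrable for p < 3/2. The choice p = 5/4 gains (5/4 - 1/2) / 2 = 3/8 of a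
  derivative.\<close>

definition sq_norm :: "(real \<Rightarrow> complex) \<Rightarrow> real" where
  "sq_norm f = (LINT x|lborel. (cmod (f x))\<^sup>2)"

definition L2_pairing :: "(real \<Rightarrow> complex) \<Rightarrow> (real \<Rightarrow> complex) \<Rightarrow> complex" where
  "L2_pairing f g = (LINT x|lborel. f x * g x)"

lemma square_integrableI:
  assumes "f \<in> borel_measurable borel" "(\<integral>\<^sup>+x. ennreal ((norm (f x))\<^sup>2) \<partial>lborel) < \<infinity>"
  shows "square_integrable f"
  using assms unfolding square_integrable_def
  by (auto intro!: integrableI_bounded)

lemma square_integrable_measurable:
  "square_integrable f \<Longrightarrow> f \<in> borel_measurable borel"
  unfolding square_integrable_def by simp

lemma square_integrable_integrable:
  "square_integrable f \<Longrightarrow> integrable lborel (\<lambda>x. (norm (f x))\<^sup>2)"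
  unfolding square_integrable_def by simp

lemma square_integrable_nn:
  fixes f :: "real \<Rightarrow> complex"
  assumes "square_integrable f"
  shows "(\<integral>\<^sup>+x. ennreal ((cmod (f x))\<^sup>2) \<partial>lborel) = ennreal (sq_norm f)"
  unfolding sq_norm_def using square_integrable_integrable[OF assms]
  by (intro nn_integral_eq_integral) auto

lemma sq_norm_nonneg [simp]: "0 \<le> sq_norm f"
  unfolding sq_norm_def by simp

lemma square_integrable_of_real [simp]:
  "square_integrable (\<lambda>x. complex_of_real (f x)) \<longleftrightarrow> square_integrable f"
proof -
  have "(\<lambda>x. complex_of_real (f x)) \<in> borel_measurable borel \<longleftrightarrow> f \<in> borel_measurable borel"
  proof
    assume "(\<lambda>x. complex_of_real (f x)) \<in> borel_measurable borel"
    from measurable_compose[OF this borel_measurable_Re] show "f \<in> borel_measurable borel"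
      by (simp only: Re_complex_of_real)
  qed measurable
  then show ?thesis
    unfolding square_integrable_def by simp
qed

lemma square_integrable_bound:
  fixes f :: "real \<Rightarrow> 'a::{banach, second_countable_topology}"
    and g :: "real \<Rightarrow> 'b::{banach, second_countable_topology}"
  assumes "square_integrable f" "g \<in> borel_measurable borel"
    and "\<And>x. norm (g x) \<le> C * norm (f x)"
  shows "square_integrable g"
  unfolding square_integrable_def
proof safe
  show "g \<in> borel_measurable lborel" using assms by simp
  have [measurable]: "g \<in> borel_measurable borel" by fact
  show "integrable lborel (\<lambda>x. (norm (g x))\<^sup>2)"
  proof (rule Bochner_Integration.integrable_bound)
    show "integrable lborel (\<lambda>x. C\<^sup>2 * (norm (f x))\<^sup>2)"
      using square_integrable_integrable[OF assms(1)] by simp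
    show "AE x in lborel. norm ((norm (g x))\<^sup>2) \<le> norm (C\<^sup>2 * (norm (f x))\<^sup>2)"
    proof (rule AE_I2)
      fix x show "norm ((norm (g x))\<^sup>2) \<le> norm (C\<^sup>2 * (norm (f x))\<^sup>2)"
        using power_mono[OF assms(3)[of x], of 2] by (simp add: power_mult_distrib)
    qed
  qed simp
qed

lemma square_integrable_add:
  fixes f g :: "real \<Rightarrow> complex"
  assumes f: "square_integrable f" and g: "square_integrable g"
  shows "square_integrable (\<lambda>x. f x + g x)"
  unfolding square_integrable_def
proof safe
  note [measurable] = square_integrable_measurable[OF f] square_integrable_measurable[OF g]
  show "(\<lambda>x. f x + g x) \<in> borel_measurable lborel" by simp
  show "integrable lborel (\<lambda>x. (cmod (f x + g x))\<^sup>2)"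
  proof (rule Bochner_Integration.integrable_bound)
    show "integrable lborel (\<lambda>x. 2 * (cmod (f x))\<^sup>2 + 2 * (cmod (g x))\<^sup>2)"
      using square_integrable_integrable[OF f] square_integrable_integrable[OF g] by simp
    show "AE x in lborel. norm ((cmod (f x + g x))\<^sup>2) \<le> norm (2 * (cmod (f x))\<^sup>2 + 2 * (cmod (g x))\<^sup>2)"
    proof (rule AE_I2)
      fix x
      have "(cmod (f x + g x))\<^sup>2 \<le> (cmod (f x) + cmod (g x))\<^sup>2"
        by (intro power_mono norm_triangle_ineq) auto
      also have "\<dots> \<le> 2 * (cmod (f x))\<^sup>2 + 2 * (cmod (g x))\<^sup>2"
        using sum_squares_bound[of "cmod (f x)" "cmod (g x)"] by (simp add: power2_sum)
      finally show "norm ((cmod (f x + g x))\<^sup>2) \<le> norm (2 * (cmod (f x))\<^sup>2 + 2 * (cmod (g x))\<^sup>2)"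
        by simp
    qed
  qed measurable
qed

lemma square_integrable_mult_bounded:
  fixes f h :: "real \<Rightarrow> complex"
  assumes "square_integrable f" "h \<in> borel_measurable borel" "\<And>x. cmod (h x) \<le> C"
  shows "square_integrable (\<lambda>x. h x * f x)"
proof (rule square_integrable_bound[OF assms(1)])
  show "cmod (h x * f x) \<le> C * cmod (f x)" for x
    using mult_right_mono[OF assms(3)[of x], of "cmod (f x)"] by (simp add: norm_mult)
qed (use assms(2) square_integrable_measurable[OF assms(1)] in auto)

lemma square_integrable_cmult:
  "square_integrable f \<Longrightarrow> square_integrable (\<lambda>x. c * f x)" for f :: "real \<Rightarrow> complex"
  by (rule square_integrable_mult_bounded[of f "\<lambda>_. c" "cmod c"]) auto

lemma square_integrable_minus:
  "square_integrable f \<Longrightarrow> square_integrable (\<lambda>x. - f x)" for f :: "real \<Rightarrow> complex"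
  using square_integrable_cmult[of f "-1"] by simp

lemma square_integrable_diff:
  "square_integrable f \<Longrightarrow> square_integrable g \<Longrightarrow> square_integrable (\<lambda>x. f x - g x)"
  for f :: "real \<Rightarrow> complex"
  using square_integrable_add[OF _ square_integrable_minus, of f g] by simp

lemma borel_measurable_cnj [measurable]: "cnj \<in> borel_measurable borel"
  by (intro borel_measurable_continuous_onI continuous_on_cnj continuous_on_id)

lemma square_integrable_cnj:
  "square_integrable f \<Longrightarrow> square_integrable (\<lambda>x. cnj (f x))"
  using square_integrable_measurable[of f] by (rule_tac square_integrable_bound[of f _ 1]) auto

lemma square_integrable_indicator:
  fixes f :: "real \<Rightarrow> complex"
  assumes "square_integrable f" "A \<in> sets borel"
  shows "square_integrable (\<lambda>x. indicator A x * f x)"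
  using assms by (rule_tac square_integrable_mult_bounded[where C=1]) (auto split: split_indicator)

lemma square_integrable_reflect:
  fixes f :: "real \<Rightarrow> complex"
  assumes "square_integrable f"
  shows "square_integrable (\<lambda>x. f (- x))"
  using assms lborel_integrable_real_affine[OF square_integrable_integrable[OF assms], of "-1" 0]
  unfolding square_integrable_def by auto

lemma square_integrable_indicator_interval:
  "square_integrable (\<lambda>x. indicator {a..b} x :: complex)"
proof (rule square_integrableI)
  have "(\<integral>\<^sup>+ x. ennreal ((cmod (indicator {a..b} x))\<^sup>2) \<partial>lborel) = (\<integral>\<^sup>+ x. indicator {a..b} x \<partial>lborel)"
    by (intro nn_integral_cong) (auto split: split_indicator)
  also have "\<dots> < \<infinity>" by (simp add: emeasure_lborel_Icc_eq)
  finally show "(\<integral>\<^sup>+ x. ennreal ((cmod (indicator {a..b} x))\<^sup>2) \<partial>lborel) < \<infinity>" .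
qed simp

lemma L2_norm_eq:
  "square_integrable f \<Longrightarrow> L2_norm f = ennreal (sqrt (sq_norm f))" for f :: "real \<Rightarrow> complex"
  unfolding L2_norm_def sq_norm_def by simp

lemma integrable_mult_square_integrable:
  fixes f g :: "real \<Rightarrow> complex"
  assumes f: "square_integrable f" and g: "square_integrable g"
  shows "integrable lborel (\<lambda>x. f x * g x)"
proof (rule Bochner_Integration.integrable_bound)
  show "integrable lborel (\<lambda>x. (cmod (f x))\<^sup>2 + (cmod (g x))\<^sup>2)"
    using square_integrable_integrable[OF f] square_integrable_integrable[OF g] by simp
  show "AE x in lborel. norm (f x * g x) \<le> norm ((cmod (f x))\<^sup>2 + (cmod (g x))\<^sup>2)"
  proof (rule AE_I2)
    fix x
    have "2 * cmod (f x) * cmod (g x) \<le> (cmod (f x))\<^sup>2 + (cmod (g x))\<^sup>2"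
      by (rule sum_squares_bound)
    moreover have "0 \<le> cmod (f x) * cmod (g x)" by simp
    ultimately have "cmod (f x) * cmod (g x) \<le> (cmod (f x))\<^sup>2 + (cmod (g x))\<^sup>2"
      by linarith
    then show "norm (f x * g x) \<le> norm ((cmod (f x))\<^sup>2 + (cmod (g x))\<^sup>2)"
      by (simp add: norm_mult)
  qed
qed (use square_integrable_measurable[OF f] square_integrable_measurable[OF g] in auto)

lemma L2_pairing_le:
  assumes f: "square_integrable f" and g: "square_integrable g"
  shows "(cmod (L2_pairing f g))\<^sup>2 \<le> sq_norm f * sq_norm g"
proof -
  note [measurable] = square_integrable_measurable[OF f] square_integrable_measurable[OF g]
  have "ennreal ((cmod (L2_pairing f g))\<^sup>2) = (ennreal (cmod (L2_pairing f g)))\<^sup>2"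
    by (simp add: ennreal_power)
  also have "\<dots> \<le> (\<integral>\<^sup>+x. ennreal (cmod (f x * g x)) \<partial>lborel)\<^sup>2"
    unfolding L2_pairing_def
    by (intro power_mono integral_norm_bound_ennreal integrable_mult_square_integrable f g) auto
  also have "\<dots> = (\<integral>\<^sup>+x. ennreal (cmod (f x)) * ennreal (cmod (g x)) \<partial>lborel)\<^sup>2"
    by (simp add: norm_mult ennreal_mult')
  also have "\<dots> \<le> (\<integral>\<^sup>+x. (ennreal (cmod (f x)))\<^sup>2 \<partial>lborel) * (\<integral>\<^sup>+x. (ennreal (cmod (g x)))\<^sup>2 \<partial>lborel)"
    by (rule Cauchy_Schwarz_nn_integral) auto
  also have "\<dots> = ennreal (sq_norm f * sq_norm g)"
    using square_integrable_nn[OF f] square_integrable_nn[OF g] by (simp add: ennreal_power ennreal_mult')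
  finally show ?thesis by (simp add: ennreal_le_iff)
qed

lemma L2_pairing_commute: "L2_pairing f g = L2_pairing g f"
  unfolding L2_pairing_def by (simp add: mult.commute)

lemma L2_pairing_add_left:
  "square_integrable f \<Longrightarrow> square_integrable g \<Longrightarrow> square_integrable h \<Longrightarrow>
    L2_pairing (\<lambda>x. f x + g x) h = L2_pairing f h + L2_pairing g h"
  unfolding L2_pairing_def
  by (simp add: distrib_right integrable_mult_square_integrable)

lemma L2_pairing_diff_left:
  "square_integrable f \<Longrightarrow> square_integrable g \<Longrightarrow> square_integrable h \<Longrightarrow>
    L2_pairing (\<lambda>x. f x - g x) h = L2_pairing f h - L2_pairing g h"
  unfolding L2_pairing_def
  by (simp add: left_diff_distrib integrable_mult_square_integrable)

lemma L2_pairing_add_right: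
  "square_integrable f \<Longrightarrow> square_integrable g \<Longrightarrow> square_integrable h \<Longrightarrow>
    L2_pairing h (\<lambda>x. f x + g x) = L2_pairing h f + L2_pairing h g"
  by (simp add: L2_pairing_commute[of h] L2_pairing_add_left)

lemma L2_pairing_cmult_left: "L2_pairing (\<lambda>x. c * f x) h = c * L2_pairing f h"
  unfolding L2_pairing_def by (simp add: mult.assoc)

lemma L2_pairing_cmult_right: "L2_pairing h (\<lambda>x. c * f x) = c * L2_pairing h f"
  unfolding L2_pairing_def by (simp add: mult.left_commute)

lemma L2_pairing_self: "L2_pairing f (\<lambda>x. cnj (f x)) = complex_of_real (sq_norm f)"
proof -
  have "L2_pairing f (\<lambda>x. cnj (f x)) = (LINT x|lborel. complex_of_real ((cmod (f x))\<^sup>2))"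
    unfolding L2_pairing_def by (simp only: complex_norm_square)
  then show ?thesis
    unfolding sq_norm_def by (simp only: integral_complex_of_real)
qed

lemma L2_pairing_cnj: "L2_pairing (\<lambda>x. cnj (f x)) (\<lambda>x. cnj (g x)) = cnj (L2_pairing f g)"
  unfolding L2_pairing_def by (simp flip: complex_cnj_mult)

lemma sq_norm_cnj [simp]: "sq_norm (\<lambda>x. cnj (f x)) = sq_norm f"
  unfolding sq_norm_def by simp

lemma sq_norm_cmult: "sq_norm (\<lambda>x. c * f x) = (cmod c)\<^sup>2 * sq_norm f"
  unfolding sq_norm_def by (simp add: norm_mult power_mult_distrib)

lemma sq_norm_cong_AE:
  assumes "AE x in lborel. f x = g x" "f \<in> borel_measurable borel" "g \<in> borel_measurable borel"
  shows "sq_norm f = sq_norm g"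
  unfolding sq_norm_def using assms by (intro integral_cong_AE) (auto intro: measurable_compose)

lemma L2_pairing_cong_AE:
  assumes "AE x in lborel. f x = f' x" "AE x in lborel. g x = g' x"
    "f \<in> borel_measurable borel" "g \<in> borel_measurable borel"
    "f' \<in> borel_measurable borel" "g' \<in> borel_measurable borel"
  shows "L2_pairing f g = L2_pairing f' g'"
  unfolding L2_pairing_def using assms by (intro integral_cong_AE) auto

lemma sq_norm_eq_0_AE:
  assumes f: "square_integrable f" and "sq_norm f = 0"
  shows "AE x in lborel. f x = 0"
  using integral_nonneg_eq_0_iff_AE[OF square_integrable_integrable[OF f]] assms(2)
  unfolding sq_norm_def by simp

lemma sq_norm_add_eq:
  assumes f: "square_integrable f" and g: "square_integrable g"
  shows "sq_norm (\<lambda>x. f x + g x) = sq_norm f + 2 * Re (L2_pairing f (\<lambda>x. cnj (g x))) + sq_norm g"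
proof -
  note fg = f g square_integrable_cnj[OF f] square_integrable_cnj[OF g]
  have "complex_of_real (sq_norm (\<lambda>x. f x + g x)) = L2_pairing (\<lambda>x. f x + g x) (\<lambda>x. cnj (f x) + cnj (g x))"
    using L2_pairing_self[of "\<lambda>x. f x + g x"] by simp
  also have "\<dots> = sq_norm f + L2_pairing f (\<lambda>x. cnj (g x)) + cnj (L2_pairing f (\<lambda>x. cnj (g x))) + sq_norm g"
    using fg L2_pairing_cnj[of f "\<lambda>x. cnj (g x)"] L2_pairing_self[of g]
      L2_pairing_commute[of g "\<lambda>x. cnj (f x)"]
    by (simp add: L2_pairing_add_left L2_pairing_add_right square_integrable_add L2_pairing_self)
  finally have "Re (complex_of_real (sq_norm (\<lambda>x. f x + g x))) =
     Re (sq_norm f + L2_pairing f (\<lambda>x. cnj (g x)) + cnj (L2_pairing f (\<lambda>x. cnj (g x))) + sq_norm g)"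
    by (rule arg_cong)
  then show ?thesis by simp
qed

lemma sq_norm_diff_commute: "sq_norm (\<lambda>x. f x - g x) = sq_norm (\<lambda>x. g x - f x)"
  unfolding sq_norm_def by (simp add: norm_minus_commute)

text \<open>The parallelogram identity with the difference term dropped. It stands in for the
  triangle inequality, so that no square roots are needed in the limit arguments.\<close>

lemma sq_norm_add_le:
  assumes f: "square_integrable f" and g: "square_integrable g"
  shows "sq_norm (\<lambda>x. f x + g x) \<le> 2 * sq_norm f + 2 * sq_norm g"
proof -
  have "sq_norm (\<lambda>x. f x + g x) + sq_norm (\<lambda>x. f x - g x) = 2 * sq_norm f + 2 * sq_norm g"
    using sq_norm_add_eq[OF f g] sq_norm_add_eq[OF f square_integrable_minus[OF g]]
      L2_pairing_cmult_right[of f "-1" "\<lambda>x. cnj (g x)"] sq_norm_cmult[of "-1" g] by simp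
  then show ?thesis using sq_norm_nonneg[of "\<lambda>x. f x - g x"] by linarith
qed

lemma tendsto_0_squeeze:
  fixes a b :: "nat \<Rightarrow> real"
  assumes "\<And>n. 0 \<le> a n" "\<And>n. a n \<le> b n" "b \<longlonglongrightarrow> 0"
  shows "a \<longlonglongrightarrow> 0"
  using assms by (rule_tac real_tendsto_sandwich[OF _ _ tendsto_const]) auto

lemma L2_pairing_tendsto:
  assumes f: "\<And>n. square_integrable (f n)" "square_integrable f'" and g: "square_integrable g"
    and lim: "(\<lambda>n. sq_norm (\<lambda>x. f n x - f' x)) \<longlonglongrightarrow> 0"
  shows "(\<lambda>n. L2_pairing (f n) g) \<longlonglongrightarrow> L2_pairing f' g"
proof -
  have "(\<lambda>n. (cmod (L2_pairing (f n) g - L2_pairing f' g))\<^sup>2) \<longlonglongrightarrow> 0"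
  proof (rule real_tendsto_sandwich[OF _ _ tendsto_const])
    show "(\<lambda>n. sq_norm (\<lambda>x. f n x - f' x) * sq_norm g) \<longlonglongrightarrow> 0"
      using tendsto_mult_right[OF lim] by simp
    show "\<forall>\<^sub>F n in sequentially. (cmod (L2_pairing (f n) g - L2_pairing f' g))\<^sup>2
        \<le> sq_norm (\<lambda>x. f n x - f' x) * sq_norm g"
      using L2_pairing_le[OF square_integrable_diff[OF f(1) f(2)] g]
      by (auto simp: L2_pairing_diff_left f g)
  qed auto
  then have "(\<lambda>n. cmod (L2_pairing (f n) g - L2_pairing f' g)) \<longlonglongrightarrow> 0"
    using tendsto_real_sqrt by fastforce
  then show ?thesis using LIM_zero_iff tendsto_norm_zero_iff by blast
qed

lemma sq_norm_tendsto:
  assumes f: "\<And>n. square_integrable (f n)" "square_integrable f'"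
    and lim: "(\<lambda>n. sq_norm (\<lambda>x. f n x - f' x)) \<longlonglongrightarrow> 0"
  shows "(\<lambda>n. sq_norm (f n)) \<longlonglongrightarrow> sq_norm f'"
proof -
  \<comment> \<open>Expanding around the limit leaves, besides the vanishing term, only a pairing
    with the fixed function \<open>f'\<close>, which converges by
    \<open>L2_pairing_tendsto\<close>.\<close>
  have eq: "sq_norm (f n) = sq_norm (\<lambda>x. f n x - f' x) + 2 * Re (L2_pairing (f n) (\<lambda>x. cnj (f' x))
      - sq_norm f') + sq_norm f'" for n
    using sq_norm_add_eq[OF square_integrable_diff[OF f(1) f(2)] f(2)]
    by (simp add: L2_pairing_diff_left f square_integrable_cnj L2_pairing_self)
  have "(\<lambda>n. L2_pairing (f n) (\<lambda>x. cnj (f' x))) \<longlonglongrightarrow> L2_pairing f' (\<lambda>x. cnj (f' x))"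
    by (intro L2_pairing_tendsto f lim square_integrable_cnj)
  then have "(\<lambda>n. L2_pairing (f n) (\<lambda>x. cnj (f' x))) \<longlonglongrightarrow> sq_norm f'"
    by (simp add: L2_pairing_self)
  then have "(\<lambda>n. sq_norm (\<lambda>x. f n x - f' x) + 2 * Re (L2_pairing (f n) (\<lambda>x. cnj (f' x)) - sq_norm f')
     + sq_norm f') \<longlonglongrightarrow> 0 + 2 * Re (complex_of_real (sq_norm f') - sq_norm f') + sq_norm f'"
    by (intro tendsto_intros lim)
  then show ?thesis unfolding eq[symmetric] by simp
qed

subsection \<open>Fourier integrals\<close>

definition fourier_integral :: "(real \<Rightarrow> complex) \<Rightarrow> real \<Rightarrow> complex" where
  "fourier_integral f \<xi> = (LINT x|lborel. f x * cis (- (x * \<xi>)))"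

lemma borel_measurable_cis [measurable]: "cis \<in> borel_measurable borel"
  by (intro borel_measurable_continuous_onI continuous_on_cis continuous_on_id)

text \<open>The Bochner integral of a non-integrable function is 0 by convention, so the bound is
  trivial in that case.\<close>

lemma integral_norm_bound_ennreal':
  fixes f :: "'a \<Rightarrow> 'b::{banach, second_countable_topology}"
  shows "ennreal (norm (integral\<^sup>L M f)) \<le> (\<integral>\<^sup>+x. ennreal (norm (f x)) \<partial>M)"
  by (cases "integrable M f") (simp_all add: integral_norm_bound_ennreal not_integrable_integral_eq)

lemma measurable_fourier_integral:
  assumes [measurable]: "f \<in> borel_measurable borel"
  shows "fourier_integral f \<in> borel_measurable borel"
  unfolding fourier_integral_def [abs_def]
  by (rule lborel.borel_measurable_lebesgue_integral) measurable

lemma integrable_mult_cis: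
  assumes "integrable lborel f" "h \<in> borel_measurable borel"
  shows "integrable lborel (\<lambda>x. f x * cis (h x))"
proof (rule Bochner_Integration.integrable_bound[OF assms(1)])
  have [measurable]: "f \<in> borel_measurable borel" "h \<in> borel_measurable borel" using assms by auto
  show "(\<lambda>x. f x * cis (h x)) \<in> borel_measurable lborel" by measurable
qed (simp add: norm_mult)

lemma norm_fourier_integral_le:
  "cmod (fourier_integral f \<xi>) \<le> (LINT x|lborel. cmod (f x))"
  unfolding fourier_integral_def
  by (rule order_trans[OF integral_norm_bound]) (simp add: norm_mult)

lemma fourier_integral_diff:
  "integrable lborel f \<Longrightarrow> integrable lborel g \<Longrightarrow>
    fourier_integral (\<lambda>x. f x - g x) \<xi> = fourier_integral f \<xi> - fourier_integral g \<xi>"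
  unfolding fourier_integral_def
  by (simp add: left_diff_distrib integrable_mult_cis)

lemma fourier_integral_cnj: "fourier_integral (\<lambda>x. cnj (f x)) \<xi> = cnj (fourier_integral f (- \<xi>))"
  unfolding fourier_integral_def
  using Bochner_Integration.integral_cnj[of lborel "\<lambda>x. f x * cis (x * \<xi>)"] by (simp add: cis_cnj)

text \<open>Fubini for \<open>f x * g \<xi> * cis (- (x * \<xi>))\<close>, integrable on the plane
  because the last factor has modulus 1. There is no conjugation: the transform is symmetric for the
  bilinear pairing.\<close>

lemma fourier_integral_multiplication_formula:
  assumes f: "integrable lborel f" and g: "integrable lborel g"
  shows "(LINT \<xi>|lborel. g \<xi> * fourier_integral f \<xi>) = (LINT x|lborel. f x * fourier_integral g x)"
proof -
  let ?h = "\<lambda>x \<xi>. f x * g \<xi> * cis (- (x * \<xi>))"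
  have [measurable]: "f \<in> borel_measurable borel" "g \<in> borel_measurable borel" using f g by auto
  have int: "integrable (lborel \<Otimes>\<^sub>M lborel) (case_prod ?h)"
  proof (rule lborel_pair.Fubini_integrable)
    show "case_prod ?h \<in> borel_measurable (lborel \<Otimes>\<^sub>M lborel)" by measurable
    show "integrable lborel (\<lambda>x. LINT y|lborel. norm (case (x, y) of (x, \<xi>) \<Rightarrow> ?h x \<xi>))"
      using f by (simp add: norm_mult)
    show "AE x in lborel. integrable lborel (\<lambda>y. case (x, y) of (x, \<xi>) \<Rightarrow> ?h x \<xi>)"
      using g by (simp add: mult.assoc integrable_mult_cis)
  qed
  have "(LINT \<xi>|lborel. g \<xi> * fourier_integral f \<xi>) = (LINT \<xi>|lborel. LINT x|lborel. ?h x \<xi>)"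
    unfolding fourier_integral_def by (simp add: mult_ac flip: integral_mult_right_zero)
  also have "\<dots> = (LINT x|lborel. LINT \<xi>|lborel. ?h x \<xi>)"
    by (rule lborel_pair.Fubini_integral[OF int])
  also have "\<dots> = (LINT x|lborel. f x * fourier_integral g x)"
    unfolding fourier_integral_def by (simp add: mult_ac flip: integral_mult_right_zero)
  finally show ?thesis .
qed

text \<open>The characteristic function of the standard normal law, dilated by \<sigma>.\<close>

lemma fourier_integral_normal_density:
  assumes "0 < \<sigma>"
  shows "fourier_integral (\<lambda>x. complex_of_real (normal_density 0 \<sigma> x)) \<xi> = exp (- (\<sigma> * \<xi>)\<^sup>2 / 2)"
proof -
  have "char std_normal_distribution (- (\<sigma> * \<xi>)) =
      (LINT x|lborel. std_normal_density x *\<^sub>R iexp (- (\<sigma> * \<xi>) * x))"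
    unfolding char_def by (subst integral_density) auto
  also have "\<dots> = (LINT x|lborel. \<bar>\<sigma>\<bar> *\<^sub>R (complex_of_real (normal_density 0 \<sigma> (0 + \<sigma> * x)) * cis (- ((0 + \<sigma> * x) * \<xi>))))"
  proof (intro Bochner_Integration.integral_cong refl)
    fix x
    have "std_normal_density x = \<sigma> * normal_density 0 \<sigma> (\<sigma> * x)"
      using assms unfolding normal_density_def
      by (simp add: real_sqrt_mult power_mult_distrib field_simps)
    then show "std_normal_density x *\<^sub>R iexp (- (\<sigma> * \<xi>) * x) =
      \<bar>\<sigma>\<bar> *\<^sub>R (complex_of_real (normal_density 0 \<sigma> (0 + \<sigma> * x)) * cis (- ((0 + \<sigma> * x) * \<xi>)))"
      using assms by (simp add: cis_conv_exp scaleR_conv_of_real mult_ac)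
  qed
  also have "\<dots> = \<bar>\<sigma>\<bar> *\<^sub>R (LINT x|lborel. complex_of_real (normal_density 0 \<sigma> (0 + \<sigma> * x)) * cis (- ((0 + \<sigma> * x) * \<xi>)))"
    by (rule integral_scaleR_right)
  also have "\<dots> = fourier_integral (\<lambda>x. complex_of_real (normal_density 0 \<sigma> x)) \<xi>"
    unfolding fourier_integral_def
    using lborel_integral_real_affine[of \<sigma> "\<lambda>x. complex_of_real (normal_density 0 \<sigma> x) * cis (- (x * \<xi>))" 0] assms
    by simp
  finally show ?thesis
    by (simp add: char_std_normal_distribution)
qed

section \<open>Bessel's inequality by Gaussian regularisation\<close>

lemma nn_integral_gaussian:
  assumes "0 < \<sigma>"
  shows "(\<integral>\<^sup>+x. ennreal (exp (- (\<sigma> * (x - a))\<^sup>2 / 2)) \<partial>lborel) = ennreal (sqrt (2 * pi) / \<sigma>)"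
proof -
  have "(\<integral>\<^sup>+x. ennreal (exp (- (\<sigma> * (x - a))\<^sup>2 / 2)) \<partial>lborel)
     = (\<integral>\<^sup>+x. ennreal (sqrt (2 * pi) / \<sigma>) * ennreal (normal_density a (1 / \<sigma>) x) \<partial>lborel)"
  proof (intro nn_integral_cong)
    fix x
    have "exp (- (\<sigma> * (x - a))\<^sup>2 / 2) = (sqrt (2 * pi) / \<sigma>) * normal_density a (1 / \<sigma>) x"
      using assms unfolding normal_density_def
      by (simp add: real_sqrt_mult real_sqrt_divide power_mult_distrib power_divide mult.commute)
    then show "ennreal (exp (- (\<sigma> * (x - a))\<^sup>2 / 2)) =
        ennreal (sqrt (2 * pi) / \<sigma>) * ennreal (normal_density a (1 / \<sigma>) x)"
      using ennreal_mult'[of "sqrt (2 * pi) / \<sigma>" "normal_density a (1 / \<sigma>) x"] assms by simp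
  qed
  also have "\<dots> = ennreal (sqrt (2 * pi) / \<sigma>) * (\<integral>\<^sup>+x. ennreal (normal_density a (1 / \<sigma>) x) \<partial>lborel)"
    by (rule nn_integral_cmult) simp
  also have "(\<integral>\<^sup>+x. ennreal (normal_density a (1 / \<sigma>) x) \<partial>lborel) = 1"
    using assms by (subst nn_integral_eq_integral) auto
  finally show ?thesis by simp
qed

text \<open>The Gaussian weight makes the triple integral behind |transform|^2 absolutely
  convergent. Transforming it produces a convolution kernel \<open>?K\<close> of mass sqrt (2 pi) /
  \<sigma>, and the normalisation of the density contributes sqrt (2 pi) \<sigma>; the product is 2
  pi, uniformly in \<sigma>.\<close>

lemma gaussian_regularized_bessel:
  assumes f: "integrable lborel f" "square_integrable f" and \<sigma>: "0 < \<sigma>"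
  shows "(\<integral>\<^sup>+\<xi>. ennreal (exp (- (\<xi> / \<sigma>)\<^sup>2 / 2) * (cmod (fourier_integral f \<xi>))\<^sup>2) \<partial>lborel)
     \<le> ennreal (2 * pi * sq_norm f)"
proof -
  have [measurable]: "f \<in> borel_measurable borel" using f by auto
  let ?F = "fourier_integral f"
  let ?K = "\<lambda>z. exp (- (\<sigma> * z)\<^sup>2 / 2)"
  note [measurable] = measurable_fourier_integral[of f]
  define nd where "nd = normal_density 0 \<sigma>"
  have nd[measurable]: "nd \<in> borel_measurable borel" unfolding nd_def by simp
  have nd0: "nd x \<ge> 0" for x unfolding nd_def by simp
  have ndi: "integrable lborel (\<lambda>x. complex_of_real (nd x))" unfolding nd_def using \<sigma> by auto
  define B where "B = (LINT x|lborel. cmod (f x))"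
  have B: "cmod (?F \<xi>) \<le> B" for \<xi> unfolding B_def by (rule norm_fourier_integral_le)
  have Gi: "integrable lborel (\<lambda>\<xi>. nd \<xi> * ?F \<xi>)"
  proof (rule Bochner_Integration.integrable_bound)
    show "integrable lborel (\<lambda>x. B * complex_of_real (nd x))" using ndi by simp
    show "AE x in lborel. norm (nd x * ?F x) \<le> norm (B * complex_of_real (nd x))"
    proof (rule AE_I2)
      fix x
      have "cmod (?F x) \<le> \<bar>B\<bar>" using B[of x] by linarith
      then show "norm (nd x * ?F x) \<le> norm (B * complex_of_real (nd x))"
        using nd0[of x] mult_left_mono[of "cmod (?F x)" "\<bar>B\<bar>" "nd x"] by (simp add: norm_mult mult.commute)
    qed
  qed measurable
  have G'i: "integrable lborel (\<lambda>\<xi>. cnj (nd \<xi> * ?F \<xi>))"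
    using Gi by (simp only: integrable_cnj)
  \<comment> \<open>The multiplication formula moves the transform from \<open>f\<close> onto the
    modulated density, where it is an explicit Gaussian centred at \<open>x\<close>.\<close>
  have inner: "fourier_integral (\<lambda>\<xi>. cnj (nd \<xi> * ?F \<xi>)) x = cnj (LINT y|lborel. f y * ?K (y - x))" for x
  proof -
    have i: "integrable lborel (\<lambda>\<xi>. complex_of_real (nd \<xi>) * cis (x * \<xi>))"
      by (rule integrable_mult_cis[OF ndi]) simp
    have "fourier_integral (\<lambda>\<xi>. cnj (nd \<xi> * ?F \<xi>)) x = cnj (fourier_integral (\<lambda>\<xi>. nd \<xi> * ?F \<xi>) (- x))"
      by (rule fourier_integral_cnj)
    also have "fourier_integral (\<lambda>\<xi>. nd \<xi> * ?F \<xi>) (- x) =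
        (LINT \<xi>|lborel. (complex_of_real (nd \<xi>) * cis (x * \<xi>)) * ?F \<xi>)"
      unfolding fourier_integral_def[of _ "- x"] by (simp add: mult_ac)
    also have "\<dots> = (LINT y|lborel. f y * fourier_integral (\<lambda>\<xi>. complex_of_real (nd \<xi>) * cis (x * \<xi>)) y)"
      by (rule fourier_integral_multiplication_formula[OF f(1) i])
    also have "(\<lambda>y. fourier_integral (\<lambda>\<xi>. complex_of_real (nd \<xi>) * cis (x * \<xi>)) y) = (\<lambda>y. complex_of_real (?K (y - x)))"
    proof
      fix y
      have "fourier_integral (\<lambda>\<xi>. complex_of_real (nd \<xi>) * cis (x * \<xi>)) y = fourier_integral (\<lambda>\<xi>. complex_of_real (nd \<xi>)) (y - x)"
        unfolding fourier_integral_def by (simp add: mult.assoc cis_mult algebra_simps)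
      then show "fourier_integral (\<lambda>\<xi>. complex_of_real (nd \<xi>) * cis (x * \<xi>)) y = complex_of_real (?K (y - x))"
        unfolding nd_def using fourier_integral_normal_density[OF \<sigma>] by simp
    qed
    finally show ?thesis .
  qed
  have Ii: "integrable lborel (\<lambda>\<xi>. nd \<xi> * (cmod (?F \<xi>))\<^sup>2)"
  proof (rule Bochner_Integration.integrable_bound)
    show "integrable lborel (\<lambda>x. B * (nd x * ?F x))" using Gi by simp
    show "AE x in lborel. norm (nd x * (cmod (?F x))\<^sup>2) \<le> norm (B * (nd x * ?F x))"
    proof (rule AE_I2)
      fix x
      have "nd x * cmod (?F x) * cmod (?F x) \<le> nd x * cmod (?F x) * \<bar>B\<bar>"
        using B[of x] nd0[of x] by (intro mult_left_mono) auto
      then show "norm (nd x * (cmod (?F x))\<^sup>2) \<le> norm (B * (nd x * ?F x))"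
        using nd0[of x] by (simp add: norm_mult power2_eq_square mult_ac)
    qed
  qed measurable
  define I where "I = (LINT \<xi>|lborel. nd \<xi> * (cmod (?F \<xi>))\<^sup>2)"
  have "complex_of_real I = (LINT \<xi>|lborel. complex_of_real (nd \<xi> * (cmod (?F \<xi>))\<^sup>2))"
    unfolding I_def by (rule integral_complex_of_real[symmetric])
  also have "\<dots> = (LINT \<xi>|lborel. cnj (nd \<xi> * ?F \<xi>) * ?F \<xi>)"
    by (intro Bochner_Integration.integral_cong refl)
       (simp only: of_real_mult complex_norm_square complex_cnj_mult complex_cnj_complex_of_real mult_ac)
  also have "\<dots> = (LINT x|lborel. f x * fourier_integral (\<lambda>\<xi>. cnj (nd \<xi> * ?F \<xi>)) x)"
    by (rule fourier_integral_multiplication_formula[OF f(1) G'i])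
  finally have I: "complex_of_real I = (LINT x|lborel. f x * cnj (LINT y|lborel. f y * ?K (y - x)))"
    unfolding inner .
  have "ennreal I \<le> (\<integral>\<^sup>+x. ennreal (cmod (f x * cnj (LINT y|lborel. f y * ?K (y - x)))) \<partial>lborel)"
  proof -
    have "ennreal I \<le> ennreal (cmod (complex_of_real I))"
      by (intro ennreal_leI) simp
    also have "\<dots> \<le> (\<integral>\<^sup>+x. ennreal (cmod (f x * cnj (LINT y|lborel. f y * ?K (y - x)))) \<partial>lborel)"
      unfolding I by (rule integral_norm_bound_ennreal')
    finally show ?thesis .
  qed
  also have "\<dots> \<le> (\<integral>\<^sup>+x. \<integral>\<^sup>+y. ennreal (cmod (f x) * cmod (f y) * ?K (y - x)) \<partial>lborel \<partial>lborel)"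
  proof (intro nn_integral_mono)
    fix x
    have "ennreal (cmod (f x * cnj (LINT y|lborel. f y * ?K (y - x)))) =
        ennreal (cmod (f x)) * ennreal (cmod (LINT y|lborel. f y * ?K (y - x)))"
      by (simp add: norm_mult ennreal_mult')
    also have "\<dots> \<le> ennreal (cmod (f x)) * (\<integral>\<^sup>+y. ennreal (cmod (f y * ?K (y - x))) \<partial>lborel)"
      by (intro mult_left_mono integral_norm_bound_ennreal') simp
    also have "\<dots> = (\<integral>\<^sup>+y. ennreal (cmod (f x)) * ennreal (cmod (f y * ?K (y - x))) \<partial>lborel)"
      by (rule nn_integral_cmult[symmetric]) measurable
    also have "\<dots> = (\<integral>\<^sup>+y. ennreal (cmod (f x) * cmod (f y) * ?K (y - x)) \<partial>lborel)"
      by (intro nn_integral_cong) (simp add: norm_mult ennreal_mult' mult_ac)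
    finally show "ennreal (cmod (f x * cnj (LINT y|lborel. f y * ?K (y - x)))) \<le>
        (\<integral>\<^sup>+y. ennreal (cmod (f x) * cmod (f y) * ?K (y - x)) \<partial>lborel)" .
  qed
  \<comment> \<open>Instead of Young's inequality: after bounding the product by half the sum of
    squares, one variable in each term occurs only in \<open>?K\<close> and can be integrated
    out.\<close>
  also have "\<dots> \<le> (\<integral>\<^sup>+x. \<integral>\<^sup>+y. ennreal ((cmod (f x))\<^sup>2 / 2) * ennreal (?K (y - x)) +
       ennreal ((cmod (f y))\<^sup>2 / 2) * ennreal (?K (y - x)) \<partial>lborel \<partial>lborel)"
  proof (intro nn_integral_mono)
    fix x y
    have "cmod (f x) * cmod (f y) \<le> (cmod (f x))\<^sup>2 / 2 + (cmod (f y))\<^sup>2 / 2"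
      using sum_squares_bound[of "cmod (f x)" "cmod (f y)"] by simp
    from mult_right_mono[OF this, of "?K (y - x)"]
    have "ennreal (cmod (f x) * cmod (f y) * ?K (y - x)) \<le>
       ennreal ((cmod (f x))\<^sup>2 / 2 * ?K (y - x) + (cmod (f y))\<^sup>2 / 2 * ?K (y - x))"
      by (intro ennreal_leI) (simp add: distrib_right)
    also have "\<dots> = ennreal ((cmod (f x))\<^sup>2 / 2) * ennreal (?K (y - x)) +
       ennreal ((cmod (f y))\<^sup>2 / 2) * ennreal (?K (y - x))"
      by (simp only: ennreal_plus ennreal_mult' exp_ge_zero zero_le_power2 mult_nonneg_nonneg
          divide_nonneg_nonneg zero_le_numeral)
    finally show "ennreal (cmod (f x) * cmod (f y) * ?K (y - x)) \<le> ennreal ((cmod (f x))\<^sup>2 / 2) * ennreal (?K (y - x)) +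
       ennreal ((cmod (f y))\<^sup>2 / 2) * ennreal (?K (y - x))" .
  qed
  also have "\<dots> = (\<integral>\<^sup>+x. \<integral>\<^sup>+y. ennreal ((cmod (f x))\<^sup>2 / 2) * ennreal (?K (y - x)) \<partial>lborel \<partial>lborel) +
       (\<integral>\<^sup>+x. \<integral>\<^sup>+y. ennreal ((cmod (f y))\<^sup>2 / 2) * ennreal (?K (y - x)) \<partial>lborel \<partial>lborel)"
    by (subst nn_integral_add[symmetric]; (measurable; simp)?)
       (intro nn_integral_cong nn_integral_add; measurable)
  also have "(\<integral>\<^sup>+x. \<integral>\<^sup>+y. ennreal ((cmod (f y))\<^sup>2 / 2) * ennreal (?K (y - x)) \<partial>lborel \<partial>lborel) =
      (\<integral>\<^sup>+y. \<integral>\<^sup>+x. ennreal ((cmod (f y))\<^sup>2 / 2) * ennreal (?K (x - y)) \<partial>lborel \<partial>lborel)"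
    by (subst lborel_pair.Fubini') (measurable, simp add: power2_commute power_mult_distrib)
  also have "(\<integral>\<^sup>+x. \<integral>\<^sup>+y. ennreal ((cmod (f x))\<^sup>2 / 2) * ennreal (?K (y - x)) \<partial>lborel \<partial>lborel) + \<dots>
     = ennreal (sq_norm f / 2) * ennreal (sqrt (2 * pi) / \<sigma>) + ennreal (sq_norm f / 2) * ennreal (sqrt (2 * pi) / \<sigma>)"
  proof -
    have "(\<integral>\<^sup>+x. \<integral>\<^sup>+y. ennreal ((cmod (f x))\<^sup>2 / 2) * ennreal (?K (y - x)) \<partial>lborel \<partial>lborel)
       = (\<integral>\<^sup>+x. ennreal ((cmod (f x))\<^sup>2 / 2) * ennreal (sqrt (2 * pi) / \<sigma>) \<partial>lborel)"
      by (intro nn_integral_cong, subst nn_integral_cmult) (measurable, simp only: nn_integral_gaussian[OF \<sigma>])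
    also have "\<dots> = (\<integral>\<^sup>+x. ennreal ((cmod (f x))\<^sup>2 / 2) \<partial>lborel) * ennreal (sqrt (2 * pi) / \<sigma>)"
      by (rule nn_integral_multc) measurable
    also have "(\<integral>\<^sup>+x. ennreal ((cmod (f x))\<^sup>2 / 2) \<partial>lborel) = ennreal (sq_norm f / 2)"
      unfolding sq_norm_def using square_integrable_integrable[OF f(2)]
      by (subst nn_integral_eq_integral) auto
    finally show ?thesis by simp
  qed
  also have "\<dots> = ennreal (sq_norm f * (sqrt (2 * pi) / \<sigma>))"
    using \<sigma> by (simp flip: ennreal_mult' ennreal_plus)
  finally have I_le: "I \<le> sq_norm f * (sqrt (2 * pi) / \<sigma>)"
    using \<sigma> by (simp add: ennreal_le_iff)
  have "(\<integral>\<^sup>+\<xi>. ennreal (exp (- (\<xi> / \<sigma>)\<^sup>2 / 2) * (cmod (?F \<xi>))\<^sup>2) \<partial>lborel)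
     = (\<integral>\<^sup>+\<xi>. ennreal (sqrt (2 * pi) * \<sigma> * (nd \<xi> * (cmod (?F \<xi>))\<^sup>2)) \<partial>lborel)"
    using \<sigma> unfolding nd_def normal_density_def
    by (intro nn_integral_cong) (simp add: real_sqrt_mult power_divide)
  also have "\<dots> = ennreal (sqrt (2 * pi) * \<sigma> * I)"
    unfolding I_def using Ii \<sigma> nd0
    by (subst nn_integral_eq_integral) (auto intro!: always_eventually mult_nonneg_nonneg)
  also have "\<dots> \<le> ennreal (2 * pi * sq_norm f)"
  proof (intro ennreal_leI)
    have "sqrt (2 * pi) * \<sigma> * I \<le> sqrt (2 * pi) * \<sigma> * (sq_norm f * (sqrt (2 * pi) / \<sigma>))"
      using I_le \<sigma> by (intro mult_left_mono) auto
    also have "\<dots> = 2 * pi * sq_norm f" using \<sigma> by (simp add: field_simps)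
    finally show "sqrt (2 * pi) * \<sigma> * I \<le> 2 * pi * sq_norm f" .
  qed
  finally show ?thesis .
qed

text \<open>With \<sigma> = n + 1 the Gaussian weight tends to 1, and Fatou's lemma preserves the
  uniform bound.\<close>

lemma fourier_integral_bessel:
  assumes f: "integrable lborel f" "square_integrable f"
  shows "square_integrable (fourier_integral f)" "sq_norm (fourier_integral f) \<le> 2 * pi * sq_norm f"
proof -
  have [measurable]: "f \<in> borel_measurable borel" using f by auto
  note [measurable] = measurable_fourier_integral[of f]
  let ?g = "\<lambda>n \<xi>. ennreal (exp (- (\<xi> / real (Suc n))\<^sup>2 / 2) * (cmod (fourier_integral f \<xi>))\<^sup>2)"
  have "(\<integral>\<^sup>+\<xi>. ennreal ((cmod (fourier_integral f \<xi>))\<^sup>2) \<partial>lborel) = (\<integral>\<^sup>+\<xi>. liminf (\<lambda>n. ?g n \<xi>) \<partial>lborel)"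
  proof (intro nn_integral_cong)
    fix \<xi>
    have "(\<lambda>n. \<xi> / real (Suc n)) \<longlonglongrightarrow> 0"
      using LIMSEQ_Suc[OF lim_const_over_n[of \<xi>]] .
    then have "(\<lambda>n. exp (- (\<xi> / real (Suc n))\<^sup>2 / 2) * (cmod (fourier_integral f \<xi>))\<^sup>2) \<longlonglongrightarrow>
        exp (- 0\<^sup>2 / 2) * (cmod (fourier_integral f \<xi>))\<^sup>2"
      by (intro tendsto_intros) auto
    then have "(\<lambda>n. ?g n \<xi>) \<longlonglongrightarrow> ennreal ((cmod (fourier_integral f \<xi>))\<^sup>2)"
      by (intro tendsto_ennrealI) simp
    from lim_imp_Liminf[OF sequentially_bot this]
    show "ennreal ((cmod (fourier_integral f \<xi>))\<^sup>2) = liminf (\<lambda>n. ?g n \<xi>)"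
      by (rule sym)
  qed
  also have "\<dots> \<le> liminf (\<lambda>n. \<integral>\<^sup>+\<xi>. ?g n \<xi> \<partial>lborel)"
    by (rule nn_integral_liminf) measurable
  also have "\<dots> \<le> ennreal (2 * pi * sq_norm f)"
    by (rule order_trans[OF Liminf_mono[where g="\<lambda>_. ennreal (2 * pi * sq_norm f)"]])
       (intro always_eventually allI gaussian_regularized_bessel f, simp_all add: Liminf_const)
  finally have le: "(\<integral>\<^sup>+\<xi>. ennreal ((cmod (fourier_integral f \<xi>))\<^sup>2) \<partial>lborel) \<le> ennreal (2 * pi * sq_norm f)" .
  show s: "square_integrable (fourier_integral f)"
    by (rule square_integrableI) (use le in \<open>auto simp: less_top[symmetric] top_unique\<close>)
  show "sq_norm (fourier_integral f) \<le> 2 * pi * sq_norm f"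
    using le unfolding square_integrable_nn[OF s] by (simp add: ennreal_le_iff)
qed

subsection \<open>The Fourier transform on square-integrable functions\<close>

definition cutoff :: "nat \<Rightarrow> (real \<Rightarrow> complex) \<Rightarrow> real \<Rightarrow> complex" where
  "cutoff n f x = indicator {- real n..real n} x * f x"

lemma truncated_fourier_eq: "truncated_fourier n f = fourier_integral (cutoff n f)"
  unfolding truncated_fourier_def fourier_integral_def cutoff_def set_lebesgue_integral_def
  by (intro ext Bochner_Integration.integral_cong) (auto split: split_indicator)

lemma integrable_cutoff: "square_integrable f \<Longrightarrow> integrable lborel (cutoff n f)"
  unfolding cutoff_def [abs_def]
  by (rule integrable_mult_square_integrable[OF square_integrable_indicator_interval])

lemma square_integrable_cutoff: "square_integrable f \<Longrightarrow> square_integrable (cutoff n f)"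
  unfolding cutoff_def [abs_def] by (rule square_integrable_indicator) auto

lemma cutoff_tendsto:
  assumes f: "square_integrable f"
  shows "(\<lambda>n. sq_norm (\<lambda>x. cutoff n f x - f x)) \<longlonglongrightarrow> 0"
proof -
  note [measurable] = square_integrable_measurable[OF f]
  have "(\<lambda>n. LINT x|lborel. (cmod (cutoff n f x - f x))\<^sup>2) \<longlonglongrightarrow> (LINT x::real|lborel. (0::real))"
  proof (rule Bochner_Integration.integral_dominated_convergence[where w="\<lambda>x. (cmod (f x))\<^sup>2"])
    show "AE x in lborel. (\<lambda>n. (cmod (cutoff n f x - f x))\<^sup>2) \<longlonglongrightarrow> 0"
    proof (rule AE_I2)
      fix x
      have "eventually (\<lambda>n. \<bar>x\<bar> \<le> real n) sequentially"
        by (metis eventually_sequentiallyI nat_ceiling_le_eq)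
      then have "eventually (\<lambda>n. (cmod (cutoff n f x - f x))\<^sup>2 = 0) sequentially"
        by (rule eventually_mono) (auto simp: cutoff_def indicator_def split: if_splits)
      then show "(\<lambda>n. (cmod (cutoff n f x - f x))\<^sup>2) \<longlonglongrightarrow> 0"
        by (rule tendsto_eventually)
    qed
    show "AE x in lborel. norm ((cmod (cutoff n f x - f x))\<^sup>2) \<le> (cmod (f x))\<^sup>2" for n
      by (rule AE_I2) (auto simp: cutoff_def split: split_indicator)
  qed (use square_integrable_integrable[OF f] in \<open>auto simp: cutoff_def\<close>)
  then show ?thesis unfolding sq_norm_def by simp
qed

lemma square_integrable_truncated_fourier:
  "square_integrable f \<Longrightarrow> square_integrable (truncated_fourier n f)"
  unfolding truncated_fourier_eq
  by (intro fourier_integral_bessel integrable_cutoff square_integrable_cutoff)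

lemma truncated_fourier_bessel:
  "square_integrable f \<Longrightarrow> sq_norm (truncated_fourier n f) \<le> 2 * pi * sq_norm (cutoff n f)"
  unfolding truncated_fourier_eq
  by (intro fourier_integral_bessel integrable_cutoff square_integrable_cutoff)

lemma truncated_fourier_cauchy:
  assumes f: "square_integrable f"
  shows "sq_norm (\<lambda>\<xi>. truncated_fourier m f \<xi> - truncated_fourier n f \<xi>) \<le>
    4 * pi * (sq_norm (\<lambda>x. cutoff m f x - f x) + sq_norm (\<lambda>x. cutoff n f x - f x))"
proof -
  note c = square_integrable_cutoff[OF f]
  have "(\<lambda>\<xi>. truncated_fourier m f \<xi> - truncated_fourier n f \<xi>) = fourier_integral (\<lambda>x. cutoff m f x - cutoff n f x)"
    unfolding truncated_fourier_eq by (intro ext) (simp add: fourier_integral_diff integrable_cutoff f)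
  then have "sq_norm (\<lambda>\<xi>. truncated_fourier m f \<xi> - truncated_fourier n f \<xi>)
      \<le> 2 * pi * sq_norm (\<lambda>x. cutoff m f x - cutoff n f x)"
    by (simp add: fourier_integral_bessel(2) integrable_cutoff f square_integrable_diff c)
  also have "sq_norm (\<lambda>x. cutoff m f x - cutoff n f x) = sq_norm (\<lambda>x. (cutoff m f x - f x) + (f x - cutoff n f x))"
    by simp
  also have "\<dots> \<le> 2 * sq_norm (\<lambda>x. cutoff m f x - f x) + 2 * sq_norm (\<lambda>x. f x - cutoff n f x)"
    by (intro sq_norm_add_le square_integrable_diff c f)
  also have "sq_norm (\<lambda>x. f x - cutoff n f x) = sq_norm (\<lambda>x. cutoff n f x - f x)"
    by (rule sq_norm_diff_commute)
  finally show ?thesis by (simp add: algebra_simps)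
qed

text \<open>With the cut-offs chosen fast, the truncated transforms converge pointwise almost everywhere.
  Since the choice can be made measurably in a parameter, this also provides jointly measurable
  transforms of functions of time and space.\<close>

lemma truncated_fourier_fast_limit:
  assumes f: "square_integrable f"
    and n: "\<And>k. sq_norm (\<lambda>x. cutoff (n k) f x - f x) \<le> (1/4) ^ k"
  defines "F \<equiv> \<lambda>\<xi>. lim (\<lambda>k. truncated_fourier (n k) f \<xi>)"
  shows "square_integrable F" "(\<lambda>m. sq_norm (\<lambda>\<xi>. truncated_fourier m f \<xi> - F \<xi>)) \<longlonglongrightarrow> 0"
proof -
  let ?\<delta> = "\<lambda>n. sq_norm (\<lambda>x. cutoff n f x - f x)"
  let ?T = "\<lambda>k. truncated_fourier (n k) f"
  have T: "square_integrable (truncated_fourier k f)" for k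
    by (rule square_integrable_truncated_fourier[OF f])
  note Tm[measurable] = square_integrable_measurable[OF T]
  have Fm[measurable]: "F \<in> borel_measurable borel" unfolding F_def by measurable
  define d where "d k \<xi> = ?T (Suc k) \<xi> - ?T k \<xi>" for k \<xi>
  have d: "square_integrable (d k)" for k unfolding d_def [abs_def] by (intro square_integrable_diff T)
  note [measurable] = square_integrable_measurable[OF d]
  have dle: "sq_norm (d k) \<le> 8 * pi * (1/4) ^ k" for k
  proof -
    have "sq_norm (d k) \<le> 4 * pi * (?\<delta> (n (Suc k)) + ?\<delta> (n k))"
      unfolding d_def by (rule truncated_fourier_cauchy[OF f])
    also have "\<dots> \<le> 4 * pi * ((1/4) ^ Suc k + (1/4) ^ k)"
      by (intro mult_left_mono add_mono n) auto
    also have "\<dots> \<le> 4 * pi * ((1/4) ^ k + (1/4) ^ k)"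
      by (intro mult_left_mono add_mono power_decreasing) auto
    finally show ?thesis by simp
  qed
  \<comment> \<open>The squared norms of the increments decay like 4^(-k), so the weight 2^k is
    affordable. It is what turns square summability into absolute summability at almost every
    point.\<close>
  have "(\<integral>\<^sup>+\<xi>. (\<Sum>k. ennreal (2 ^ k * (cmod (d k \<xi>))\<^sup>2)) \<partial>lborel) =
      (\<Sum>k. \<integral>\<^sup>+\<xi>. ennreal (2 ^ k * (cmod (d k \<xi>))\<^sup>2) \<partial>lborel)"
    by (rule nn_integral_suminf) measurable
  also have "\<dots> \<le> (\<Sum>k. ennreal (8 * pi * (1/2) ^ k))"
  proof (intro suminf_le allI summableI)
    fix k
    have "(\<integral>\<^sup>+\<xi>. ennreal (2 ^ k * (cmod (d k \<xi>))\<^sup>2) \<partial>lborel) = ennreal (2 ^ k * sq_norm (d k))"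
      unfolding sq_norm_def using square_integrable_integrable[OF d[of k]]
      by (subst nn_integral_eq_integral) auto
    also have "\<dots> \<le> ennreal (2 ^ k * (8 * pi * (1/4) ^ k))"
      by (intro ennreal_leI mult_left_mono dle) simp
    also have "2 ^ k * (8 * pi * (1/4) ^ k) = 8 * pi * (1/2 :: real) ^ k"
      using power_mult_distrib[of "2::real" 2 k] by (simp add: power_divide)
    finally show "(\<integral>\<^sup>+\<xi>. ennreal (2 ^ k * (cmod (d k \<xi>))\<^sup>2) \<partial>lborel) \<le> ennreal (8 * pi * (1/2) ^ k)" .
  qed
  also have "\<dots> < \<infinity>"
    by (subst suminf_ennreal2) (auto intro: summable_mult)
  finally have "AE \<xi> in lborel. (\<Sum>k. ennreal (2 ^ k * (cmod (d k \<xi>))\<^sup>2)) \<noteq> \<infinity>"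
    by (intro nn_integral_PInf_AE) auto
  then have conv: "AE \<xi> in lborel. (\<lambda>k. ?T k \<xi>) \<longlonglongrightarrow> F \<xi>"
  proof eventually_elim
    fix \<xi> assume "(\<Sum>k. ennreal (2 ^ k * (cmod (d k \<xi>))\<^sup>2)) \<noteq> \<infinity>"
    then have 1: "summable (\<lambda>k. 2 ^ k * (cmod (d k \<xi>))\<^sup>2)"
      by (intro summable_suminf_not_top) auto
    have 2: "summable (\<lambda>k. ((1/2) ^ k + 2 ^ k * (cmod (d k \<xi>))\<^sup>2))"
      by (intro summable_add 1 summable_geometric) auto
    \<comment> \<open>The inequality 2xy \<le> x^2 + y^2 with x^2 = 2^(-k) and y = 2^(k/2) |d k|:
      both sequences on the right are summable.\<close>
    have 3: "norm (norm (d k \<xi>)) \<le> (1/2) ^ k + 2 ^ k * (cmod (d k \<xi>))\<^sup>2" for k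
    proof -
      have "2 * sqrt ((1/2) ^ k) * (sqrt (2 ^ k) * cmod (d k \<xi>)) \<le>
         (sqrt ((1/2) ^ k))\<^sup>2 + (sqrt (2 ^ k) * cmod (d k \<xi>))\<^sup>2"
        by (rule sum_squares_bound)
      also have "2 * sqrt ((1/2) ^ k) * (sqrt (2 ^ k) * cmod (d k \<xi>)) = 2 * cmod (d k \<xi>)"
        by (simp add: power_divide real_sqrt_divide)
      finally show ?thesis by (simp add: power_mult_distrib) (smt (verit) norm_ge_zero)
    qed
    have "summable (\<lambda>k. norm (d k \<xi>))"
      by (rule summable_comparison_test'[OF 2]) (rule 3)
    then have "summable (\<lambda>k. d k \<xi>)" by (rule summable_norm_cancel)
    then have "convergent (\<lambda>k. \<Sum>i<k. d i \<xi>)" by (simp add: summable_iff_convergent)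
    moreover have "(\<Sum>i<k. d i \<xi>) = ?T k \<xi> - ?T 0 \<xi>" for k
      unfolding d_def by (rule sum_lessThan_telescope)
    ultimately have "convergent (\<lambda>k. ?T k \<xi> - ?T 0 \<xi>)" by simp
    then have "convergent (\<lambda>k. ?T k \<xi> - ?T 0 \<xi> + ?T 0 \<xi>)"
      by (intro convergent_add convergent_const)
    then show "(\<lambda>k. ?T k \<xi>) \<longlonglongrightarrow> F \<xi>"
      unfolding F_def by (simp add: convergent_LIMSEQ_iff)
  qed
  \<comment> \<open>Fatou along the fast subsequence transfers the Cauchy estimate to the limit. The
    index \<open>m\<close> is arbitrary here, so all truncations converge and not only the
    subsequence.\<close>
  have fatou: "(\<integral>\<^sup>+\<xi>. ennreal ((cmod (truncated_fourier m f \<xi> - F \<xi>))\<^sup>2) \<partial>lborel) \<le> ennreal (4 * pi * ?\<delta> m)" for m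
  proof -
    have "(\<integral>\<^sup>+\<xi>. ennreal ((cmod (truncated_fourier m f \<xi> - F \<xi>))\<^sup>2) \<partial>lborel)
        = (\<integral>\<^sup>+\<xi>. liminf (\<lambda>k. ennreal ((cmod (truncated_fourier m f \<xi> - ?T k \<xi>))\<^sup>2)) \<partial>lborel)"
    proof (rule nn_integral_cong_AE, use conv in eventually_elim)
      fix \<xi> assume "(\<lambda>k. ?T k \<xi>) \<longlonglongrightarrow> F \<xi>"
      then have "(\<lambda>k. ennreal ((cmod (truncated_fourier m f \<xi> - ?T k \<xi>))\<^sup>2)) \<longlonglongrightarrow>
          ennreal ((cmod (truncated_fourier m f \<xi> - F \<xi>))\<^sup>2)"
        by (intro tendsto_intros tendsto_ennrealI)
      from lim_imp_Liminf[OF sequentially_bot this]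
      show "ennreal ((cmod (truncated_fourier m f \<xi> - F \<xi>))\<^sup>2) =
        liminf (\<lambda>k. ennreal ((cmod (truncated_fourier m f \<xi> - ?T k \<xi>))\<^sup>2))" by (rule sym)
    qed
    also have "\<dots> \<le> liminf (\<lambda>k. \<integral>\<^sup>+\<xi>. ennreal ((cmod (truncated_fourier m f \<xi> - ?T k \<xi>))\<^sup>2) \<partial>lborel)"
      by (rule nn_integral_liminf) measurable
    also have "\<dots> \<le> liminf (\<lambda>k. ennreal (4 * pi * (?\<delta> m + (1/4) ^ k)))"
    proof (intro Liminf_mono always_eventually allI)
      fix k
      have "sq_norm (\<lambda>\<xi>. truncated_fourier m f \<xi> - ?T k \<xi>) \<le> 4 * pi * (?\<delta> m + ?\<delta> (n k))"
        by (rule truncated_fourier_cauchy[OF f])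
      also have "\<dots> \<le> 4 * pi * (?\<delta> m + (1/4) ^ k)"
        by (intro mult_left_mono add_mono n) auto
      finally show "(\<integral>\<^sup>+\<xi>. ennreal ((cmod (truncated_fourier m f \<xi> - ?T k \<xi>))\<^sup>2) \<partial>lborel)
          \<le> ennreal (4 * pi * (?\<delta> m + (1/4) ^ k))"
        by (subst square_integrable_nn) (auto intro: square_integrable_diff T ennreal_leI)
    qed
    also have "\<dots> = ennreal (4 * pi * (?\<delta> m + 0))"
      by (intro lim_imp_Liminf tendsto_ennrealI tendsto_intros LIMSEQ_realpow_zero) auto
    finally show ?thesis by simp
  qed
  have TF: "square_integrable (\<lambda>\<xi>. truncated_fourier m f \<xi> - F \<xi>)" for m
    by (rule square_integrableI) (use fatou[of m] in \<open>auto simp: less_top[symmetric] top_unique\<close>)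
  show "square_integrable F"
    using square_integrable_diff[OF T TF, of 0 0] by simp
  have le: "sq_norm (\<lambda>\<xi>. truncated_fourier m f \<xi> - F \<xi>) \<le> 4 * pi * ?\<delta> m" for m
    using fatou[of m] unfolding square_integrable_nn[OF TF] by (simp add: ennreal_le_iff)
  show "(\<lambda>m. sq_norm (\<lambda>\<xi>. truncated_fourier m f \<xi> - F \<xi>)) \<longlonglongrightarrow> 0"
    by (rule tendsto_0_squeeze[OF sq_norm_nonneg le])
       (use tendsto_mult_left[OF cutoff_tendsto[OF f], of "4 * pi"] in simp)
qed

lemma L2_norm_tendsto_0_iff:
  fixes f :: "nat \<Rightarrow> real \<Rightarrow> complex"
  assumes "\<And>n. square_integrable (f n)"
  shows "(\<lambda>n. L2_norm (f n)) \<longlonglongrightarrow> 0 \<longleftrightarrow> (\<lambda>n. sq_norm (f n)) \<longlonglongrightarrow> 0"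
proof -
  have "(\<lambda>n. L2_norm (f n)) \<longlonglongrightarrow> 0 \<longleftrightarrow> (\<lambda>n. sqrt (sq_norm (f n))) \<longlonglongrightarrow> 0"
    unfolding L2_norm_eq[OF assms] ennreal_0[symmetric] by (rule tendsto_ennreal_iff) auto
  also have "\<dots> \<longleftrightarrow> (\<lambda>n. sq_norm (f n)) \<longlonglongrightarrow> 0"
  proof
    assume "(\<lambda>n. sqrt (sq_norm (f n))) \<longlonglongrightarrow> 0"
    from tendsto_power[OF this, of 2] show "(\<lambda>n. sq_norm (f n)) \<longlonglongrightarrow> 0" by simp
  next
    assume "(\<lambda>n. sq_norm (f n)) \<longlonglongrightarrow> 0"
    from tendsto_real_sqrt[OF this] show "(\<lambda>n. sqrt (sq_norm (f n))) \<longlonglongrightarrow> 0" by simp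
  qed
  finally show ?thesis .
qed

lemma cutoff_fast:
  assumes f: "square_integrable f"
  shows "\<exists>n. sq_norm (\<lambda>x. cutoff n f x - f x) \<le> (1/4) ^ k"
  using LIMSEQ_le_const[OF cutoff_tendsto[OF f], of "(1/4)^k"]
  by (metis linorder_le_cases linorder_not_le zero_less_divide_1_iff zero_less_numeral zero_less_power)

text \<open>The \<open>SOME\<close> in \<open>fourier\<close> is resolved once and for all: the fast
  limit witnesses the predicate, so the chosen representative satisfies it as well.\<close>

lemma
  assumes f: "square_integrable f"
  shows square_integrable_fourier: "square_integrable (fourier f)"
    and fourier_tendsto: "(\<lambda>n. sq_norm (\<lambda>\<xi>. truncated_fourier n f \<xi> - fourier f \<xi>)) \<longlonglongrightarrow> 0"
proof -
  let ?P = "\<lambda>F. square_integrable F \<and> (\<lambda>n. L2_norm (\<lambda>\<xi>. truncated_fourier n f \<xi> - F \<xi>)) \<longlonglongrightarrow> 0"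
  obtain n where n: "\<And>k. sq_norm (\<lambda>x. cutoff (n k) f x - f x) \<le> (1/4) ^ k"
    using cutoff_fast[OF f] by metis
  note F = truncated_fourier_fast_limit[OF f n]
  have iff: "(\<lambda>n. L2_norm (\<lambda>\<xi>. truncated_fourier n f \<xi> - F \<xi>)) \<longlonglongrightarrow> 0 \<longleftrightarrow>
      (\<lambda>n. sq_norm (\<lambda>\<xi>. truncated_fourier n f \<xi> - F \<xi>)) \<longlonglongrightarrow> 0" if "square_integrable F" for F
    by (intro L2_norm_tendsto_0_iff square_integrable_diff square_integrable_truncated_fourier f that)
  have "?P (\<lambda>\<xi>. lim (\<lambda>k. truncated_fourier (n k) f \<xi>))"
    using F iff[OF F(1)] by simp
  then have P: "?P (fourier f)" unfolding fourier_def by (rule someI[of ?P])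
  then show *: "square_integrable (fourier f)" by simp
  show "(\<lambda>n. sq_norm (\<lambda>\<xi>. truncated_fourier n f \<xi> - fourier f \<xi>)) \<longlonglongrightarrow> 0"
    using P iff[OF *] by simp
qed

text \<open>The tool for computing transforms: a function is identified with the chosen
  representative as soon as it is an L2 limit of the truncated integrals.\<close>

lemma fourier_unique:
  assumes f: "square_integrable f" and F: "square_integrable F"
    and lim: "(\<lambda>n. sq_norm (\<lambda>\<xi>. truncated_fourier n f \<xi> - F \<xi>)) \<longlonglongrightarrow> 0"
  shows "AE \<xi> in lborel. fourier f \<xi> = F \<xi>"
proof -
  note sq = square_integrable_fourier[OF f] square_integrable_truncated_fourier[OF f]
  have "sq_norm (\<lambda>\<xi>. fourier f \<xi> - F \<xi>) \<le> 2 * 0 + 2 * 0"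
  proof (rule LIMSEQ_le[OF tendsto_const])
    show "(\<lambda>n. 2 * sq_norm (\<lambda>\<xi>. truncated_fourier n f \<xi> - fourier f \<xi>) +
        2 * sq_norm (\<lambda>\<xi>. truncated_fourier n f \<xi> - F \<xi>)) \<longlonglongrightarrow> 2 * 0 + 2 * 0"
      by (intro tendsto_intros lim fourier_tendsto f)
    have "sq_norm (\<lambda>\<xi>. fourier f \<xi> - F \<xi>) \<le> 2 * sq_norm (\<lambda>\<xi>. truncated_fourier n f \<xi> - fourier f \<xi>) +
        2 * sq_norm (\<lambda>\<xi>. truncated_fourier n f \<xi> - F \<xi>)" for n
      using sq_norm_add_le[of "\<lambda>\<xi>. fourier f \<xi> - truncated_fourier n f \<xi>" "\<lambda>\<xi>. truncated_fourier n f \<xi> - F \<xi>"]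
      by (simp add: square_integrable_diff sq F sq_norm_diff_commute[of "fourier f"])
    then show "\<exists>N. \<forall>n\<ge>N. sq_norm (\<lambda>\<xi>. fourier f \<xi> - F \<xi>) \<le>
       2 * sq_norm (\<lambda>\<xi>. truncated_fourier n f \<xi> - fourier f \<xi>) +
        2 * sq_norm (\<lambda>\<xi>. truncated_fourier n f \<xi> - F \<xi>)" by blast
  qed
  then have "sq_norm (\<lambda>\<xi>. fourier f \<xi> - F \<xi>) = 0"
    using sq_norm_nonneg[of "\<lambda>\<xi>. fourier f \<xi> - F \<xi>"] by simp
  from sq_norm_eq_0_AE[OF square_integrable_diff[OF sq(1) F] this] show ?thesis by simp
qed

lemma fourier_eq_fourier_integral:
  assumes f: "square_integrable f" and fi: "integrable lborel f"
  shows "AE \<xi> in lborel. fourier f \<xi> = fourier_integral f \<xi>"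
proof (rule fourier_unique[OF f fourier_integral_bessel(1)[OF fi f]])
  have le: "sq_norm (\<lambda>\<xi>. truncated_fourier n f \<xi> - fourier_integral f \<xi>) \<le> 2 * pi * sq_norm (\<lambda>x. cutoff n f x - f x)" for n
  proof -
    have "(\<lambda>\<xi>. truncated_fourier n f \<xi> - fourier_integral f \<xi>) = fourier_integral (\<lambda>x. cutoff n f x - f x)"
      unfolding truncated_fourier_eq by (intro ext) (simp add: fourier_integral_diff integrable_cutoff f fi)
    then show ?thesis
      by (simp add: fourier_integral_bessel(2) integrable_cutoff fi f square_integrable_diff square_integrable_cutoff)
  qed
  show "(\<lambda>n. sq_norm (\<lambda>\<xi>. truncated_fourier n f \<xi> - fourier_integral f \<xi>)) \<longlonglongrightarrow> 0"
    by (rule tendsto_0_squeeze[OF sq_norm_nonneg le])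
       (use tendsto_mult_left[OF cutoff_tendsto[OF f], of "2 * pi"] in simp)
qed

section \<open>Linearity, conjugation and limits of truncated transforms\<close>

lemma cutoff_add: "cutoff n (\<lambda>x. f x + g x) = (\<lambda>x. cutoff n f x + cutoff n g x)"
  and cutoff_cmult: "cutoff n (\<lambda>x. c * f x) = (\<lambda>x. c * cutoff n f x)"
  and cutoff_cnj: "cutoff n (\<lambda>x. cnj (f x)) = (\<lambda>x. cnj (cutoff n f x))"
  unfolding cutoff_def by (auto simp: fun_eq_iff algebra_simps split: split_indicator)

lemma fourier_add:
  assumes f: "square_integrable f" and g: "square_integrable g"
  shows "AE \<xi> in lborel. fourier (\<lambda>x. f x + g x) \<xi> = fourier f \<xi> + fourier g \<xi>"
proof (rule fourier_unique[OF square_integrable_add[OF f g]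
      square_integrable_add[OF square_integrable_fourier[OF f] square_integrable_fourier[OF g]]])
  note sq = square_integrable_fourier[OF f] square_integrable_truncated_fourier[OF f]
    square_integrable_fourier[OF g] square_integrable_truncated_fourier[OF g]
  have eq: "truncated_fourier n (\<lambda>x. f x + g x) \<xi> = truncated_fourier n f \<xi> + truncated_fourier n g \<xi>" for n \<xi>
    unfolding truncated_fourier_eq cutoff_add fourier_integral_def
    using integrable_cutoff[OF f, of n] integrable_cutoff[OF g, of n]
    by (simp add: distrib_right integrable_mult_cis)
  have le: "sq_norm (\<lambda>\<xi>. truncated_fourier n (\<lambda>x. f x + g x) \<xi> - (fourier f \<xi> + fourier g \<xi>)) \<le>
     2 * sq_norm (\<lambda>\<xi>. truncated_fourier n f \<xi> - fourier f \<xi>) +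
     2 * sq_norm (\<lambda>\<xi>. truncated_fourier n g \<xi> - fourier g \<xi>)" for n
    using sq_norm_add_le[of "\<lambda>\<xi>. truncated_fourier n f \<xi> - fourier f \<xi>" "\<lambda>\<xi>. truncated_fourier n g \<xi> - fourier g \<xi>"]
    by (simp add: square_integrable_diff sq eq add_diff_add)
  have "(\<lambda>n. 2 * sq_norm (\<lambda>\<xi>. truncated_fourier n f \<xi> - fourier f \<xi>) +
     2 * sq_norm (\<lambda>\<xi>. truncated_fourier n g \<xi> - fourier g \<xi>)) \<longlonglongrightarrow> 2 * 0 + 2 * 0"
    by (intro tendsto_intros fourier_tendsto f g)
  then show "(\<lambda>n. sq_norm (\<lambda>\<xi>. truncated_fourier n (\<lambda>x. f x + g x) \<xi> - (fourier f \<xi> + fourier g \<xi>))) \<longlonglongrightarrow> 0"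
    by (intro tendsto_0_squeeze[OF sq_norm_nonneg le]) simp
qed

lemma fourier_cmult:
  assumes f: "square_integrable f"
  shows "AE \<xi> in lborel. fourier (\<lambda>x. c * f x) \<xi> = c * fourier f \<xi>"
proof (rule fourier_unique[OF square_integrable_cmult[OF f] square_integrable_cmult[OF square_integrable_fourier[OF f]]])
  have eq: "truncated_fourier n (\<lambda>x. c * f x) \<xi> = c * truncated_fourier n f \<xi>" for n \<xi>
    unfolding truncated_fourier_eq cutoff_cmult fourier_integral_def by (simp add: mult.assoc)
  have "sq_norm (\<lambda>\<xi>. truncated_fourier n (\<lambda>x. c * f x) \<xi> - c * fourier f \<xi>) =
      (cmod c)\<^sup>2 * sq_norm (\<lambda>\<xi>. truncated_fourier n f \<xi> - fourier f \<xi>)" for n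
    unfolding eq right_diff_distrib[symmetric] by (rule sq_norm_cmult)
  then show "(\<lambda>n. sq_norm (\<lambda>\<xi>. truncated_fourier n (\<lambda>x. c * f x) \<xi> - c * fourier f \<xi>)) \<longlonglongrightarrow> 0"
    using tendsto_mult_left[OF fourier_tendsto[OF f], of "(cmod c)\<^sup>2"] by simp
qed

lemma sq_norm_reflect: "sq_norm (\<lambda>x. f (- x)) = sq_norm f"
  unfolding sq_norm_def
  using lborel_integral_real_affine[of "-1" "\<lambda>x. (cmod (f x))\<^sup>2" 0] by simp

lemma fourier_cnj:
  assumes f: "square_integrable f"
  shows "AE \<xi> in lborel. fourier (\<lambda>x. cnj (f x)) \<xi> = cnj (fourier f (- \<xi>))"
proof (rule fourier_unique[OF square_integrable_cnj[OF f]
      square_integrable_cnj[OF square_integrable_reflect[OF square_integrable_fourier[OF f]]]])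
  have eq: "truncated_fourier n (\<lambda>x. cnj (f x)) \<xi> = cnj (truncated_fourier n f (- \<xi>))" for n \<xi>
    unfolding truncated_fourier_eq cutoff_cnj by (rule fourier_integral_cnj)
  have "sq_norm (\<lambda>\<xi>. truncated_fourier n (\<lambda>x. cnj (f x)) \<xi> - cnj (fourier f (- \<xi>))) =
     sq_norm (\<lambda>\<xi>. truncated_fourier n f \<xi> - fourier f \<xi>)" for n
    unfolding eq complex_cnj_diff[symmetric] sq_norm_cnj
    using sq_norm_reflect[of "\<lambda>\<xi>. truncated_fourier n f \<xi> - fourier f \<xi>"] .
  then show "(\<lambda>n. sq_norm (\<lambda>\<xi>. truncated_fourier n (\<lambda>x. cnj (f x)) \<xi> - cnj (fourier f (- \<xi>)))) \<longlonglongrightarrow> 0"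
    using fourier_tendsto[OF f] by simp
qed

lemma fourier_bessel:
  assumes f: "square_integrable f"
  shows "sq_norm (fourier f) \<le> 2 * pi * sq_norm f"
proof (rule LIMSEQ_le)
  show "(\<lambda>n. sq_norm (truncated_fourier n f)) \<longlonglongrightarrow> sq_norm (fourier f)"
    by (intro sq_norm_tendsto square_integrable_truncated_fourier square_integrable_fourier fourier_tendsto f)
  show "(\<lambda>n. 2 * pi * sq_norm (cutoff n f)) \<longlonglongrightarrow> 2 * pi * sq_norm f"
    by (intro tendsto_intros sq_norm_tendsto square_integrable_cutoff cutoff_tendsto f)
  show "\<exists>N. \<forall>n\<ge>N. sq_norm (truncated_fourier n f) \<le> 2 * pi * sq_norm (cutoff n f)"
    using truncated_fourier_bessel[OF f] by blast
qed

text \<open>The equality is literal, not just almost everywhere: the truncated integrals do not see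
  null sets, so both sides apply \<open>SOME\<close> to the same predicate.\<close>

lemma fourier_cong_AE:
  assumes "square_integrable f" "square_integrable g" "AE x in lborel. f x = g x"
  shows "fourier f = fourier g"
proof -
  have "truncated_fourier n f = truncated_fourier n g" for n
    unfolding truncated_fourier_eq fourier_integral_def [abs_def] cutoff_def
    using square_integrable_measurable[OF assms(1)] square_integrable_measurable[OF assms(2)]
    by (intro ext integral_cong_AE, measurable) (use assms(3) in eventually_elim, simp)
  then show ?thesis unfolding fourier_def by simp
qed

lemma fourier_multiplication_formula:
  assumes f: "square_integrable f" and g: "square_integrable g"
  shows "L2_pairing (fourier f) g = L2_pairing f (fourier g)"
proof -
  note sqf = f square_integrable_fourier[OF f] square_integrable_truncated_fourier[OF f] square_integrable_cutoff[OF f]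
  note sqg = g square_integrable_fourier[OF g] square_integrable_truncated_fourier[OF g] square_integrable_cutoff[OF g]
  have 1: "L2_pairing (truncated_fourier n f) (cutoff m g) = L2_pairing (cutoff n f) (truncated_fourier m g)" for n m
    unfolding truncated_fourier_eq L2_pairing_def
    using fourier_integral_multiplication_formula[OF integrable_cutoff[OF f, of n] integrable_cutoff[OF g, of m]]
    by (simp add: mult.commute)
  \<comment> \<open>The two truncations are removed one at a time, first the one of \<open>g\<close>
    with \<open>n\<close> fixed; each limit is then the limit of a pairing in one argument.\<close>
  have 2: "L2_pairing (truncated_fourier n f) g = L2_pairing (cutoff n f) (fourier g)" for n
  proof (rule LIMSEQ_unique)
    show "(\<lambda>m. L2_pairing (truncated_fourier n f) (cutoff m g)) \<longlonglongrightarrow> L2_pairing (truncated_fourier n f) g"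
      unfolding L2_pairing_commute[of "truncated_fourier n f"]
      by (intro L2_pairing_tendsto sqf sqg cutoff_tendsto)
    show "(\<lambda>m. L2_pairing (truncated_fourier n f) (cutoff m g)) \<longlonglongrightarrow> L2_pairing (cutoff n f) (fourier g)"
      unfolding 1 L2_pairing_commute[of "cutoff n f"]
      by (intro L2_pairing_tendsto sqf sqg fourier_tendsto)
  qed
  show ?thesis
  proof (rule LIMSEQ_unique)
    show "(\<lambda>n. L2_pairing (truncated_fourier n f) g) \<longlonglongrightarrow> L2_pairing (fourier f) g"
      by (intro L2_pairing_tendsto sqf sqg fourier_tendsto)
    show "(\<lambda>n. L2_pairing (truncated_fourier n f) g) \<longlonglongrightarrow> L2_pairing f (fourier g)"
      unfolding 2 by (intro L2_pairing_tendsto sqf sqg cutoff_tendsto)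
  qed
qed

subsection \<open>Plancherel's theorem\<close>

text \<open>Rational endpoints suffice because integrals over rays depend right-continuously on the
  endpoint; this allows countable families of test functions later. The closed rays then determine
  the integrals over all Borel sets by a Dynkin argument. Since \<open>f\<close> is only locally
  integrable, everything is done for one cutoff at a time.\<close>

lemma AE_zero_if_interval_integrals_zero:
  fixes f :: "real \<Rightarrow> complex"
  assumes [measurable]: "f \<in> borel_measurable borel"
    and int: "\<And>n. integrable lborel (cutoff n f)"
    and zero: "\<And>a b. a \<in> \<rat> \<Longrightarrow> b \<in> \<rat> \<Longrightarrow> a < b \<Longrightarrow> (LINT x|lborel. indicator {a..b} x * f x) = 0"
  shows "AE x in lborel. f x = 0"
proof -
  have "AE x in lborel. cutoff n f x = 0" for n
  proof -
    define g where "g = cutoff n f"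
    have gi: "integrable lborel g" using int[of n] unfolding g_def .
    have [measurable]: "g \<in> borel_measurable borel" using gi by auto
    have gs: "set_integrable lborel A g" if "A \<in> sets borel" for A
      unfolding set_integrable_def by (rule integrable_mult_indicator) (use that gi in auto)
    have rat: "(LINT x|lborel. indicator {..q} x *\<^sub>R g x) = 0" if "q \<in> \<rat>" for q
    proof (cases "- real n < q")
      case True
      show ?thesis
      \<comment> \<open>For \<open>n = 0\<close> the cutoff lives on the single point 0, a
        degenerate interval that the hypothesis with \<open>a < b\<close> does not cover.\<close>
      proof (cases "n = 0")
        case True
        have "AE x in lborel. indicator {..q} x *\<^sub>R g x = 0"
          using AE_lborel_singleton[of "0::real"] by eventually_elim (auto simp: g_def cutoff_def True)
        then show ?thesis by (rule integral_eq_zero_AE)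
      next
        case False
        have "(LINT x|lborel. indicator {..q} x *\<^sub>R g x) = (LINT x|lborel. indicator {- real n..min q (real n)} x * f x)"
          by (intro Bochner_Integration.integral_cong refl)
             (auto simp: g_def cutoff_def split: split_indicator)
        also have "\<dots> = 0"
          using that True False by (intro zero) (auto simp: min_def)
        finally show ?thesis .
      qed
    next
      case False
      have "AE x in lborel. indicator {..q} x *\<^sub>R g x = 0"
        using AE_lborel_singleton[of "- real n"]
        by eventually_elim (use False in \<open>auto simp: g_def cutoff_def split: split_indicator\<close>)
      then show ?thesis by (rule integral_eq_zero_AE)
    qed
    \<comment> \<open>Rationals approach \<open>b\<close> strictly from above, so the closed rays
      shrink to the closed ray at \<open>b\<close>; domination is by |g|.\<close>
    have ray: "(LINT x|lborel. indicator {..b} x *\<^sub>R g x) = 0" for b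
    proof -
      have "\<exists>q\<in>\<rat>. b < q \<and> q < b + 1 / real (Suc k)" for k
        using Rats_dense_in_real[of b "b + 1 / real (Suc k)"] by auto
      then obtain q where q: "\<And>k. q k \<in> \<rat>" "\<And>k. b < q k" "\<And>k. q k < b + 1 / real (Suc k)"
        by metis
      have "(\<lambda>k. LINT x|lborel. indicator {..q k} x *\<^sub>R g x) \<longlonglongrightarrow> (LINT x|lborel. indicator {..b} x *\<^sub>R g x)"
      proof (rule Bochner_Integration.integral_dominated_convergence[where w="\<lambda>x. cmod (g x)"])
        show "AE x in lborel. (\<lambda>k. indicator {..q k} x *\<^sub>R g x) \<longlonglongrightarrow> indicator {..b} x *\<^sub>R g x"
        proof (rule AE_I2, rule tendsto_eventually)
          fix x
          show "\<forall>\<^sub>F k in sequentially. indicator {..q k} x *\<^sub>R g x = indicator {..b} x *\<^sub>R g x"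
          proof (cases "x \<le> b")
            case True
            then have "x \<le> q k" for k using q(2)[of k] by simp
            then show ?thesis using True by (simp add: indicator_def)
          next
            case False
            then obtain N where N: "1 / real (Suc N) < x - b"
              using nat_approx_posE[of "x - b"] by auto
            have "\<not> x \<le> q k" if "k \<ge> N" for k
            proof -
              have "1 / real (Suc k) \<le> 1 / real (Suc N)" using that by (simp add: frac_le)
              then show ?thesis using q(3)[of k] N by simp
            qed
            then show ?thesis using False
              by (intro eventually_sequentiallyI[of N]) (simp add: indicator_def)
          qed
        qed
        show "AE x in lborel. norm (indicator {..q k} x *\<^sub>R g x) \<le> cmod (g x)" for k
          by (rule AE_I2) (auto split: split_indicator)
      qed (use gi in auto)
      then show ?thesis unfolding rat[OF q(1)] by (simp add: LIMSEQ_const_iff)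
    qed
    have UN: "(LINT x:UNIV|lborel. g x) = 0"
    proof -
      have "(LINT x:UNIV|lborel. g x) = (LINT x|lborel. indicator {..real n} x *\<^sub>R g x)"
        unfolding set_lebesgue_integral_def
        by (intro Bochner_Integration.integral_cong refl) (auto simp: g_def cutoff_def split: split_indicator)
      then show ?thesis using ray by simp
    qed
    \<comment> \<open>Closed rays are stable under intersection and generate the Borel sets. The
      vanishing total integral \<open>UN\<close> serves the complement step.\<close>
    have "(LINT x:A|lborel. g x) = 0" if "A \<in> sets borel" for A
    proof -
      have 1: "Int_stable (range (\<lambda>a::real. {..a}))"
        by (auto simp: Int_stable_def)
      have 2: "range (\<lambda>a::real. {..a}) \<subseteq> Pow UNIV" by simp
      have 3: "A \<in> sigma_sets UNIV (range (\<lambda>a::real. {..a}))"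
        using that by (simp add: borel_eq_atMost)
      from 1 2 3 show ?thesis
      proof (induction rule: sigma_sets_induct_disjoint)
        case (basic A)
        then show ?case using ray by (auto simp: set_lebesgue_integral_def)
      next
        case empty
        show ?case by (simp add: set_lebesgue_integral_def)
      next
        case (compl A)
        have A: "A \<in> sets borel" using compl(1) by (simp add: borel_eq_atMost)
        have "(LINT x:UNIV|lborel. g x) = (LINT x:A \<union> (UNIV - A)|lborel. g x)" by simp
        also have "\<dots> = (LINT x:A|lborel. g x) + (LINT x:UNIV - A|lborel. g x)"
          using A by (intro set_integral_Un gs) auto
        finally show ?case using UN compl.IH by simp
      next
        case (union A)
        have A: "A i \<in> sets borel" for i using union(2) by (auto simp: borel_eq_atMost)
        have "(LINT x:(\<Union>i. A i)|lborel. g x) = (\<Sum>i. (LINT x:(A i)|lborel. g x))"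
          by (rule lebesgue_integral_countable_add)
             (use A union(1) in \<open>auto intro!: gs simp: disjoint_family_on_def\<close>)
        then show ?case using union.IH by simp
      qed
    qed
    then have "AE x in lborel. g x = 0"
      using sigma_finite_measure.density_unique_banach[OF sigma_finite_lborel gi, of "\<lambda>_. 0"] by (auto simp: set_lebesgue_integral_def)
    then show ?thesis unfolding g_def .
  qed
  then have "AE x in lborel. \<forall>n. cutoff n f x = 0" by (simp add: AE_all_countable)
  then show ?thesis
  proof eventually_elim
    fix x assume "\<forall>n. cutoff n f x = 0"
    moreover obtain n where "\<bar>x\<bar> \<le> real n" using real_arch_simple by blast
    ultimately show "f x = 0"
      by (auto simp: cutoff_def abs_le_iff indicator_def split: if_splits dest!: spec[of _ n])
  qed
qed

text \<open>Written so that the right-hand side is exactly the quotient occurring in Levy's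
  inversion formula.\<close>

lemma fourier_integral_interval:
  assumes "a \<le> b" "t \<noteq> 0"
  shows "fourier_integral (indicator {a..b}) t = (iexp (- (t * a)) - iexp (- (t * b))) / (\<i> * t)"
proof -
  have "fourier_integral (indicator {a..b}) t = (LINT x|lborel. indicator {a..b} x *\<^sub>R cis (- (x * t)))"
    unfolding fourier_integral_def
    by (intro Bochner_Integration.integral_cong refl) (auto split: split_indicator)
  also have "\<dots> = cis (- (b * t)) / (- \<i> * t) - cis (- (a * t)) / (- \<i> * t)"
  proof (rule integral_FTC_Icc)
    fix x
    have "((\<lambda>x. exp (\<i> * complex_of_real (- (x * t))) / (- \<i> * t)) has_vector_derivative
        exp (\<i> * complex_of_real (- (x * t)))) (at x within {a..b})"
      using assms(2)
      by (auto intro!: derivative_eq_intros has_vector_derivative_real_field simp: field_simps)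
    then show "((\<lambda>x. cis (- (x * t)) / (- \<i> * t)) has_vector_derivative cis (- (x * t))) (at x within {a..b})"
      by (simp add: cis_conv_exp)
  qed (use assms in \<open>auto intro!: continuous_intros\<close>)
  also have "\<dots> = (iexp (- (t * a)) - iexp (- (t * b))) / (\<i> * t)"
    using assms(2) by (simp add: cis_conv_exp mult.commute field_simps)
  finally show ?thesis .
qed

text \<open>Levy's inversion formula for the uniform distribution is Plancherel's identity for
  the indicator of an interval.\<close>

lemma plancherel_interval:
  assumes ab: "a < b"
  shows "sq_norm (fourier (indicator {a..b})) = 2 * pi * sq_norm (indicator {a..b})"
proof -
  let ?I = "indicator {a..b} :: real \<Rightarrow> complex"
  let ?F = "fourier_integral ?I"
  have I: "square_integrable ?I" by (rule square_integrable_indicator_interval)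
  have Ii: "integrable lborel ?I"
    using integrable_mult_square_integrable[OF I I] by (simp flip: indicator_inter_arith)
  have sqI: "sq_norm ?I = b - a"
  proof -
    have "sq_norm ?I = (LINT x|lborel. indicator {a..b} x)"
      unfolding sq_norm_def by (intro Bochner_Integration.integral_cong refl) (auto split: split_indicator)
    then show ?thesis using ab by simp
  qed
  have F: "square_integrable ?F" by (rule fourier_integral_bessel[OF Ii I])
  note [measurable] = square_integrable_measurable[OF F]
  \<comment> \<open>The density of the uniform distribution on the interval.\<close>
  define p where "p x = indicator {a..b} x / (b - a)" for x :: real
  have p0: "p x \<ge> 0" for x using ab unfolding p_def by auto
  have [measurable]: "p \<in> borel_measurable borel" unfolding p_def by measurable
  define M where "M = density lborel (\<lambda>x. ennreal (p x))"
  have em: "emeasure M A = ennreal (measure lborel (A \<inter> {a..b}) / (b - a))" if "A \<in> sets borel" for A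
  proof -
    have "emeasure M A = (\<integral>\<^sup>+x. ennreal (1 / (b - a)) * indicator (A \<inter> {a..b}) x \<partial>lborel)"
      unfolding M_def p_def using that
      by (subst emeasure_density) (auto intro!: nn_integral_cong split: split_indicator)
    also have "\<dots> = ennreal (1 / (b - a)) * emeasure lborel (A \<inter> {a..b})"
      using that by (intro nn_integral_cmult_indicator) auto
    also have "emeasure lborel (A \<inter> {a..b}) = ennreal (measure lborel (A \<inter> {a..b}))"
    proof (rule emeasure_eq_ennreal_measure)
      have "emeasure lborel (A \<inter> {a..b}) \<le> emeasure lborel {a..b}"
        by (intro emeasure_mono) auto
      then show "emeasure lborel (A \<inter> {a..b}) \<noteq> top" by (auto simp: emeasure_lborel_Icc_eq top_unique)
    qed
    finally show ?thesis using ab by (simp add: ennreal_mult'[symmetric])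
  qed
  interpret M: real_distribution M
  proof -
    have "prob_space M"
    proof
      show "emeasure M (space M) = 1"
        using em[of UNIV] ab by (simp add: M_def)
    qed
    then show "real_distribution M"
      by (simp add: real_distribution_def real_distribution_axioms_def M_def)
  qed
  \<comment> \<open>Characteristic functions use the opposite sign in the exponent, hence the
    conjugate. Multiplied by the quotient of \<open>fourier_integral_interval\<close> this is
    |transform|^2 / (b - a), so the inversion formula computes an L2 norm.\<close>
  have char: "char M t = cnj (?F t) / complex_of_real (b - a)" for t
  proof -
    have "char M t = (LINT x|lborel. p x *\<^sub>R iexp (t * x))"
      unfolding char_def M_def using p0 by (intro integral_density) auto
    also have "\<dots> = (LINT x|lborel. (?I x * cis (- (x * (- t)))) / complex_of_real (b - a))"
      by (intro Bochner_Integration.integral_cong refl)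
         (auto simp: p_def cis_conv_exp scaleR_conv_of_real mult.commute divide_simps split: split_indicator)
    also have "\<dots> = fourier_integral ?I (- t) / complex_of_real (b - a)"
      unfolding fourier_integral_def by (rule integral_divide_zero)
    also have "fourier_integral ?I (- t) = cnj (fourier_integral (\<lambda>x. cnj (?I x)) t)"
      using fourier_integral_cnj[of ?I t] by simp
    also have "(\<lambda>x. cnj (?I x)) = ?I" by (auto split: split_indicator)
    finally show ?thesis .
  qed
  have T: "(CLBINT t=ereal (- real T)..ereal (real T). (iexp (- (t * a)) - iexp (- (t * b))) / (\<i> * t) * char M t)
      = complex_of_real (sq_norm (cutoff T ?F) / (b - a))" for T :: nat
  proof -
    have "(CLBINT t=ereal (- real T)..ereal (real T). (iexp (- (t * a)) - iexp (- (t * b))) / (\<i> * t) * char M t)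
      = (LINT t|lborel. indicator {- real T..real T} t *\<^sub>R ((iexp (- (t * a)) - iexp (- (t * b))) / (\<i> * t) * char M t))"
      by (subst interval_integral_Icc) (auto simp: set_lebesgue_integral_def)
    also have "\<dots> = (LINT t|lborel. complex_of_real ((cmod (cutoff T ?F t))\<^sup>2 / (b - a)))"
    proof (rule integral_cong_AE)
      \<comment> \<open>At t = 0 the quotient is 0 by the convention on division, so the identity is
        claimed only off that point.\<close>
      have eq: "indicator {- real T..real T} t *\<^sub>R ((iexp (- (t * a)) - iexp (- (t * b))) / (\<i> * t) * char M t)
         = complex_of_real ((cmod (cutoff T ?F t))\<^sup>2 / (b - a))" if "t \<noteq> 0" for t
      proof -
        have "(iexp (- (t * a)) - iexp (- (t * b))) / (\<i> * t) * char M t = ?F t * cnj (?F t) / complex_of_real (b - a)"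
          using fourier_integral_interval[of a b t] ab that unfolding char by simp
        also have "\<dots> = complex_of_real ((cmod (?F t))\<^sup>2 / (b - a))"
          by (simp only: complex_norm_square of_real_divide)
        finally show ?thesis by (auto simp: cutoff_def split: split_indicator)
      qed
      show "AE t in lborel. indicator {- real T..real T} t *\<^sub>R ((iexp (- (t * a)) - iexp (- (t * b))) / (\<i> * t) * char M t)
         = complex_of_real ((cmod (cutoff T ?F t))\<^sup>2 / (b - a))"
        using AE_lborel_singleton[of "0::real"] by eventually_elim (rule eq)
    qed (auto simp: cutoff_def)
    also have "\<dots> = complex_of_real (sq_norm (cutoff T ?F) / (b - a))"
      unfolding sq_norm_def by (simp only: integral_complex_of_real integral_divide_zero)
    finally show ?thesis .
  qed
  \<comment> \<open>Levy's formula requires that the endpoints carry no mass.\<close>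
  have z: "measure M {c} = 0" for c
  proof -
    have "emeasure lborel ({c} \<inter> {a..b}) \<le> emeasure lborel {c}" by (intro emeasure_mono) auto
    then have "measure lborel ({c} \<inter> {a..b}) = 0" by (simp add: measure_def)
    then show ?thesis using em[of "{c}"] by (simp add: measure_def)
  qed
  have m1: "measure M {a<..b} = 1"
  proof -
    have "{a<..b} \<inter> {a..b} = {a<..b}" by auto
    then show ?thesis using em[of "{a<..b}"] ab by (simp add: measure_def)
  qed
  have "(\<lambda>T. 1 / (2 * pi) * complex_of_real (sq_norm (cutoff T ?F) / (b - a))) \<longlonglongrightarrow> complex_of_real 1"
    using M.Levy_Inversion[of a b] ab z m1 T by (simp add: mult.commute)
  moreover have "(\<lambda>T. 1 / (2 * pi) * complex_of_real (sq_norm (cutoff T ?F) / (b - a))) \<longlonglongrightarrow>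
      1 / (2 * pi) * complex_of_real (sq_norm ?F / (b - a))"
    using ab by (intro tendsto_intros sq_norm_tendsto F square_integrable_cutoff cutoff_tendsto) auto
  ultimately have "1 / (2 * pi) * complex_of_real (sq_norm ?F / (b - a)) = complex_of_real 1"
    by (rule LIMSEQ_unique[rotated])
  then have "complex_of_real (1 / (2 * pi) * (sq_norm ?F / (b - a))) = complex_of_real 1"
    by simp
  then have "1 / (2 * pi) * (sq_norm ?F / (b - a)) = 1" unfolding of_real_eq_iff .
  then have "sq_norm ?F = 2 * pi * (b - a)" using ab by (simp add: field_simps)
  moreover have "sq_norm (fourier ?I) = sq_norm ?F"
    using fourier_eq_fourier_integral[OF I Ii] square_integrable_measurable[OF square_integrable_fourier[OF I]]
    by (intro sq_norm_cong_AE) auto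
  ultimately show ?thesis using sqI by simp
qed

text \<open>The form \<open>2\<pi>\<langle>f, g\<rangle> - \<langle>fourier f, fourier g\<rangle>\<close> is positive semidefinite by Bessel's
  inequality, so it vanishes whenever \<open>g\<close> is the indicator of an interval.\<close>

lemma parseval_interval:
  assumes ab: "a < b" and f: "square_integrable f"
  shows "L2_pairing (fourier f) (\<lambda>\<xi>. cnj (fourier (indicator {a..b}) \<xi>)) =
     2 * pi * L2_pairing f (indicator {a..b})"
proof -
  let ?I = "indicator {a..b} :: real \<Rightarrow> complex"
  have I: "square_integrable ?I" by (rule square_integrable_indicator_interval)
  have cI: "(\<lambda>x. cnj (?I x)) = ?I" by (auto split: split_indicator)
  note Ff = square_integrable_fourier[OF f] and FI = square_integrable_fourier[OF I]
  define D where "D = 2 * pi * L2_pairing f ?I - L2_pairing (fourier f) (\<lambda>\<xi>. cnj (fourier ?I \<xi>))"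
  \<comment> \<open>Bessel's inequality for \<open>f + c * ?I\<close>. The terms quadratic in
    \<open>c\<close> cancel since \<open>plancherel_interval\<close> is an equality; what is left is
    affine in \<open>c\<close> and bounded below, which forces \<open>D = 0\<close>.\<close>
  have pos: "0 \<le> 2 * pi * sq_norm f - sq_norm (fourier f) + 2 * Re (cnj c * D)" for c
  proof -
    have 1: "sq_norm (\<lambda>x. f x + c * ?I x) = sq_norm f + 2 * Re (cnj c * L2_pairing f ?I) + (cmod c)\<^sup>2 * sq_norm ?I"
      using sq_norm_add_eq[OF f square_integrable_cmult[OF I, of c]] cI
      by (simp add: sq_norm_cmult L2_pairing_cmult_right fun_eq_iff)
    have 2: "AE \<xi> in lborel. fourier (\<lambda>x. f x + c * ?I x) \<xi> = fourier f \<xi> + c * fourier ?I \<xi>"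
      using fourier_add[OF f square_integrable_cmult[OF I, of c]] fourier_cmult[OF I, of c]
      by eventually_elim simp
    have "sq_norm (fourier (\<lambda>x. f x + c * ?I x)) = sq_norm (\<lambda>\<xi>. fourier f \<xi> + c * fourier ?I \<xi>)"
      using 2 f I Ff FI
      by (intro sq_norm_cong_AE square_integrable_measurable square_integrable_fourier
          square_integrable_add square_integrable_cmult)
    also have "\<dots> = sq_norm (fourier f) + 2 * Re (cnj c * L2_pairing (fourier f) (\<lambda>\<xi>. cnj (fourier ?I \<xi>)))
       + (cmod c)\<^sup>2 * sq_norm (fourier ?I)"
      using sq_norm_add_eq[OF Ff square_integrable_cmult[OF FI, of c]]
      by (simp add: sq_norm_cmult L2_pairing_cmult_right)
    finally have 3: "sq_norm (fourier (\<lambda>x. f x + c * ?I x)) = \<dots>" .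
    have "sq_norm (fourier (\<lambda>x. f x + c * ?I x)) \<le> 2 * pi * sq_norm (\<lambda>x. f x + c * ?I x)"
      by (intro fourier_bessel square_integrable_add f square_integrable_cmult I)
    then show ?thesis
      unfolding 1 3 plancherel_interval[OF ab] D_def by (simp add: algebra_simps)
  qed
  have "D = 0"
  proof (rule ccontr)
    assume "D \<noteq> 0"
    \<comment> \<open>Chosen so that \<open>pos\<close>, taken at c = - t D, becomes the absurd 0
      \<le> -1.\<close>
    define t where "t = (2 * pi * sq_norm f - sq_norm (fourier f) + 1) / (2 * (cmod D)\<^sup>2)"
    have "cnj (- complex_of_real t * D) * D = - complex_of_real t * (D * cnj D)" by simp
    also have "\<dots> = complex_of_real (- (t * (cmod D)\<^sup>2))" by (simp only: complex_norm_square of_real_mult of_real_minus mult_minus_left)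
    finally have "Re (cnj (- complex_of_real t * D) * D) = - (t * (cmod D)\<^sup>2)" by (simp only: Re_complex_of_real)
    moreover have "2 * (t * (cmod D)\<^sup>2) = 2 * pi * sq_norm f - sq_norm (fourier f) + 1"
      unfolding t_def using \<open>D \<noteq> 0\<close> by simp
    ultimately show False using pos[of "- complex_of_real t * D"] by simp
  qed
  then show ?thesis unfolding D_def by simp
qed

text \<open>The inverse transform appears as conjugate, transform, conjugate, so that no second
  operator is introduced. By the multiplication formula and \<open>parseval_interval\<close>, the
  error is orthogonal to every interval indicator and therefore vanishes almost everywhere.\<close>

lemma fourier_inversion:
  fixes f :: "real \<Rightarrow> complex"
  assumes f: "square_integrable f"
  shows "AE x in lborel. cnj (fourier (\<lambda>\<xi>. cnj (fourier f \<xi>)) x) = 2 * pi * f x"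
proof -
  define k where "k x = cnj (fourier (\<lambda>\<xi>. cnj (fourier f \<xi>)) x) - 2 * pi * f x" for x
  note Ff = square_integrable_fourier[OF f]
  note cFf = square_integrable_cnj[OF Ff]
  note K = square_integrable_cnj[OF square_integrable_fourier[OF cFf]]
  have k: "square_integrable k"
    unfolding k_def [abs_def] by (intro square_integrable_diff square_integrable_cmult K f)
  have "AE x in lborel. k x = 0"
  proof (rule AE_zero_if_interval_integrals_zero)
    show "k \<in> borel_measurable borel" by (rule square_integrable_measurable[OF k])
    show "integrable lborel (cutoff n k)" for n by (rule integrable_cutoff[OF k])
    fix a b :: real assume ab: "a < b"
    let ?I = "indicator {a..b} :: real \<Rightarrow> complex"
    have I: "square_integrable ?I" by (rule square_integrable_indicator_interval)
    have cI: "(\<lambda>x. cnj (?I x)) = ?I" by (auto split: split_indicator)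
    have "(LINT x|lborel. ?I x * k x) = L2_pairing k ?I"
      unfolding L2_pairing_def by (simp add: mult.commute)
    also have "\<dots> = L2_pairing (\<lambda>x. cnj (fourier (\<lambda>\<xi>. cnj (fourier f \<xi>)) x)) ?I - 2 * pi * L2_pairing f ?I"
      unfolding k_def [abs_def]
      by (subst L2_pairing_diff_left) (auto intro: K f I square_integrable_cmult simp: L2_pairing_cmult_left)
    also have "L2_pairing (\<lambda>x. cnj (fourier (\<lambda>\<xi>. cnj (fourier f \<xi>)) x)) ?I =
        cnj (L2_pairing (fourier (\<lambda>\<xi>. cnj (fourier f \<xi>))) ?I)"
      using L2_pairing_cnj[of "fourier (\<lambda>\<xi>. cnj (fourier f \<xi>))" ?I] unfolding cI .
    also have "L2_pairing (fourier (\<lambda>\<xi>. cnj (fourier f \<xi>))) ?I = L2_pairing (\<lambda>\<xi>. cnj (fourier f \<xi>)) (fourier ?I)"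
      by (rule fourier_multiplication_formula[OF cFf I])
    also have "cnj (L2_pairing (\<lambda>\<xi>. cnj (fourier f \<xi>)) (fourier ?I)) = L2_pairing (fourier f) (\<lambda>\<xi>. cnj (fourier ?I \<xi>))"
      using L2_pairing_cnj[of "\<lambda>\<xi>. cnj (fourier f \<xi>)" "fourier ?I"] by simp
    also have "\<dots> = 2 * pi * L2_pairing f ?I" by (rule parseval_interval[OF ab f])
    finally show "(LINT x|lborel. ?I x * k x) = 0" by simp
  qed
  then show ?thesis by eventually_elim (simp add: k_def)
qed

text \<open>The multiplication formula moves the transform onto the second factor, where inversion
  undoes it.\<close>

theorem plancherel:
  assumes f: "square_integrable f"
  shows "sq_norm (fourier f) = 2 * pi * sq_norm f"
proof -
  note Ff = square_integrable_fourier[OF f]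
  note cFf = square_integrable_cnj[OF Ff]
  note FcFf = square_integrable_fourier[OF cFf]
  have "complex_of_real (sq_norm (fourier f)) = L2_pairing (fourier f) (\<lambda>\<xi>. cnj (fourier f \<xi>))"
    by (rule L2_pairing_self[symmetric])
  also have "\<dots> = L2_pairing f (fourier (\<lambda>\<xi>. cnj (fourier f \<xi>)))"
    by (rule fourier_multiplication_formula[OF f cFf])
  also have "\<dots> = L2_pairing f (\<lambda>x. cnj (2 * pi * f x))"
  proof (rule L2_pairing_cong_AE)
    show "AE x in lborel. fourier (\<lambda>\<xi>. cnj (fourier f \<xi>)) x = cnj (2 * pi * f x)"
      using fourier_inversion[OF f] by eventually_elim (metis complex_cnj_cnj)
    show "(\<lambda>x. cnj (2 * pi * f x)) \<in> borel_measurable borel"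
      by (intro square_integrable_measurable square_integrable_cnj square_integrable_cmult f)
  qed (auto intro: square_integrable_measurable f FcFf)
  also have "\<dots> = 2 * pi * L2_pairing f (\<lambda>x. cnj (f x))"
    by (simp add: L2_pairing_cmult_right)
  also have "\<dots> = complex_of_real (2 * pi * sq_norm f)"
    by (simp add: L2_pairing_self)
  finally show ?thesis by (simp only: of_real_eq_iff)
qed

lemma parseval:
  assumes f: "square_integrable f" and g: "square_integrable g"
  shows "L2_pairing (fourier f) (\<lambda>\<xi>. cnj (fourier g \<xi>)) = 2 * pi * L2_pairing f (\<lambda>x. cnj (g x))"
proof -
  note cFg = square_integrable_cnj[OF square_integrable_fourier[OF g]]
  have "L2_pairing (fourier f) (\<lambda>\<xi>. cnj (fourier g \<xi>)) = L2_pairing f (fourier (\<lambda>\<xi>. cnj (fourier g \<xi>)))"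
    by (rule fourier_multiplication_formula[OF f cFg])
  also have "\<dots> = L2_pairing f (\<lambda>x. cnj (2 * pi * g x))"
  proof (rule L2_pairing_cong_AE)
    show "AE x in lborel. fourier (\<lambda>\<xi>. cnj (fourier g \<xi>)) x = cnj (2 * pi * g x)"
      using fourier_inversion[OF g] by eventually_elim (metis complex_cnj_cnj)
    show "(\<lambda>x. cnj (2 * pi * g x)) \<in> borel_measurable borel"
      by (intro square_integrable_measurable square_integrable_cnj square_integrable_cmult g)
  qed (auto intro: square_integrable_measurable f square_integrable_fourier[OF cFg])
  finally show ?thesis by (simp add: L2_pairing_cmult_right)
qed

text \<open>The inversion formula suggests the preimage \<open>f / (2 pi)\<close>. That its
  transform is \<open>G\<close> follows by expanding the squared norm of the error: with 4 pi^2
  times the squared norm of \<open>G\<close> as unit, the three terms are 1, -2 and 1.\<close>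

lemma fourier_surj:
  assumes G: "square_integrable G"
  shows "\<exists>g. square_integrable g \<and> (AE \<xi> in lborel. fourier g \<xi> = G \<xi>)"
proof -
  note cG = square_integrable_cnj[OF G]
  note FcG = square_integrable_fourier[OF cG]
  define f where "f x = cnj (fourier (\<lambda>\<xi>. cnj (G \<xi>)) x)" for x
  have f: "square_integrable f" unfolding f_def [abs_def] by (rule square_integrable_cnj[OF FcG])
  note Ff = square_integrable_fourier[OF f]
  define H where "H \<xi> = - 2 * pi * G \<xi>" for \<xi>
  have H: "square_integrable H" unfolding H_def [abs_def] by (rule square_integrable_cmult[OF G])
  have sf: "sq_norm f = 2 * pi * sq_norm G"
    using plancherel[OF cG] unfolding f_def by simp
  have cf: "(\<lambda>x. cnj (f x)) = fourier (\<lambda>\<xi>. cnj (G \<xi>))" unfolding f_def by simp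
  have "L2_pairing (fourier f) (\<lambda>\<xi>. cnj (H \<xi>)) = - 2 * pi * L2_pairing (fourier f) (\<lambda>\<xi>. cnj (G \<xi>))"
    unfolding H_def using L2_pairing_cmult_right[of "fourier f" "- 2 * pi" "\<lambda>\<xi>. cnj (G \<xi>)"] by simp
  also have "L2_pairing (fourier f) (\<lambda>\<xi>. cnj (G \<xi>)) = L2_pairing f (\<lambda>x. cnj (f x))"
    unfolding cf by (rule fourier_multiplication_formula[OF f cG])
  also have "\<dots> = sq_norm f" by (rule L2_pairing_self)
  finally have cross: "L2_pairing (fourier f) (\<lambda>\<xi>. cnj (H \<xi>)) = complex_of_real (- 2 * pi * sq_norm f)" by simp
  have "sq_norm (\<lambda>\<xi>. fourier f \<xi> + H \<xi>) = sq_norm (fourier f) + 2 * Re (L2_pairing (fourier f) (\<lambda>\<xi>. cnj (H \<xi>))) + sq_norm H"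
    by (rule sq_norm_add_eq[OF Ff H])
  also have "sq_norm H = (2 * pi)\<^sup>2 * sq_norm G"
    unfolding H_def using sq_norm_cmult[of "- 2 * pi" G] by (simp add: norm_mult)
  also have "sq_norm (fourier f) = 2 * pi * sq_norm f" by (rule plancherel[OF f])
  finally have "sq_norm (\<lambda>\<xi>. fourier f \<xi> + H \<xi>) = 0"
    unfolding cross sf by (simp add: power2_eq_square)
  from sq_norm_eq_0_AE[OF square_integrable_add[OF Ff H] this]
  have "AE \<xi> in lborel. fourier f \<xi> = 2 * pi * G \<xi>"
    by eventually_elim (simp add: H_def)
  with fourier_cmult[OF f, of "1 / (2 * pi)"]
  have "AE \<xi> in lborel. fourier (\<lambda>x. 1 / (2 * pi) * f x) \<xi> = G \<xi>"
    by eventually_elim simp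
  then show ?thesis using square_integrable_cmult[OF f] by blast
qed

lemma fourier_inj:
  assumes f: "square_integrable f" and g: "square_integrable g"
    and eq: "AE \<xi> in lborel. fourier f \<xi> = fourier g \<xi>"
  shows "AE x in lborel. f x = g x"
proof -
  have "fourier (\<lambda>\<xi>. cnj (fourier f \<xi>)) = fourier (\<lambda>\<xi>. cnj (fourier g \<xi>))"
    by (intro fourier_cong_AE square_integrable_cnj square_integrable_fourier f g)
       (use eq in eventually_elim, simp)
  with fourier_inversion[OF f] fourier_inversion[OF g]
  show ?thesis by (auto elim: eventually_elim2)
qed

subsection \<open>Norms of Fourier multipliers\<close>

text \<open>Surjectivity of the transform provides a candidate, so the \<open>SOME\<close> in
  \<open>multiplier\<close> is meaningful whenever the product with the symbol is square
  integrable.\<close>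

lemma multiplier_exists:
  assumes f: "square_integrable f" and s: "s \<in> borel_measurable borel"
    and fin: "(\<integral>\<^sup>+\<xi>. ennreal ((s \<xi>)\<^sup>2 * (cmod (fourier f \<xi>))\<^sup>2) \<partial>lborel) < \<infinity>"
  shows "is_multiplier s f (multiplier s f)"
proof -
  note [measurable] = s square_integrable_measurable[OF square_integrable_fourier[OF f]]
  have "square_integrable (\<lambda>\<xi>. complex_of_real (s \<xi>) * fourier f \<xi>)"
    by (rule square_integrableI) (use fin in \<open>auto simp: norm_mult power_mult_distrib\<close>)
  from fourier_surj[OF this] obtain g where "is_multiplier s f g"
    unfolding is_multiplier_def using f by blast
  then show ?thesis unfolding multiplier_def by (rule someI[of "is_multiplier s f"])
qed

text \<open>Plancherel makes the norm independent of the chosen representative and turns finiteness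
  of the norm into finiteness of a weighted integral. From here on, norms are handled only through
  that integral.\<close>

lemma multiplier_norm_eq:
  assumes f: "square_integrable f" and s: "s \<in> borel_measurable borel"
  defines "E \<equiv> \<integral>\<^sup>+\<xi>. ennreal ((s \<xi>)\<^sup>2 * (cmod (fourier f \<xi>))\<^sup>2) \<partial>lborel"
  shows "multiplier_norm s f = (if E < \<infinity> then ennreal (sqrt (enn2real E / (2 * pi))) else \<infinity>)"
proof -
  note [measurable] = s square_integrable_measurable[OF square_integrable_fourier[OF f]]
  have val: "E = ennreal (2 * pi * sq_norm g)" if g: "is_multiplier s f g" for g
  proof -
    have g1: "square_integrable g" and g2: "AE \<xi> in lborel. fourier g \<xi> = complex_of_real (s \<xi>) * fourier f \<xi>"
      using g unfolding is_multiplier_def by auto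
    have "E = (\<integral>\<^sup>+\<xi>. ennreal ((cmod (fourier g \<xi>))\<^sup>2) \<partial>lborel)"
      unfolding E_def
      by (intro nn_integral_cong_AE) (use g2 in eventually_elim, simp add: norm_mult power_mult_distrib)
    also have "\<dots> = ennreal (2 * pi * sq_norm g)"
      by (simp add: square_integrable_nn[OF square_integrable_fourier[OF g1]] plancherel[OF g1])
    finally show ?thesis .
  qed
  show ?thesis
  proof (cases "E < \<infinity>")
    case True
    have m: "is_multiplier s f (multiplier s f)"
      by (rule multiplier_exists[OF f s]) (use True in \<open>simp add: E_def\<close>)
    have "L2_norm (multiplier s f) = ennreal (sqrt (sq_norm (multiplier s f)))"
      using m by (intro L2_norm_eq) (simp add: is_multiplier_def)
    also have "sq_norm (multiplier s f) = enn2real E / (2 * pi)"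
      unfolding val[OF m] by (simp add: enn2real_ennreal)
    finally have "L2_norm (multiplier s f) = ennreal (sqrt (enn2real E / (2 * pi)))" .
    then show ?thesis using True m unfolding multiplier_norm_def by auto
  next
    case False
    then have "\<not> (\<exists>g. is_multiplier s f g)" using val by auto
    then show ?thesis using False unfolding multiplier_norm_def by auto
  qed
qed

lemma multiplier_norm_not_square_integrable:
  "\<not> square_integrable f \<Longrightarrow> multiplier_norm s f = \<infinity>"
  unfolding multiplier_norm_def is_multiplier_def by simp

subsection \<open>Jointly measurable Fourier transforms\<close>

text \<open>\<open>fourier (w t)\<close> is selected independently for each \<open>t\<close>, which
  says nothing about measurability in time. \<open>U\<close> is instead an explicit pointwise limit
  of truncated transforms, with a truncation index depending measurably on \<open>t\<close>.\<close>

lemma jointly_measurable_fourier: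
  fixes w :: "real \<Rightarrow> real \<Rightarrow> complex"
  assumes w[measurable]: "case_prod w \<in> borel_measurable (borel \<Otimes>\<^sub>M borel)"
  obtains U where "case_prod U \<in> borel_measurable (borel \<Otimes>\<^sub>M borel)"
    "\<And>t. square_integrable (w t) \<Longrightarrow> AE \<xi> in lborel. fourier (w t) \<xi> = U t \<xi>"
    "\<And>t. square_integrable (w t) \<Longrightarrow> square_integrable (U t)"
proof -
  \<comment> \<open>\<open>LEAST\<close> rather than an arbitrary choice: it makes the index a
    measurable function of \<open>t\<close> with countably many values, so substituting it preserves
    joint measurability.\<close>
  define n where "n t k = (LEAST n. sq_norm (\<lambda>x. cutoff n (w t) x - w t x) \<le> (1/4) ^ k)" for t k
  define U where "U t \<xi> = lim (\<lambda>k. truncated_fourier (n t k) (w t) \<xi>)" for t \<xi>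
  have [measurable]: "(\<lambda>t. sq_norm (\<lambda>x. cutoff n (w t) x - w t x)) \<in> borel_measurable borel" for n
    unfolding sq_norm_def cutoff_def
    by (rule lborel.borel_measurable_lebesgue_integral) measurable
  have nm[measurable]: "(\<lambda>t. n t k) \<in> measurable borel (count_space UNIV)" for k
    unfolding n_def by measurable
  have T[measurable]: "(\<lambda>z. truncated_fourier m (w (fst z)) (snd z)) \<in> borel_measurable (borel \<Otimes>\<^sub>M borel)" for m
    unfolding truncated_fourier_eq fourier_integral_def cutoff_def
    by (rule lborel.borel_measurable_lebesgue_integral) measurable
  have "(\<lambda>z. truncated_fourier (n (fst z) k) (w (fst z)) (snd z)) \<in> borel_measurable (borel \<Otimes>\<^sub>M borel)" for k
    by (rule measurable_compose_countable[where f="\<lambda>m z. truncated_fourier m (w (fst z)) (snd z)"]) measurable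
  then have "(\<lambda>z. lim (\<lambda>k. truncated_fourier (n (fst z) k) (w (fst z)) (snd z))) \<in> borel_measurable (borel \<Otimes>\<^sub>M borel)"
    by (rule borel_measurable_lim_metric)
  then have 1: "case_prod U \<in> borel_measurable (borel \<Otimes>\<^sub>M borel)"
    unfolding U_def by (simp add: case_prod_beta')
  have lim: "square_integrable (U t)" "AE \<xi> in lborel. fourier (w t) \<xi> = U t \<xi>" if t: "square_integrable (w t)" for t
  proof -
    have n: "sq_norm (\<lambda>x. cutoff (n t k) (w t) x - w t x) \<le> (1/4) ^ k" for k
      unfolding n_def using cutoff_fast[OF t] by (rule LeastI_ex)
    note L = truncated_fourier_fast_limit[OF t n]
    have Ut: "U t = (\<lambda>\<xi>. lim (\<lambda>k. truncated_fourier (n t k) (w t) \<xi>))" by (simp add: U_def fun_eq_iff)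
    show "square_integrable (U t)" unfolding Ut by (rule L)
    show "AE \<xi> in lborel. fourier (w t) \<xi> = U t \<xi>"
      unfolding Ut by (rule fourier_unique[OF t L])
  qed
  show ?thesis by (rule that[OF 1 lim(2) lim(1)])
qed

section \<open>Functions on the half-line of times\<close>

lemma space_time_measure [simp]: "space time_measure = {0<..}"
  unfolding time_measure_def by (simp add: space_restrict_space)

lemma sets_time_measure: "sets time_measure = sets (restrict_space borel {0<..})"
  unfolding time_measure_def by (simp add: sets_restrict_space)

text \<open>Extension by zero to negative times lets all later measurability arguments run on the
  plane with its Borel sets, free of restricted spaces.\<close>

lemma measurable_extend_time:
  fixes u :: "real \<Rightarrow> real \<Rightarrow> real"
  assumes u: "case_prod u \<in> borel_measurable (time_measure \<Otimes>\<^sub>M lborel)"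
  shows "(\<lambda>(t, x). if 0 < t then u t x else 0) \<in> borel_measurable (borel \<Otimes>\<^sub>M borel)"
proof -
  let ?S = "{z :: real \<times> real. 0 < fst z}"
  have S: "?S \<in> sets (borel \<Otimes>\<^sub>M borel)"
  proof -
    have "{z \<in> space (borel \<Otimes>\<^sub>M borel :: (real \<times> real) measure). 0 < fst z} \<in> sets (borel \<Otimes>\<^sub>M borel)" by measurable
    then show ?thesis by (simp add: space_pair_measure)
  qed
  have "(\<lambda>z. (fst z, snd z)) \<in> measurable (restrict_space (borel \<Otimes>\<^sub>M borel) ?S) (time_measure \<Otimes>\<^sub>M lborel)"
  proof (rule measurable_Pair)
    have "fst \<in> measurable (restrict_space (borel \<Otimes>\<^sub>M borel) ?S) (restrict_space borel {0<..})"
      by (rule measurable_restrict_space2) (auto simp: space_restrict_space intro!: measurable_restrict_space1)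
    then show "fst \<in> measurable (restrict_space (borel \<Otimes>\<^sub>M borel) ?S) time_measure"
      using measurable_cong_sets[OF refl sets_time_measure] by blast
    show "snd \<in> measurable (restrict_space (borel \<Otimes>\<^sub>M borel) ?S) lborel"
      by (intro measurable_restrict_space1) simp
  qed
  from measurable_compose[OF this u]
  have "(\<lambda>z. u (fst z) (snd z)) \<in> borel_measurable (restrict_space (borel \<Otimes>\<^sub>M borel) ?S)"
    by (simp add: case_prod_beta')
  moreover have "(\<lambda>z. 0::real) \<in> borel_measurable (restrict_space (borel \<Otimes>\<^sub>M borel) {z. \<not> 0 < fst z})" by simp
  ultimately have "(\<lambda>z. if 0 < fst z then u (fst z) (snd z) else 0) \<in> borel_measurable (borel \<Otimes>\<^sub>M borel)"
    using S by (subst measurable_If_restrict_space_iff) (auto simp: space_pair_measure)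
  then show ?thesis by (simp add: case_prod_beta')
qed

lemma AE_time_measure_iff: "(AE t in time_measure. P t) \<longleftrightarrow> (AE t in lborel. 0 < t \<longrightarrow> P t)"
  unfolding time_measure_def by (subst AE_restrict_space_iff) auto

lemma measurable_time_measureI:
  "f \<in> borel_measurable borel \<Longrightarrow> (\<And>t. 0 < t \<Longrightarrow> f t = g t) \<Longrightarrow> g \<in> borel_measurable time_measure"
  for f g :: "real \<Rightarrow> 'a::topological_space"
  using measurable_cong[of time_measure f g borel]
  by (auto simp: time_measure_def intro: measurable_restrict_space1)

text \<open>Needed for the conclusion of the theorem: an almost everywhere bound yields a bound of
  \<open>esssup\<close> through \<open>esssup_I\<close>, which asks for measurability.\<close>

lemma measurable_multiplier_norm:
  assumes u: "case_prod u \<in> borel_measurable (time_measure \<Otimes>\<^sub>M lborel)"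
    and s[measurable]: "s \<in> borel_measurable borel"
  shows "(\<lambda>t. multiplier_norm s (\<lambda>x. complex_of_real (u t x))) \<in> borel_measurable time_measure"
proof -
  define w where "w t x = complex_of_real (if 0 < t then u t x else 0)" for t x
  have w[measurable]: "case_prod w \<in> borel_measurable (borel \<Otimes>\<^sub>M borel)"
    using measurable_compose[OF measurable_extend_time[OF u], of complex_of_real borel]
    unfolding w_def by (simp add: case_prod_beta')
  obtain U where U[measurable]: "case_prod U \<in> borel_measurable (borel \<Otimes>\<^sub>M borel)"
    and UF: "\<And>t. square_integrable (w t) \<Longrightarrow> AE \<xi> in lborel. fourier (w t) \<xi> = U t \<xi>"
    and Usq: "\<And>t. square_integrable (w t) \<Longrightarrow> square_integrable (U t)"
    by (rule jointly_measurable_fourier[OF w]) (rule that, assumption+)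
  define N where "N t = (\<integral>\<^sup>+x. ennreal ((cmod (w t x))\<^sup>2) \<partial>lborel)" for t
  define E where "E t = (\<integral>\<^sup>+\<xi>. ennreal ((s \<xi>)\<^sup>2 * (cmod (U t \<xi>))\<^sup>2) \<partial>lborel)" for t
  have [measurable]: "N \<in> borel_measurable borel" "E \<in> borel_measurable borel"
    unfolding N_def E_def by measurable
  have wt: "w t \<in> borel_measurable borel" for t
    using measurable_compose[OF measurable_Pair1' w] by simp
  have sq: "square_integrable (w t) \<longleftrightarrow> N t < \<infinity>" for t
    unfolding N_def using square_integrableI[OF wt, of t] square_integrable_nn[of "w t"] by auto
  \<comment> \<open>Both ways in which the norm can be infinite, a slice outside L2 or an infinite
    weighted integral, become measurable conditions on \<open>t\<close>.\<close>
  have "multiplier_norm s (w t) =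
     (if N t < \<infinity> \<and> E t < \<infinity> then ennreal (sqrt (enn2real (E t) / (2 * pi))) else \<infinity>)" for t
  proof (cases "square_integrable (w t)")
    case True
    have "(\<integral>\<^sup>+\<xi>. ennreal ((s \<xi>)\<^sup>2 * (cmod (fourier (w t) \<xi>))\<^sup>2) \<partial>lborel) = E t"
      unfolding E_def by (intro nn_integral_cong_AE) (use UF[OF True] in eventually_elim, simp)
    then show ?thesis using multiplier_norm_eq[OF True s] True sq by simp
  next
    case False
    then show ?thesis using sq multiplier_norm_not_square_integrable by auto
  qed
  then have "(\<lambda>t. multiplier_norm s (w t)) \<in> borel_measurable borel" by simp
  moreover have "w t = (\<lambda>x. complex_of_real (u t x))" if "0 < t" for t
    using that by (simp add: w_def fun_eq_iff)
  ultimately show ?thesis by (rule_tac measurable_time_measureI[of "\<lambda>t. multiplier_norm s (w t)"]) auto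
qed

subsection \<open>Weighted estimates on the Fourier side\<close>

text \<open>The inhomogeneous frequency weight. Being at least 1, its powers increase with the
  exponent at every frequency, which fails for powers of |\<xi>|.\<close>

definition weight :: "real \<Rightarrow> real" where
  "weight \<xi> = 1 + \<bar>\<xi>\<bar>"

lemma weight_ge_1: "1 \<le> weight \<xi>"
  unfolding weight_def by simp

lemma weight_pos [simp]: "0 < weight \<xi>"
  unfolding weight_def by simp

lemma weight_nonneg [simp]: "0 \<le> weight \<xi>"
  unfolding weight_def by simp

lemma borel_measurable_weight [measurable]: "weight \<in> borel_measurable borel"
  unfolding weight_def [abs_def] by measurable

lemma powr_squared: "(x powr b)\<^sup>2 = x powr (2 * b)" for x b :: real
  by (simp add: power2_eq_square flip: powr_add)

lemma nn_integral_powr_tail: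
  assumes "1 < p"
  shows "(\<integral>\<^sup>+x. ennreal ((1 + x) powr - p) * indicator {0..} x \<partial>lborel) < \<infinity>"
proof -
  have "(\<integral>\<^sup>+x. ennreal ((1 + x) powr - p) * indicator {0..} x \<partial>lborel) =
      ennreal (0 - (1 + 0) powr (1 - p) / (1 - p))"
  proof (rule nn_integral_FTC_atLeast)
    show "(\<lambda>x. (1 + x) powr - p) \<in> borel_measurable borel" by measurable
    show "DERIV (\<lambda>x. (1 + x) powr (1 - p) / (1 - p)) x :> (1 + x) powr - p" if "0 \<le> x" for x :: real
    proof -
      have "((\<lambda>x. (1 + x) powr (1 - p)) has_real_derivative (1 - p) * (1 + x) powr (1 - p - 1) * 1) (at x)"
        using that by (intro DERIV_chain2[OF has_real_derivative_powr]) (auto intro!: derivative_eq_intros)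
      from DERIV_cdivide[OF this, of "1 - p"] show ?thesis using assms by simp
    qed
    have "((\<lambda>x. (1 + x) powr (1 - p)) \<longlongrightarrow> 0) at_top"
      using assms by (intro tendsto_neg_powr filterlim_tendsto_add_at_top[OF tendsto_const] filterlim_ident) auto
    then show "((\<lambda>x. (1 + x) powr (1 - p) / (1 - p)) \<longlongrightarrow> 0) at_top"
      using tendsto_divide_zero by blast
  qed auto
  then show ?thesis by simp
qed

lemma nn_integral_weight_powr:
  assumes "1 < p"
  shows "(\<integral>\<^sup>+\<xi>. ennreal (weight \<xi> powr - p) \<partial>lborel) < \<infinity>"
proof -
  let ?g = "\<lambda>x. ennreal ((1 + x) powr - p) * indicator {0..} x"
  have "(\<integral>\<^sup>+\<xi>. ennreal (weight \<xi> powr - p) \<partial>lborel) \<le> (\<integral>\<^sup>+\<xi>. ?g \<xi> + ?g (0 + - 1 * \<xi>) \<partial>lborel)"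
    by (intro nn_integral_mono) (auto simp: weight_def split: split_indicator)
  also have "\<dots> = (\<integral>\<^sup>+\<xi>. ?g \<xi> \<partial>lborel) + (\<integral>\<^sup>+\<xi>. ?g (0 + - 1 * \<xi>) \<partial>lborel)"
    by (rule nn_integral_add) measurable
  also have "(\<integral>\<^sup>+\<xi>. ?g (0 + - 1 * \<xi>) \<partial>lborel) = (\<integral>\<^sup>+\<xi>. ?g \<xi> \<partial>lborel)"
    using nn_integral_real_affine[of ?g "-1" 0] by simp
  also have "(\<integral>\<^sup>+\<xi>. ?g \<xi> \<partial>lborel) + (\<integral>\<^sup>+\<xi>. ?g \<xi> \<partial>lborel) < \<infinity>"
    using nn_integral_powr_tail[OF assms] by simp
  finally show ?thesis .
qed

text \<open>The larger of the two frequencies carries the weight, so the convolution of \<open>U\<close> with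
  itself is dominated by one of an \<open>L\<^sup>2\<close> and an \<open>L\<^sup>1\<close> function; the loss of a quarter derivative
  pays for the latter, even below the exponent \<open>1/2\<close> at which \<open>H\<^sup>s\<close> becomes an algebra.\<close>

lemma weighted_convolution_estimate:
  fixes U F :: "real \<Rightarrow> complex"
  assumes [measurable]: "U \<in> borel_measurable borel" "F \<in> borel_measurable borel"
    and F: "\<And>\<xi>. ennreal (cmod (F \<xi>)) \<le> (\<integral>\<^sup>+\<eta>. ennreal (cmod (U \<eta>) * cmod (U (\<xi> - \<eta>))) \<partial>lborel)"
    and a: "1/8 \<le> a"
  shows "(\<integral>\<^sup>+\<xi>. ennreal (weight \<xi> powr (2 * a) * (cmod (F \<xi>))\<^sup>2) \<partial>lborel) \<le>
    ennreal (4 * 4 powr a) * (\<integral>\<^sup>+\<xi>. ennreal (weight \<xi> powr - (5/4)) \<partial>lborel) *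
      (\<integral>\<^sup>+\<xi>. ennreal (weight \<xi> powr (2 * (a + 1/4)) * (cmod (U \<xi>))\<^sup>2) \<partial>lborel)\<^sup>2"
proof -
  \<comment> \<open>A quarter derivative is moved between the factors: \<open>p\<close> carries a +
    1/4 and is in L2, while \<open>r\<close> carries -1/4 and will be in L1.\<close>
  define p where "p \<eta> = weight \<eta> powr (a + 1/4) * cmod (U \<eta>)" for \<eta>
  define r where "r \<eta> = weight \<eta> powr - (1/4) * cmod (U \<eta>)" for \<eta>
  have [measurable]: "p \<in> borel_measurable borel" "r \<in> borel_measurable borel"
    unfolding p_def [abs_def] r_def [abs_def] by measurable
  have p0: "0 \<le> p \<eta>" and r0: "0 \<le> r \<eta>" for \<eta> unfolding p_def r_def by auto
  define A where "A = (\<integral>\<^sup>+\<xi>. ennreal (weight \<xi> powr (2 * (a + 1/4)) * (cmod (U \<xi>))\<^sup>2) \<partial>lborel)"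
  define K where "K = (\<integral>\<^sup>+\<xi>. ennreal (weight \<xi> powr - (5/4)) \<partial>lborel)"
  define R where "R = (\<integral>\<^sup>+\<xi>. ennreal (r \<xi>) \<partial>lborel)"
  \<comment> \<open>The weight at the sum is at most twice the larger weight. The surplus power -1/4
    of the larger weight is then traded for that of the smaller one, which is bigger.\<close>
  have half: "weight \<xi> powr a * (cmod (U \<eta>) * cmod (U \<zeta>)) \<le> 2 powr a * (p \<eta> * r \<zeta>)"
    if "weight \<zeta> \<le> weight \<eta>" "\<xi> = \<eta> + \<zeta>" for \<xi> \<eta> \<zeta>
  proof -
    have "weight \<xi> \<le> 2 * weight \<eta>"
      using that abs_triangle_ineq[of \<eta> \<zeta>] unfolding weight_def by simp
    then have "weight \<xi> powr a \<le> (2 * weight \<eta>) powr a"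
      using a by (intro powr_mono2) auto
    also have "\<dots> = 2 powr a * (weight \<eta> powr (a + 1/4) * weight \<eta> powr - (1/4))"
      by (simp add: powr_mult flip: powr_add)
    also have "\<dots> \<le> 2 powr a * (weight \<eta> powr (a + 1/4) * weight \<zeta> powr - (1/4))"
      using that by (intro mult_left_mono powr_mono2') auto
    finally have "weight \<xi> powr a * (cmod (U \<eta>) * cmod (U \<zeta>)) \<le>
       2 powr a * (weight \<eta> powr (a + 1/4) * weight \<zeta> powr - (1/4)) * (cmod (U \<eta>) * cmod (U \<zeta>))"
      by (rule mult_right_mono) simp
    then show ?thesis unfolding p_def r_def by (simp add: mult_ac)
  qed
  have pt: "ennreal (weight \<xi> powr a * cmod (F \<xi>)) \<le>
      ennreal (2 * 2 powr a) * (\<integral>\<^sup>+\<eta>. ennreal (p \<eta> * r (\<xi> - \<eta>)) \<partial>lborel)" for \<xi>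
  proof -
    have "ennreal (weight \<xi> powr a * cmod (F \<xi>)) = ennreal (weight \<xi> powr a) * ennreal (cmod (F \<xi>))"
      by (rule ennreal_mult') simp
    also have "\<dots> \<le> ennreal (weight \<xi> powr a) * (\<integral>\<^sup>+\<eta>. ennreal (cmod (U \<eta>) * cmod (U (\<xi> - \<eta>))) \<partial>lborel)"
      by (intro mult_left_mono F) simp
    also have "\<dots> = (\<integral>\<^sup>+\<eta>. ennreal (weight \<xi> powr a * (cmod (U \<eta>) * cmod (U (\<xi> - \<eta>)))) \<partial>lborel)"
      by (subst nn_integral_cmult[symmetric]) (auto simp: ennreal_mult')
    also have "\<dots> \<le> (\<integral>\<^sup>+\<eta>. ennreal (2 powr a) * ennreal (p \<eta> * r (\<xi> - \<eta>)) +
        ennreal (2 powr a) * ennreal (p (\<xi> - \<eta>) * r \<eta>) \<partial>lborel)"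
    proof (intro nn_integral_mono)
      fix \<eta>
      have "weight \<xi> powr a * (cmod (U \<eta>) * cmod (U (\<xi> - \<eta>))) \<le>
          2 powr a * (p \<eta> * r (\<xi> - \<eta>)) + 2 powr a * (p (\<xi> - \<eta>) * r \<eta>)"
      proof (cases "weight (\<xi> - \<eta>) \<le> weight \<eta>")
        case True
        from half[OF this, of \<xi>] show ?thesis
          using p0[of "\<xi> - \<eta>"] r0[of \<eta>] by (auto intro: add_increasing2)
      next
        case False
        then have "weight \<xi> powr a * (cmod (U (\<xi> - \<eta>)) * cmod (U \<eta>)) \<le> 2 powr a * (p (\<xi> - \<eta>) * r \<eta>)"
          by (intro half) auto
        then show ?thesis
          using p0[of \<eta>] r0[of "\<xi> - \<eta>"] by (auto intro: add_increasing simp: mult_ac)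
      qed
      then have "ennreal (weight \<xi> powr a * (cmod (U \<eta>) * cmod (U (\<xi> - \<eta>)))) \<le>
          ennreal (2 powr a * (p \<eta> * r (\<xi> - \<eta>)) + 2 powr a * (p (\<xi> - \<eta>) * r \<eta>))"
        by (rule ennreal_leI)
      also have "\<dots> = ennreal (2 powr a) * ennreal (p \<eta> * r (\<xi> - \<eta>)) +
        ennreal (2 powr a) * ennreal (p (\<xi> - \<eta>) * r \<eta>)"
        using p0 r0 by (subst ennreal_plus) (auto simp: ennreal_mult')
      finally show "ennreal (weight \<xi> powr a * (cmod (U \<eta>) * cmod (U (\<xi> - \<eta>)))) \<le> \<dots>" .
    qed
    also have "\<dots> = ennreal (2 powr a) * (\<integral>\<^sup>+\<eta>. ennreal (p \<eta> * r (\<xi> - \<eta>)) \<partial>lborel) +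
        ennreal (2 powr a) * (\<integral>\<^sup>+\<eta>. ennreal (p (\<xi> - \<eta>) * r \<eta>) \<partial>lborel)"
      by (simp add: nn_integral_add nn_integral_cmult)
    also have "(\<integral>\<^sup>+\<eta>. ennreal (p (\<xi> - \<eta>) * r \<eta>) \<partial>lborel) = (\<integral>\<^sup>+\<eta>. ennreal (p \<eta> * r (\<xi> - \<eta>)) \<partial>lborel)"
      using nn_integral_real_affine[of "\<lambda>\<eta>. ennreal (p \<eta> * r (\<xi> - \<eta>))" "-1" \<xi>] by simp
    also have "ennreal (2 powr a) * (\<integral>\<^sup>+\<eta>. ennreal (p \<eta> * r (\<xi> - \<eta>)) \<partial>lborel) +
        ennreal (2 powr a) * (\<integral>\<^sup>+\<eta>. ennreal (p \<eta> * r (\<xi> - \<eta>)) \<partial>lborel) =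
        ennreal (2 * 2 powr a) * (\<integral>\<^sup>+\<eta>. ennreal (p \<eta> * r (\<xi> - \<eta>)) \<partial>lborel)"
      by (simp add: ennreal_mult' flip: mult_2 mult.assoc)
    finally show ?thesis .
  qed
  \<comment> \<open>Young's inequality for an L2 and an L1 function, by Cauchy-Schwarz with
    \<open>r\<close> split into two square roots.\<close>
  have cs: "(\<integral>\<^sup>+\<eta>. ennreal (p \<eta> * r (\<xi> - \<eta>)) \<partial>lborel)\<^sup>2 \<le>
      (\<integral>\<^sup>+\<eta>. ennreal ((p \<eta>)\<^sup>2) * ennreal (r (\<xi> - \<eta>)) \<partial>lborel) * R" for \<xi>
  proof -
    have "(\<integral>\<^sup>+\<eta>. ennreal (p \<eta> * r (\<xi> - \<eta>)) \<partial>lborel) =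
        (\<integral>\<^sup>+\<eta>. ennreal (p \<eta> * sqrt (r (\<xi> - \<eta>))) * ennreal (sqrt (r (\<xi> - \<eta>))) \<partial>lborel)"
      using p0 r0 by (intro nn_integral_cong) (simp flip: ennreal_mult)
    also have "\<dots>\<^sup>2 \<le> (\<integral>\<^sup>+\<eta>. (ennreal (p \<eta> * sqrt (r (\<xi> - \<eta>))))\<^sup>2 \<partial>lborel) *
        (\<integral>\<^sup>+\<eta>. (ennreal (sqrt (r (\<xi> - \<eta>))))\<^sup>2 \<partial>lborel)"
      by (rule Cauchy_Schwarz_nn_integral) measurable
    also have "(\<integral>\<^sup>+\<eta>. (ennreal (p \<eta> * sqrt (r (\<xi> - \<eta>))))\<^sup>2 \<partial>lborel) =
        (\<integral>\<^sup>+\<eta>. ennreal ((p \<eta>)\<^sup>2) * ennreal (r (\<xi> - \<eta>)) \<partial>lborel)"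
      using p0 r0 by (intro nn_integral_cong) (simp add: ennreal_power power_mult_distrib ennreal_mult')
    also have "(\<integral>\<^sup>+\<eta>. (ennreal (sqrt (r (\<xi> - \<eta>))))\<^sup>2 \<partial>lborel) = (\<integral>\<^sup>+\<eta>. ennreal (r (\<xi> - \<eta>)) \<partial>lborel)"
      using r0 by (intro nn_integral_cong) (simp add: ennreal_power)
    also have "\<dots> = R"
      unfolding R_def using nn_integral_real_affine[of "\<lambda>\<eta>. ennreal (r \<eta>)" "-1" \<xi>] by simp
    finally show ?thesis .
  qed
  have P: "(\<integral>\<^sup>+\<eta>. ennreal ((p \<eta>)\<^sup>2) \<partial>lborel) = A"
    unfolding A_def p_def
    by (intro nn_integral_cong) (simp add: power_mult_distrib powr_squared)
  \<comment> \<open>Here \<open>r\<close> is \<open>p\<close> times the weight to the power -1/2 -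
    a, whose square has exponent -1 - 2a. For a \<ge> 1/8 this is at most -5/4, which is integrable;
    this is where the bound on \<open>a\<close> comes from.\<close>
  have RA: "R\<^sup>2 \<le> K * A"
  proof -
    have "R = (\<integral>\<^sup>+\<xi>. ennreal (weight \<xi> powr (- (1/2) - a)) * ennreal (p \<xi>) \<partial>lborel)"
      unfolding R_def r_def p_def
      by (intro nn_integral_cong) (simp flip: ennreal_mult' powr_add mult.assoc)
    also have "\<dots>\<^sup>2 \<le> (\<integral>\<^sup>+\<xi>. (ennreal (weight \<xi> powr (- (1/2) - a)))\<^sup>2 \<partial>lborel) * (\<integral>\<^sup>+\<xi>. (ennreal (p \<xi>))\<^sup>2 \<partial>lborel)"
      by (rule Cauchy_Schwarz_nn_integral) measurable
    also have "(\<integral>\<^sup>+\<xi>. (ennreal (p \<xi>))\<^sup>2 \<partial>lborel) = A"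
      unfolding P[symmetric] using p0 by (intro nn_integral_cong) (simp add: ennreal_power)
    also have "(\<integral>\<^sup>+\<xi>. (ennreal (weight \<xi> powr (- (1/2) - a)))\<^sup>2 \<partial>lborel) \<le> K"
      unfolding K_def
    proof (intro nn_integral_mono)
      fix \<xi>
      have "weight \<xi> powr (- 1 - 2 * a) \<le> weight \<xi> powr - (5/4)"
        using a weight_ge_1 by (intro powr_mono) auto
      then show "(ennreal (weight \<xi> powr (- (1/2) - a)))\<^sup>2 \<le> ennreal (weight \<xi> powr - (5/4))"
        by (simp add: ennreal_power powr_squared algebra_simps)
    qed
    finally show ?thesis by (simp add: mult_right_mono)
  qed
  have "(\<integral>\<^sup>+\<xi>. ennreal (weight \<xi> powr (2 * a) * (cmod (F \<xi>))\<^sup>2) \<partial>lborel) =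
      (\<integral>\<^sup>+\<xi>. (ennreal (weight \<xi> powr a * cmod (F \<xi>)))\<^sup>2 \<partial>lborel)"
    by (intro nn_integral_cong) (simp add: ennreal_power power_mult_distrib powr_squared mult.commute)
  also have "\<dots> \<le> (\<integral>\<^sup>+\<xi>. ennreal (4 * 4 powr a) * (R * (\<integral>\<^sup>+\<eta>. ennreal ((p \<eta>)\<^sup>2) * ennreal (r (\<xi> - \<eta>)) \<partial>lborel)) \<partial>lborel)"
  proof (intro nn_integral_mono)
    fix \<xi>
    have "(ennreal (weight \<xi> powr a * cmod (F \<xi>)))\<^sup>2 \<le>
       (ennreal (2 * 2 powr a) * (\<integral>\<^sup>+\<eta>. ennreal (p \<eta> * r (\<xi> - \<eta>)) \<partial>lborel))\<^sup>2"
      by (intro power_mono pt) simp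
    also have "\<dots> = (ennreal (2 * 2 powr a))\<^sup>2 * (\<integral>\<^sup>+\<eta>. ennreal (p \<eta> * r (\<xi> - \<eta>)) \<partial>lborel)\<^sup>2"
      by (rule power_mult_distrib)
    also have "(ennreal (2 * 2 powr a))\<^sup>2 = ennreal (4 * 4 powr a)"
      using powr_mult[of 2 2 a] by (subst ennreal_power) (auto simp: power2_eq_square)
    also have "ennreal (4 * 4 powr a) * (\<integral>\<^sup>+\<eta>. ennreal (p \<eta> * r (\<xi> - \<eta>)) \<partial>lborel)\<^sup>2 \<le>
        ennreal (4 * 4 powr a) * ((\<integral>\<^sup>+\<eta>. ennreal ((p \<eta>)\<^sup>2) * ennreal (r (\<xi> - \<eta>)) \<partial>lborel) * R)"
      by (intro mult_left_mono cs) simp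
    finally show "(ennreal (weight \<xi> powr a * cmod (F \<xi>)))\<^sup>2 \<le>
        ennreal (4 * 4 powr a) * (R * (\<integral>\<^sup>+\<eta>. ennreal ((p \<eta>)\<^sup>2) * ennreal (r (\<xi> - \<eta>)) \<partial>lborel))"
      by (simp add: mult.commute)
  qed
  also have "\<dots> = ennreal (4 * 4 powr a) * (R * (\<integral>\<^sup>+\<xi>. \<integral>\<^sup>+\<eta>. ennreal ((p \<eta>)\<^sup>2) * ennreal (r (\<xi> - \<eta>)) \<partial>lborel \<partial>lborel))"
    by (simp add: nn_integral_cmult)
  also have "(\<integral>\<^sup>+\<xi>. \<integral>\<^sup>+\<eta>. ennreal ((p \<eta>)\<^sup>2) * ennreal (r (\<xi> - \<eta>)) \<partial>lborel \<partial>lborel) =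
      (\<integral>\<^sup>+\<eta>. \<integral>\<^sup>+\<xi>. ennreal ((p \<eta>)\<^sup>2) * ennreal (r (\<xi> - \<eta>)) \<partial>lborel \<partial>lborel)"
    by (rule lborel_pair.Fubini') measurable
  also have "\<dots> = (\<integral>\<^sup>+\<eta>. ennreal ((p \<eta>)\<^sup>2) * R \<partial>lborel)"
  proof (intro nn_integral_cong)
    fix \<eta>
    have "(\<integral>\<^sup>+\<xi>. ennreal (r (\<xi> - \<eta>)) \<partial>lborel) = R"
      unfolding R_def using nn_integral_real_affine[of "\<lambda>\<eta>. ennreal (r \<eta>)" 1 "- \<eta>"] by simp
    then show "(\<integral>\<^sup>+\<xi>. ennreal ((p \<eta>)\<^sup>2) * ennreal (r (\<xi> - \<eta>)) \<partial>lborel) = ennreal ((p \<eta>)\<^sup>2) * R"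
      by (simp add: nn_integral_cmult)
  qed
  also have "\<dots> = A * R" by (simp add: nn_integral_multc P)
  also have "ennreal (4 * 4 powr a) * (R * (A * R)) = ennreal (4 * 4 powr a) * (A * R\<^sup>2)"
    by (simp add: power2_eq_square mult_ac)
  also have "\<dots> \<le> ennreal (4 * 4 powr a) * (A * (K * A))"
    by (intro mult_left_mono RA) auto
  also have "\<dots> = ennreal (4 * 4 powr a) * K * A\<^sup>2"
    by (simp add: power2_eq_square mult_ac)
  finally show ?thesis unfolding A_def K_def .
qed

text \<open>A function of time that dominates
  \<open>w powr (5/4) * exp (- \<tau> * l) / (2 * c)\<close> for all w \<ge> 1 at once. The exponent
  5/6 is 5/4 divided by 3/2, the rate at which dissipation of order 3/2 trades frequency for time.
  As 5/6 < 1, the singularity at 0 is integrable; the exponential keeps the integral finite over all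
  times, so the final bound does not grow with \<open>t\<close>.\<close>

definition smoothing_kernel :: "real \<Rightarrow> real \<Rightarrow> real" where
  "smoothing_kernel c \<tau> = 1 / c * (c * \<tau>) powr - (5/6) * exp (- (c * \<tau> / 2))"

lemma borel_measurable_smoothing_kernel [measurable]: "smoothing_kernel c \<in> borel_measurable borel"
  unfolding smoothing_kernel_def [abs_def] by measurable

lemma smoothing_kernel_nonneg: "0 < c \<Longrightarrow> 0 \<le> smoothing_kernel c \<tau>"
  unfolding smoothing_kernel_def by simp

lemma powr_le_exp_half:
  assumes "0 < (y::real)"
  shows "y powr (5/6) \<le> 2 * exp (y / 2)"
proof (cases "y \<le> 1")
  case True
  then have "y powr (5/6) \<le> 1" using assms by (simp add: powr_le1)
  also have "1 \<le> 2 * exp (y / 2)" using assms exp_ge_add_one_self[of "y / 2"] by linarith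
  finally show ?thesis .
next
  case False
  then have "y powr (5/6) \<le> y powr 1" by (intro powr_mono) auto
  also have "\<dots> = y" using assms by simp
  also have "y \<le> 2 * exp (y / 2)" using exp_ge_add_one_self[of "y / 2"] by linarith
  finally show ?thesis .
qed

text \<open>In terms of y = c \<tau> w^(3/2), the power w^(5/4) is (y / (c \<tau>))^(5/6). Half of
  the exponential in y absorbs y^(5/6); the other half gives decay in time, because y \<ge> c
  \<tau>.\<close>

lemma smoothing_bound:
  assumes c: "0 < c" and \<tau>: "0 < \<tau>" and w: "1 \<le> w" and l: "c * w powr (3/2) \<le> l"
  shows "w powr (5/4) * exp (- \<tau> * l) / (2 * c) \<le> smoothing_kernel c \<tau>"
proof -
  define y where "y = c * \<tau> * w powr (3/2)"
  have y: "0 < y" unfolding y_def using c \<tau> w by simp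
  have w1: "1 \<le> w powr (3/2)" using w by (simp add: ge_one_powr_ge_zero)
  have yct: "c * \<tau> \<le> y" unfolding y_def using w1 c \<tau> by simp
  have "\<tau> * (c * w powr (3/2)) \<le> \<tau> * l" using l \<tau> by (intro mult_left_mono) auto
  then have yl: "y \<le> \<tau> * l" unfolding y_def by (simp add: mult_ac)
  have "w powr (5/4) = (y / (c * \<tau>)) powr (5/6)"
    unfolding y_def using c \<tau> by (simp add: powr_powr)
  also have "\<dots> = y powr (5/6) * (c * \<tau>) powr - (5/6)"
    using y c \<tau> by (simp add: powr_divide powr_minus_divide)
  finally have "w powr (5/4) * exp (- \<tau> * l) = (c * \<tau>) powr - (5/6) * (y powr (5/6) * exp (- \<tau> * l))"
    by simp
  also have "\<dots> \<le> (c * \<tau>) powr - (5/6) * (2 * exp (- (c * \<tau> / 2)))"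
  proof (intro mult_left_mono)
    have "y powr (5/6) * exp (- \<tau> * l) \<le> 2 * exp (y / 2) * exp (- y)"
      using yl by (intro mult_mono powr_le_exp_half y) auto
    also have "\<dots> = 2 * exp (- (y / 2))" by (simp flip: exp_add)
    also have "\<dots> \<le> 2 * exp (- (c * \<tau> / 2))" using yct by simp
    finally show "y powr (5/6) * exp (- \<tau> * l) \<le> 2 * exp (- (c * \<tau> / 2))" .
  qed simp
  finally show ?thesis unfolding smoothing_kernel_def using c by (simp add: field_simps)
qed

lemma nn_integral_exp_decay:
  assumes "0 < (l::real)"
  shows "(\<integral>\<^sup>+\<tau>. ennreal (exp (- l * \<tau>)) * indicator {0..} \<tau> \<partial>lborel) = ennreal (1 / l)"
proof -
  have "(\<integral>\<^sup>+\<tau>. ennreal (exp (- l * \<tau>)) * indicator {0..} \<tau> \<partial>lborel) = ennreal (0 - (- exp (- l * 0) / l))"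
  proof (rule nn_integral_FTC_atLeast)
    show "DERIV (\<lambda>\<tau>. - exp (- l * \<tau>) / l) \<tau> :> exp (- l * \<tau>)" for \<tau>
      using assms by (auto intro!: derivative_eq_intros)
    have "filterlim (\<lambda>\<tau>. - l * \<tau>) at_bot at_top"
      by (rule filterlim_tendsto_neg_mult_at_bot[OF tendsto_const _ filterlim_ident]) (use assms in simp)
    from tendsto_minus[OF tendsto_divide_zero[OF filterlim_compose[OF exp_at_bot this], of l]]
    show "((\<lambda>\<tau>. - exp (- l * \<tau>) / l) \<longlongrightarrow> 0) at_top" by simp
  qed auto
  then show ?thesis by simp
qed

lemma nn_integral_smoothing_kernel:
  assumes c: "0 < c"
  shows "(\<integral>\<^sup>+\<tau>. ennreal (smoothing_kernel c \<tau>) * indicator {0<..} \<tau> \<partial>lborel) < \<infinity>"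
proof -
  let ?k = "1 / c * c powr - (5/6)"
  \<comment> \<open>The singular part is integrated over times up to 1; its value 6 is 1 / (1 -
    5/6). Later times are left to the exponential.\<close>
  have "((\<lambda>\<tau>. if \<tau> \<in> {0..1} then \<tau> powr - (5/6) else 0) has_integral (1 powr (- (5/6) + 1) / (- (5/6) + 1))) (UNIV :: real set)"
    unfolding has_integral_restrict_UNIV by (rule has_integral_powr_from_0) auto
  then have "((\<lambda>\<tau>. \<tau> powr - (5/6) * indicator {0..1} \<tau>) has_integral 6) (UNIV :: real set)"
    by (rule has_integral_eq_rhs[OF has_integral_eq[rotated]]) auto
  then have 1: "(\<integral>\<^sup>+\<tau>. ennreal (\<tau> powr - (5/6) * indicator {0..1} \<tau>) \<partial>lborel) = ennreal 6"
    by (intro nn_integral_has_integral_lborel) auto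
  have "(\<integral>\<^sup>+\<tau>. ennreal (smoothing_kernel c \<tau>) * indicator {0<..} \<tau> \<partial>lborel) \<le>
     (\<integral>\<^sup>+\<tau>. ennreal ?k * (ennreal (\<tau> powr - (5/6) * indicator {0..1} \<tau>) + ennreal (exp (- (c / 2) * \<tau>)) * indicator {0..} \<tau>) \<partial>lborel)"
  proof (intro nn_integral_mono)
    fix \<tau> :: real
    show "ennreal (smoothing_kernel c \<tau>) * indicator {0<..} \<tau> \<le>
      ennreal ?k * (ennreal (\<tau> powr - (5/6) * indicator {0..1} \<tau>) + ennreal (exp (- (c / 2) * \<tau>)) * indicator {0..} \<tau>)"
    proof (cases "0 < \<tau>")
      case True
      have "\<tau> powr - (5/6) * exp (- (c * \<tau> / 2)) \<le> \<tau> powr - (5/6) * indicator {0..1} \<tau> + exp (- (c / 2) * \<tau>)"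
      proof (cases "\<tau> \<le> 1")
        case True
        then have "\<tau> powr - (5/6) * exp (- (c * \<tau> / 2)) \<le> \<tau> powr - (5/6) * 1"
          using c \<open>0 < \<tau>\<close> by (intro mult_left_mono) auto
        then show ?thesis using True \<open>0 < \<tau>\<close> by (auto intro: add_increasing2)
      next
        case False
        have "\<tau> powr - (5/6) \<le> \<tau> powr 0" using False by (intro powr_mono) auto
        then have "\<tau> powr - (5/6) \<le> 1" using True by simp
        then have "\<tau> powr - (5/6) * exp (- (c * \<tau> / 2)) \<le> 1 * exp (- (c * \<tau> / 2))"
          by (intro mult_right_mono) auto
        then show ?thesis using False by simp
      qed
      from mult_left_mono[OF this, of ?k]
      have "smoothing_kernel c \<tau> \<le> ?k * (\<tau> powr - (5/6) * indicator {0..1} \<tau> + exp (- (c / 2) * \<tau>))"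
        unfolding smoothing_kernel_def using c True by (simp add: powr_mult mult_ac)
      then have "ennreal (smoothing_kernel c \<tau>) \<le> ennreal (?k * (\<tau> powr - (5/6) * indicator {0..1} \<tau> + exp (- (c / 2) * \<tau>)))"
        by (rule ennreal_leI)
      also have "\<dots> = ennreal ?k * (ennreal (\<tau> powr - (5/6) * indicator {0..1} \<tau>) + ennreal (exp (- (c / 2) * \<tau>)))"
        using c by (subst ennreal_mult') (auto simp: ennreal_plus)
      finally show ?thesis using True by simp
    qed simp
  qed
  also have "\<dots> = ennreal ?k * (ennreal 6 + ennreal (1 / (c / 2)))"
    using nn_integral_exp_decay[of "c / 2"] c
    by (subst nn_integral_cmult) (auto simp: nn_integral_add 1)
  also have "\<dots> < \<infinity>" by (simp add: ennreal_mult_less_top)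
  finally show ?thesis .
qed

lemma ennreal_power2_add_le: "(a + b)\<^sup>2 \<le> 2 * a\<^sup>2 + 2 * b\<^sup>2" for a b :: ennreal
proof (cases a; cases b)
  fix x y assume "a = ennreal x" "0 \<le> x" "b = ennreal y" "0 \<le> y"
  moreover have "(x + y)\<^sup>2 \<le> 2 * x\<^sup>2 + 2 * y\<^sup>2"
    using sum_squares_bound[of x y] by (simp add: power2_sum)
  then have "ennreal ((x + y)\<^sup>2) \<le> ennreal (2 * x\<^sup>2 + 2 * y\<^sup>2)" by (rule ennreal_leI)
  then have "ennreal ((x + y)\<^sup>2) \<le> 2 * ennreal (x\<^sup>2) + 2 * ennreal (y\<^sup>2)"
    by (simp add: ennreal_plus ennreal_mult')
  ultimately show ?thesis
    by (simp add: ennreal_power flip: ennreal_plus)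
qed (auto simp: power2_eq_square ennreal_top_mult ennreal_mult_top)

text \<open>Below frequency one the weights are harmless. Above it, the dissipation dominates
  \<open>|\<xi>|\<^bsup>3/2\<^esup>\<close>, which absorbs the derivative in the nonlinearity and gains \<open>3/8\<close> further
  derivatives with an integrable singularity in time.\<close>

lemma duhamel_energy_estimate:
  fixes U\<^sub>0 U\<^sub>t :: "real \<Rightarrow> complex" and F :: "real \<Rightarrow> real \<Rightarrow> complex"
  assumes [measurable]: "U\<^sub>0 \<in> borel_measurable borel" "U\<^sub>t \<in> borel_measurable borel"
      "case_prod F \<in> borel_measurable (borel \<Otimes>\<^sub>M borel)" "L \<in> borel_measurable borel"
    and c: "0 < c" and L: "\<And>\<xi>. 1 \<le> \<bar>\<xi>\<bar> \<Longrightarrow> c * weight \<xi> powr (3/2) \<le> L \<xi>"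
    and duhamel: "AE \<xi> in lborel. ennreal (cmod (U\<^sub>t \<xi>)) \<le> ennreal (cmod (U\<^sub>0 \<xi>)) +
        ennreal (\<bar>\<xi>\<bar> / 2) * (\<integral>\<^sup>+s. ennreal (exp (- (t - s) * L \<xi>) * cmod (F s \<xi>)) * indicator {0<..<t} s \<partial>lborel)"
    and \<sigma>: "0 \<le> \<sigma>" "\<sigma> \<le> a + 3/8" "\<sigma> \<le> \<rho>"
    and F: "AE s in lborel. 0 < s \<longrightarrow> (\<integral>\<^sup>+\<xi>. ennreal (weight \<xi> powr (2 * a) * (cmod (F s \<xi>))\<^sup>2) \<partial>lborel) \<le> C"
  shows "(\<integral>\<^sup>+\<xi>. ennreal (weight \<xi> powr (2 * \<sigma>) * (cmod (U\<^sub>t \<xi>))\<^sup>2) \<partial>lborel) \<le>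
     ennreal (4 powr \<rho>) * (\<integral>\<^sup>+\<xi>. ennreal ((cmod (U\<^sub>t \<xi>))\<^sup>2) \<partial>lborel) +
     ennreal (2 * 4 powr \<rho>) * (\<integral>\<^sup>+\<xi>. ennreal (\<bar>\<xi>\<bar> powr (2 * \<rho>) * (cmod (U\<^sub>0 \<xi>))\<^sup>2) \<partial>lborel) +
     C * (\<integral>\<^sup>+\<tau>. ennreal (smoothing_kernel c \<tau>) * indicator {0<..} \<tau> \<partial>lborel)"
proof -
  let ?\<kappa> = "smoothing_kernel c"
  let ?J = "\<lambda>\<xi>. \<integral>\<^sup>+s. ennreal (?\<kappa> (t - s) * (weight \<xi> powr (2 * a) * (cmod (F s \<xi>))\<^sup>2)) * indicator {0<..<t} s \<partial>lborel"
  have pt: "ennreal (weight \<xi> powr (2 * \<sigma>) * (cmod (U\<^sub>t \<xi>))\<^sup>2) \<le>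
      ennreal (4 powr \<rho>) * ennreal ((cmod (U\<^sub>t \<xi>))\<^sup>2) +
      ennreal (2 * 4 powr \<rho>) * ennreal (\<bar>\<xi>\<bar> powr (2 * \<rho>) * (cmod (U\<^sub>0 \<xi>))\<^sup>2) + ?J \<xi>"
    if D: "ennreal (cmod (U\<^sub>t \<xi>)) \<le> ennreal (cmod (U\<^sub>0 \<xi>)) +
        ennreal (\<bar>\<xi>\<bar> / 2) * (\<integral>\<^sup>+s. ennreal (exp (- (t - s) * L \<xi>) * cmod (F s \<xi>)) * indicator {0<..<t} s \<partial>lborel)" for \<xi>
  proof (cases "1 \<le> \<bar>\<xi>\<bar>")
    \<comment> \<open>For |\<xi>| < 1 the weight is below 2, so its power is at most 2^(2 \<rho>) =
      4^\<rho> and the L2 norm is enough.\<close>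
    case False
    have "weight \<xi> powr (2 * \<sigma>) \<le> weight \<xi> powr (2 * \<rho>)"
      using \<sigma> weight_ge_1 by (intro powr_mono) auto
    also have "\<dots> \<le> 2 powr (2 * \<rho>)"
      using False \<sigma> by (intro powr_mono2) (auto simp: weight_def)
    also have "\<dots> = 4 powr \<rho>" by (simp add: powr_powr[symmetric])
    finally have "ennreal (weight \<xi> powr (2 * \<sigma>) * (cmod (U\<^sub>t \<xi>))\<^sup>2) \<le> ennreal (4 powr \<rho> * (cmod (U\<^sub>t \<xi>))\<^sup>2)"
      by (intro ennreal_leI mult_right_mono) auto
    then show ?thesis by (simp add: ennreal_mult' add_increasing2 add.assoc)
  next
    case True
    define l where "l = L \<xi>"
    define w where "w = weight \<xi>"
    have w: "1 \<le> w" "\<bar>\<xi>\<bar> \<le> w" "w \<le> 2 * \<bar>\<xi>\<bar>" using True unfolding w_def weight_def by auto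
    have cl: "c * w powr (3/2) \<le> l" using L[OF True] unfolding l_def w_def .
    have "0 < c * w powr (3/2)" using c w by simp
    then have l: "0 < l" using cl by linarith
    define I where "I = (\<integral>\<^sup>+s. ennreal (exp (- (t - s) * l) * cmod (F s \<xi>)) * indicator {0<..<t} s \<partial>lborel)"
    define J where "J = (\<integral>\<^sup>+s. ennreal (exp (- (t - s) * l) * (cmod (F s \<xi>))\<^sup>2) * indicator {0<..<t} s \<partial>lborel)"
    \<comment> \<open>The exponential is shared equally by the two factors. The factor without
      \<open>F\<close> integrates to at most 1 / l, the first of two uses of the dissipation; the
      kernel is the second.\<close>
    have IJ: "I\<^sup>2 \<le> ennreal (1 / l) * J"
    proof -
      define E where "E s = exp (- (t - s) * l / 2)" for s
      have [measurable]: "E \<in> borel_measurable borel" unfolding E_def [abs_def] by measurable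
      have sq: "(E s)\<^sup>2 = exp (- (t - s) * l)" and E0: "0 \<le> E s" for s
        unfolding E_def by (simp_all add: power2_eq_square flip: exp_add)
      have I_eq: "I = (\<integral>\<^sup>+s. (ennreal (E s) * indicator {0<..<t} s) * (ennreal (E s * cmod (F s \<xi>)) * indicator {0<..<t} s) \<partial>lborel)"
        unfolding I_def sq[symmetric] using E0
        by (intro nn_integral_cong)
           (simp split: split_indicator add: power2_eq_square mult.assoc flip: ennreal_mult')
      have "I\<^sup>2 \<le> (\<integral>\<^sup>+s. (ennreal (E s) * indicator {0<..<t} s)\<^sup>2 \<partial>lborel) *
          (\<integral>\<^sup>+s. (ennreal (E s * cmod (F s \<xi>)) * indicator {0<..<t} s)\<^sup>2 \<partial>lborel)"
        unfolding I_eq by (rule Cauchy_Schwarz_nn_integral) measurable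
      also have "(\<integral>\<^sup>+s. (ennreal (E s * cmod (F s \<xi>)) * indicator {0<..<t} s)\<^sup>2 \<partial>lborel) = J"
        unfolding J_def
      proof (intro nn_integral_cong)
        fix s
        have "(E s * cmod (F s \<xi>))\<^sup>2 = exp (- (t - s) * l) * (cmod (F s \<xi>))\<^sup>2"
          by (simp only: power_mult_distrib sq)
        moreover have "0 \<le> E s * cmod (F s \<xi>)" using E0 by simp
        ultimately have "(ennreal (E s * cmod (F s \<xi>)))\<^sup>2 = ennreal (exp (- (t - s) * l) * (cmod (F s \<xi>))\<^sup>2)"
          using ennreal_power by metis
        then show "(ennreal (E s * cmod (F s \<xi>)) * indicator {0<..<t} s)\<^sup>2 =
            ennreal (exp (- (t - s) * l) * (cmod (F s \<xi>))\<^sup>2) * indicator {0<..<t} s"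
          by (cases "s \<in> {0<..<t}") (simp_all only: indicator_simps if_True mult_1_right mult_zero_right zero_power2 simp_thms)
      qed
      also have "(\<integral>\<^sup>+s. (ennreal (E s) * indicator {0<..<t} s)\<^sup>2 \<partial>lborel) \<le> ennreal (1 / l)"
      proof -
        have "(\<integral>\<^sup>+s. (ennreal (E s) * indicator {0<..<t} s)\<^sup>2 \<partial>lborel) \<le>
            (\<integral>\<^sup>+s. ennreal (exp (- l * (t + - 1 * s))) * indicator {0..} (t + - 1 * s) \<partial>lborel)"
        proof (intro nn_integral_mono)
          fix s
          have "- (t - s) * l = - l * (t + - 1 * s)" by (simp add: algebra_simps)
          then show "(ennreal (E s) * indicator {0<..<t} s)\<^sup>2 \<le> ennreal (exp (- l * (t + - 1 * s))) * indicator {0..} (t + - 1 * s)"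
            using sq[of s] E0[of s] by (auto split: split_indicator simp: ennreal_power)
        qed
        also have "\<dots> = (\<integral>\<^sup>+\<tau>. ennreal (exp (- l * \<tau>)) * indicator {0..} \<tau> \<partial>lborel)"
          using nn_integral_real_affine[of "\<lambda>\<tau>. ennreal (exp (- l * \<tau>)) * indicator {0..} \<tau>" "-1" t] by simp
        finally show ?thesis using nn_integral_exp_decay[OF l] by simp
      qed
      finally show ?thesis by (simp add: mult_right_mono)
    qed
    \<comment> \<open>Counting powers of \<open>w\<close>: the bound on \<open>\<sigma>\<close>
      allows 2a + 3/4, the squared derivative adds 2, and dividing by \<open>l\<close> removes 3/2.
      The excess over 2a is 5/4, the power that \<open>smoothing_bound\<close> absorbs.\<close>
    have coeff: "w powr (2 * \<sigma>) * \<xi>\<^sup>2 / (2 * l) * exp (- \<tau> * l) \<le> ?\<kappa> \<tau> * w powr (2 * a)" if \<tau>: "0 < \<tau>" for \<tau>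
    proof -
      have "w powr (2 * \<sigma>) * \<xi>\<^sup>2 / (2 * l) \<le> w powr (2 * a + 3/4) * w powr 2 / (2 * (c * w powr (3/2)))"
      proof (intro frac_le mult_mono)
        show "w powr (2 * \<sigma>) \<le> w powr (2 * a + 3/4)" using \<sigma> w by (intro powr_mono) auto
        have "\<bar>\<xi>\<bar>\<^sup>2 \<le> w\<^sup>2" using w by (intro power_mono) auto
        then show "\<xi>\<^sup>2 \<le> w powr 2" using w by (simp add: powr_numeral)
      qed (use cl c w in auto)
      also have "\<dots> = w powr (2 * a) * (w powr (5/4) / (2 * c))"
      proof -
        have "w powr (2 * a + 3/4) * w powr 2 = w powr (2 * a) * w powr (5/4) * w powr (3/2)"
          by (simp flip: powr_add)
        then show ?thesis using w c by simp
      qed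
      finally have "w powr (2 * \<sigma>) * \<xi>\<^sup>2 / (2 * l) * exp (- \<tau> * l) \<le> w powr (2 * a) * (w powr (5/4) / (2 * c)) * exp (- \<tau> * l)"
        by (rule mult_right_mono) simp
      also have "\<dots> = w powr (2 * a) * (w powr (5/4) * exp (- \<tau> * l) / (2 * c))" by simp
      also have "\<dots> \<le> w powr (2 * a) * ?\<kappa> \<tau>"
        by (intro mult_left_mono smoothing_bound c \<tau> w cl) simp
      finally show ?thesis by (simp add: mult.commute)
    qed
    have ww: "w powr (2 * \<sigma>) \<le> 4 powr \<rho> * \<bar>\<xi>\<bar> powr (2 * \<rho>)"
    proof -
      have "w powr (2 * \<sigma>) \<le> w powr (2 * \<rho>)" using \<sigma> w by (intro powr_mono) auto
      also have "\<dots> \<le> (2 * \<bar>\<xi>\<bar>) powr (2 * \<rho>)" using \<sigma> w by (intro powr_mono2) auto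
      also have "\<dots> = 4 powr \<rho> * \<bar>\<xi>\<bar> powr (2 * \<rho>)" by (simp add: powr_mult powr_powr[symmetric])
      finally show ?thesis .
    qed
    have "ennreal (w powr (2 * \<sigma>) * (cmod (U\<^sub>t \<xi>))\<^sup>2) = ennreal (w powr (2 * \<sigma>)) * (ennreal (cmod (U\<^sub>t \<xi>)))\<^sup>2"
      by (simp add: ennreal_mult' ennreal_power)
    also have "\<dots> \<le> ennreal (w powr (2 * \<sigma>)) * (ennreal (cmod (U\<^sub>0 \<xi>)) + ennreal (\<bar>\<xi>\<bar> / 2) * I)\<^sup>2"
      using D unfolding I_def l_def by (intro mult_left_mono power_mono) auto
    also have "\<dots> \<le> ennreal (w powr (2 * \<sigma>)) * (2 * (ennreal (cmod (U\<^sub>0 \<xi>)))\<^sup>2 + 2 * (ennreal (\<bar>\<xi>\<bar> / 2) * I)\<^sup>2)"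
      by (intro mult_left_mono ennreal_power2_add_le) simp
    also have "\<dots> = ennreal (w powr (2 * \<sigma>)) * (2 * (ennreal (cmod (U\<^sub>0 \<xi>)))\<^sup>2) + ennreal (w powr (2 * \<sigma>)) * (2 * (ennreal (\<bar>\<xi>\<bar> / 2) * I)\<^sup>2)"
      by (rule distrib_left)
    also have "\<dots> \<le> ennreal (2 * 4 powr \<rho>) * ennreal (\<bar>\<xi>\<bar> powr (2 * \<rho>) * (cmod (U\<^sub>0 \<xi>))\<^sup>2) + ?J \<xi>"
    proof (rule add_mono)
      have "ennreal (w powr (2 * \<sigma>)) * (2 * (ennreal (cmod (U\<^sub>0 \<xi>)))\<^sup>2) = ennreal (w powr (2 * \<sigma>) * (2 * (cmod (U\<^sub>0 \<xi>))\<^sup>2))"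
        by (simp add: ennreal_mult' ennreal_power)
      also have "\<dots> \<le> ennreal (4 powr \<rho> * \<bar>\<xi>\<bar> powr (2 * \<rho>) * (2 * (cmod (U\<^sub>0 \<xi>))\<^sup>2))"
        by (intro ennreal_leI mult_right_mono ww) simp
      also have "\<dots> = ennreal (2 * 4 powr \<rho>) * ennreal (\<bar>\<xi>\<bar> powr (2 * \<rho>) * (cmod (U\<^sub>0 \<xi>))\<^sup>2)"
        by (subst ennreal_mult'[symmetric]) (auto simp: mult_ac)
      finally show "ennreal (w powr (2 * \<sigma>)) * (2 * (ennreal (cmod (U\<^sub>0 \<xi>)))\<^sup>2) \<le>
         ennreal (2 * 4 powr \<rho>) * ennreal (\<bar>\<xi>\<bar> powr (2 * \<rho>) * (cmod (U\<^sub>0 \<xi>))\<^sup>2)" .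
      have "ennreal (w powr (2 * \<sigma>)) * (2 * (ennreal (\<bar>\<xi>\<bar> / 2) * I)\<^sup>2) =
          (ennreal (w powr (2 * \<sigma>)) * (2 * (ennreal (\<bar>\<xi>\<bar> / 2))\<^sup>2)) * I\<^sup>2"
        by (simp add: power_mult_distrib mult.assoc)
      also have "ennreal (w powr (2 * \<sigma>)) * (2 * (ennreal (\<bar>\<xi>\<bar> / 2))\<^sup>2) = ennreal (w powr (2 * \<sigma>) * \<xi>\<^sup>2 / 2)"
      proof -
        have "ennreal (w powr (2 * \<sigma>)) * (2 * (ennreal (\<bar>\<xi>\<bar> / 2))\<^sup>2) =
          ennreal (w powr (2 * \<sigma>)) * (ennreal 2 * ennreal ((\<bar>\<xi>\<bar> / 2)\<^sup>2))"
          by (subst ennreal_power) auto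
        also have "\<dots> = ennreal (w powr (2 * \<sigma>) * (2 * (\<bar>\<xi>\<bar> / 2)\<^sup>2))"
          by (simp only: ennreal_mult' powr_ge_zero zero_le_numeral)
        finally show ?thesis by (simp add: power_divide)
      qed
      also have "ennreal (w powr (2 * \<sigma>) * \<xi>\<^sup>2 / 2) * I\<^sup>2 \<le> ennreal (w powr (2 * \<sigma>) * \<xi>\<^sup>2 / 2) * (ennreal (1 / l) * J)"
        by (intro mult_left_mono IJ) simp
      also have "\<dots> = ennreal (w powr (2 * \<sigma>) * \<xi>\<^sup>2 / (2 * l)) * J"
        using l by (simp add: ennreal_mult'[symmetric] mult.assoc[symmetric])
      also have "\<dots> = (\<integral>\<^sup>+s. ennreal (w powr (2 * \<sigma>) * \<xi>\<^sup>2 / (2 * l)) *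
          (ennreal (exp (- (t - s) * l) * (cmod (F s \<xi>))\<^sup>2) * indicator {0<..<t} s) \<partial>lborel)"
        unfolding J_def by (rule nn_integral_cmult[symmetric]) measurable
      also have "\<dots> \<le> ?J \<xi>"
      proof (intro nn_integral_mono)
        fix s
        show "ennreal (w powr (2 * \<sigma>) * \<xi>\<^sup>2 / (2 * l)) *
          (ennreal (exp (- (t - s) * l) * (cmod (F s \<xi>))\<^sup>2) * indicator {0<..<t} s) \<le>
          ennreal (?\<kappa> (t - s) * (weight \<xi> powr (2 * a) * (cmod (F s \<xi>))\<^sup>2)) * indicator {0<..<t} s"
        proof (cases "s \<in> {0<..<t}")
          case True
          from mult_right_mono[OF coeff[of "t - s"], of "(cmod (F s \<xi>))\<^sup>2"] True
          have "w powr (2 * \<sigma>) * \<xi>\<^sup>2 / (2 * l) * (exp (- (t - s) * l) * (cmod (F s \<xi>))\<^sup>2) \<le>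
              ?\<kappa> (t - s) * (weight \<xi> powr (2 * a) * (cmod (F s \<xi>))\<^sup>2)"
            by (simp add: w_def mult.assoc)
          then show ?thesis using True l by (simp add: ennreal_mult'[symmetric] ennreal_leI)
        qed simp
      qed
      finally show "ennreal (w powr (2 * \<sigma>)) * (2 * (ennreal (\<bar>\<xi>\<bar> / 2) * I)\<^sup>2) \<le> ?J \<xi>" .
    qed
    finally show ?thesis unfolding w_def by (simp add: add_increasing add.assoc)
  qed
  \<comment> \<open>After Fubini the time integral is a convolution with the kernel. Extending it
    from (0, t) to the whole half-line makes the bound independent of \<open>t\<close>.\<close>
  have J: "(\<integral>\<^sup>+\<xi>. ?J \<xi> \<partial>lborel) \<le> C * (\<integral>\<^sup>+\<tau>. ennreal (?\<kappa> \<tau>) * indicator {0<..} \<tau> \<partial>lborel)"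
  proof -
    have "(\<integral>\<^sup>+\<xi>. ?J \<xi> \<partial>lborel) = (\<integral>\<^sup>+s. \<integral>\<^sup>+\<xi>. ennreal (?\<kappa> (t - s) * (weight \<xi> powr (2 * a) * (cmod (F s \<xi>))\<^sup>2)) * indicator {0<..<t} s \<partial>lborel \<partial>lborel)"
      by (rule lborel_pair.Fubini') measurable
    also have "\<dots> = (\<integral>\<^sup>+s. ennreal (?\<kappa> (t - s)) * indicator {0<..<t} s * (\<integral>\<^sup>+\<xi>. ennreal (weight \<xi> powr (2 * a) * (cmod (F s \<xi>))\<^sup>2) \<partial>lborel) \<partial>lborel)"
      using smoothing_kernel_nonneg[OF c]
      by (intro nn_integral_cong, subst nn_integral_cmult[symmetric])
         (auto intro!: nn_integral_cong simp: ennreal_mult' split: split_indicator)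
    also have "\<dots> \<le> (\<integral>\<^sup>+s. ennreal (?\<kappa> (t - s)) * indicator {0<..<t} s * C \<partial>lborel)"
      by (intro nn_integral_mono_AE)
         (use F in eventually_elim, auto split: split_indicator intro: mult_left_mono)
    also have "\<dots> = (\<integral>\<^sup>+s. ennreal (?\<kappa> (t - s)) * indicator {0<..<t} s \<partial>lborel) * C"
      by (rule nn_integral_multc) measurable
    also have "(\<integral>\<^sup>+s. ennreal (?\<kappa> (t - s)) * indicator {0<..<t} s \<partial>lborel) \<le>
        (\<integral>\<^sup>+s. ennreal (?\<kappa> (t + - 1 * s)) * indicator {0<..} (t + - 1 * s) \<partial>lborel)"
      by (intro nn_integral_mono) (auto split: split_indicator)
    also have "\<dots> = (\<integral>\<^sup>+\<tau>. ennreal (?\<kappa> \<tau>) * indicator {0<..} \<tau> \<partial>lborel)"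
      using nn_integral_real_affine[of "\<lambda>\<tau>. ennreal (?\<kappa> \<tau>) * indicator {0<..} \<tau>" "-1" t] by simp
    finally show ?thesis by (simp add: mult.commute mult_right_mono)
  qed
  have "(\<integral>\<^sup>+\<xi>. ennreal (weight \<xi> powr (2 * \<sigma>) * (cmod (U\<^sub>t \<xi>))\<^sup>2) \<partial>lborel) \<le>
      (\<integral>\<^sup>+\<xi>. ennreal (4 powr \<rho>) * ennreal ((cmod (U\<^sub>t \<xi>))\<^sup>2) +
      ennreal (2 * 4 powr \<rho>) * ennreal (\<bar>\<xi>\<bar> powr (2 * \<rho>) * (cmod (U\<^sub>0 \<xi>))\<^sup>2) + ?J \<xi> \<partial>lborel)"
    by (intro nn_integral_mono_AE) (use duhamel in eventually_elim, rule pt)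
  also have "\<dots> = ennreal (4 powr \<rho>) * (\<integral>\<^sup>+\<xi>. ennreal ((cmod (U\<^sub>t \<xi>))\<^sup>2) \<partial>lborel) +
     ennreal (2 * 4 powr \<rho>) * (\<integral>\<^sup>+\<xi>. ennreal (\<bar>\<xi>\<bar> powr (2 * \<rho>) * (cmod (U\<^sub>0 \<xi>))\<^sup>2) \<partial>lborel) + (\<integral>\<^sup>+\<xi>. ?J \<xi> \<partial>lborel)"
    by (simp add: nn_integral_add nn_integral_cmult)
  also have "\<dots> \<le> ennreal (4 powr \<rho>) * (\<integral>\<^sup>+\<xi>. ennreal ((cmod (U\<^sub>t \<xi>))\<^sup>2) \<partial>lborel) +
     ennreal (2 * 4 powr \<rho>) * (\<integral>\<^sup>+\<xi>. ennreal (\<bar>\<xi>\<bar> powr (2 * \<rho>) * (cmod (U\<^sub>0 \<xi>))\<^sup>2) \<partial>lborel) +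
     C * (\<integral>\<^sup>+\<tau>. ennreal (?\<kappa> \<tau>) * indicator {0<..} \<tau> \<partial>lborel)"
    by (intro add_left_mono J)
  finally show ?thesis .
qed

subsection \<open>The dissipation symbol\<close>

text \<open>Syntactically the symbol inside \<open>sqrt_laplacian_M\<close>, so that unfolding that
  operator exposes \<open>multiplier dissipation\<close>.\<close>

definition dissipation :: "real \<Rightarrow> real" where
  "dissipation \<xi> = frac_laplacian_symbol (1/2) \<xi> * M_symbol \<xi>"

lemma borel_measurable_dissipation [measurable]: "dissipation \<in> borel_measurable borel"
proof -
  have [measurable]: "(tanh :: real \<Rightarrow> real) \<in> borel_measurable borel"
    by (intro borel_measurable_continuous_onI continuous_on_tanh continuous_on_id) simp
  show ?thesis
    unfolding dissipation_def [abs_def] frac_laplacian_symbol_def M_symbol_def by measurable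
qed

lemma dissipation_nonneg: "0 \<le> dissipation \<xi>"
proof -
  have "0 \<le> tanh \<xi> / \<xi>" by (cases "0 \<le> \<xi>") (auto simp: divide_nonpos_nonpos)
  then have "0 \<le> sqrt ((1 + \<xi>\<^sup>2) * (tanh \<xi> / \<xi>))"
    by (intro real_sqrt_ge_zero mult_nonneg_nonneg) auto
  then show ?thesis
    unfolding dissipation_def frac_laplacian_symbol_def M_symbol_def by (auto simp del: real_sqrt_ge_0_iff)
qed

lemma dissipation_even: "dissipation (- \<xi>) = dissipation \<xi>"
  unfolding dissipation_def frac_laplacian_symbol_def M_symbol_def by simp

lemma tanh_le_self: "0 \<le> x \<Longrightarrow> tanh x \<le> x" for x :: real
proof -
  assume "0 \<le> x"
  have "(\<lambda>x. x - tanh x) 0 \<le> (\<lambda>x. x - tanh x) x"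
  proof (rule DERIV_nonneg_imp_nondecreasing[OF \<open>0 \<le> x\<close>])
    fix y :: real
    have "((\<lambda>x. x - tanh x) has_real_derivative 1 - (1 - (tanh y)\<^sup>2)) (at y)"
      by (auto intro!: derivative_eq_intros)
    then show "\<exists>d. ((\<lambda>x. x - tanh x) has_real_derivative d) (at y) \<and> 0 \<le> d" by (intro exI conjI) auto
  qed
  then show ?thesis by simp
qed

lemma tanh_quotient_abs: "tanh \<xi> / \<xi> = tanh \<bar>\<xi>\<bar> / \<bar>\<xi>\<bar>" for \<xi> :: real
  by (cases "0 \<le> \<xi>") auto

text \<open>A crude bound, from tanh x \<le> x; the true order is 3/2. An integer power is
  convenient here because it is played off against the fourth-order decay of transforms of test
  functions.\<close>

lemma dissipation_le: "dissipation \<xi> \<le> (weight \<xi>)\<^sup>2"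
proof -
  have "M_symbol \<xi> \<le> weight \<xi>"
  proof (cases "\<xi> = 0")
    case True
    then show ?thesis by (simp add: M_symbol_def weight_def)
  next
    case False
    have "tanh \<xi> / \<xi> \<le> 1"
      unfolding tanh_quotient_abs[of \<xi>] using False tanh_le_self[of "\<bar>\<xi>\<bar>"] by simp
    then have "(1 + \<xi>\<^sup>2) * (tanh \<xi> / \<xi>) \<le> (1 + \<xi>\<^sup>2) * 1"
      by (intro mult_left_mono) auto
    also have "\<dots> \<le> (weight \<xi>)\<^sup>2" unfolding weight_def by (simp add: power2_sum)
    finally have "sqrt ((1 + \<xi>\<^sup>2) * (tanh \<xi> / \<xi>)) \<le> weight \<xi>"
      by (rule real_le_lsqrt[rotated 1]) simp
    then show ?thesis using False by (simp add: M_symbol_def)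
  qed
  moreover have "frac_laplacian_symbol (1/2) \<xi> \<le> weight \<xi>"
    unfolding frac_laplacian_symbol_def weight_def by (cases "\<xi> = 0") auto
  ultimately show ?thesis
    unfolding dissipation_def power2_eq_square
    by (intro mult_mono) (auto simp: frac_laplacian_symbol_def M_symbol_def tanh_quotient_abs)
qed

text \<open>For |\<xi>| \<ge> 1, monotonicity gives tanh |\<xi>| \<ge> tanh 1, and (1 + \<xi>^2) /
  |\<xi>| \<ge> |\<xi>|; the symbol thus exceeds sqrt (tanh 1) |\<xi>|^(3/2). The factor 2^(3/2)
  comes from \<open>weight \<xi>\<close> being at most 2 |\<xi>|.\<close>

lemma dissipation_ge:
  assumes "1 \<le> \<bar>\<xi>\<bar>"
  shows "sqrt (tanh 1) / 2 powr (3/2) * weight \<xi> powr (3/2) \<le> dissipation \<xi>"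
proof -
  have x0: "\<xi> \<noteq> 0" using assms by auto
  have t1: "0 < tanh (1::real)" by simp
  have "weight \<xi> powr (3/2) \<le> (2 * \<bar>\<xi>\<bar>) powr (3/2)"
    using assms by (intro powr_mono2) (auto simp: weight_def)
  also have "\<dots> = 2 powr (3/2) * (\<bar>\<xi>\<bar> powr 1 * \<bar>\<xi>\<bar> powr (1/2))"
    using powr_add[of "\<bar>\<xi>\<bar>" 1 "1/2"] by (simp add: powr_mult)
  finally have "sqrt (tanh 1) / 2 powr (3/2) * weight \<xi> powr (3/2) \<le>
      sqrt (tanh 1) / 2 powr (3/2) * (2 powr (3/2) * (\<bar>\<xi>\<bar> powr 1 * \<bar>\<xi>\<bar> powr (1/2)))"
    by (intro mult_left_mono) auto
  also have "\<dots> = \<bar>\<xi>\<bar> * (sqrt (tanh 1) * sqrt \<bar>\<xi>\<bar>)"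
    using x0 by (simp add: powr_half_sqrt)
  also have "\<dots> \<le> \<bar>\<xi>\<bar> * sqrt ((1 + \<xi>\<^sup>2) * (tanh \<xi> / \<xi>))"
  proof (intro mult_left_mono)
    have "tanh 1 * r = r\<^sup>2 * (tanh 1 / r)" if "r \<noteq> 0" for r :: real
      using that by (simp add: power2_eq_square)
    then have "tanh 1 * \<bar>\<xi>\<bar> = \<bar>\<xi>\<bar>\<^sup>2 * (tanh 1 / \<bar>\<xi>\<bar>)" using x0 by (metis abs_0_eq)
    also have "\<dots> \<le> (1 + \<xi>\<^sup>2) * (tanh \<bar>\<xi>\<bar> / \<bar>\<xi>\<bar>)"
      using assms t1 tanh_real_le_iff[of 1 "\<bar>\<xi>\<bar>"] by (intro mult_mono divide_right_mono) auto
    finally show "sqrt (tanh 1) * sqrt \<bar>\<xi>\<bar> \<le> sqrt ((1 + \<xi>\<^sup>2) * (tanh \<xi> / \<xi>))"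
      unfolding tanh_quotient_abs[of \<xi>] by (simp flip: real_sqrt_mult)
  qed simp
  also have "\<dots> = dissipation \<xi>"
    using x0 by (simp add: dissipation_def frac_laplacian_symbol_def M_symbol_def)
  finally show ?thesis .
qed

subsection \<open>Test functions\<close>

text \<open>One-variable counterpart of \<open>Ck_halfplane\<close>, with the same recursion, so
  that smoothness of a product of a time and a space function follows by induction on
  \<open>k\<close>.\<close>

primrec Ck :: "nat \<Rightarrow> (real \<Rightarrow> real) \<Rightarrow> bool" where
  "Ck 0 f \<longleftrightarrow> continuous_on UNIV f"
| "Ck (Suc k) f \<longleftrightarrow> (\<exists>f'. (\<forall>x. (f has_real_derivative f' x) (at x)) \<and> Ck k f')"

lemma DERIV_continuous_on_UNIV:
  assumes "\<And>x::real. (f has_real_derivative f' x) (at x)"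
  shows "continuous_on UNIV f"
  using assms DERIV_isCont by (blast intro: continuous_at_imp_continuous_on)

lemma Ck_Suc_D: "Ck (Suc k) f \<Longrightarrow> Ck k f"
proof (induction k arbitrary: f)
  case 0
  then show ?case using DERIV_continuous_on_UNIV by auto
next
  case (Suc k)
  then show ?case unfolding Ck.simps(2)[of "Suc k"] Ck.simps(2)[of k] by blast
qed

lemma Ck_continuous: "Ck k f \<Longrightarrow> continuous_on UNIV f"
  by (induction k) (auto intro: DERIV_continuous_on_UNIV)

lemma Ck_add: "Ck k f \<Longrightarrow> Ck k g \<Longrightarrow> Ck k (\<lambda>x. f x + g x)"
proof (induction k arbitrary: f g)
  case 0
  then show ?case by (auto intro: continuous_on_add)
next
  case (Suc k)
  then obtain f' g' where "\<And>x. (f has_real_derivative f' x) (at x)" "Ck k f'"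
    "\<And>x. (g has_real_derivative g' x) (at x)" "Ck k g'" by auto
  then show ?case using Suc.IH[of f' g']
    by (auto intro!: exI[of _ "\<lambda>x. f' x + g' x"] DERIV_add)
qed

lemma Ck_mult: "Ck k f \<Longrightarrow> Ck k g \<Longrightarrow> Ck k (\<lambda>x. f x * g x)"
proof (induction k arbitrary: f g)
  case 0
  then show ?case by (auto intro: continuous_on_mult)
next
  case (Suc k)
  then obtain f' g' where *: "\<And>x. (f has_real_derivative f' x) (at x)" "Ck k f'"
    "\<And>x. (g has_real_derivative g' x) (at x)" "Ck k g'" by auto
  have "Ck k (\<lambda>x. f' x * g x + g' x * f x)"
    using * Suc.prems[THEN Ck_Suc_D] by (rule_tac Ck_add) (rule Suc.IH; assumption)+
  then show ?case using *
    by (auto intro!: exI[of _ "\<lambda>x. f' x * g x + g' x * f x"] DERIV_mult)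
qed

lemma Ck_const: "Ck k (\<lambda>_. c)"
  by (induction k arbitrary: c) (auto intro!: exI[of _ "\<lambda>_. 0"])

lemma Ck_affine: "Ck k f \<Longrightarrow> Ck k (\<lambda>x. f (c * x + d))"
proof (induction k arbitrary: f)
  case 0
  then show ?case by (auto intro!: continuous_on_compose2[of UNIV f] continuous_intros)
next
  case (Suc k)
  then obtain f' where f': "\<And>x. (f has_real_derivative f' x) (at x)" "Ck k f'" by auto
  have "((\<lambda>x. f (c * x + d)) has_real_derivative f' (c * x + d) * c) (at x)" for x
    by (rule DERIV_chain2[OF f'(1)]) (auto intro!: derivative_eq_intros)
  moreover have "Ck k (\<lambda>x. f' (c * x + d) * c)"
    by (rule Ck_mult[OF Suc.IH[OF f'(2)] Ck_const])
  ultimately show ?case unfolding Ck.simps by (intro exI[of _ "\<lambda>x. f' (c * x + d) * c"]) simp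
qed

text \<open>The classical smooth function exp (- c / x), extended by zero and generalised by a
  polynomial factor in 1 / x. This family is closed under differentiation, so smoothness is a
  one-line induction over all polynomials.\<close>

definition flat :: "real poly \<Rightarrow> real \<Rightarrow> real \<Rightarrow> real" where
  "flat p c x = (if 0 < x then poly p (1 / x) * exp (- c / x) else 0)"

lemma tendsto_poly_times_exp:
  assumes "0 < (c::real)"
  shows "((\<lambda>z. poly p z * exp (- c * z)) \<longlongrightarrow> 0) at_top"
proof -
  have "((\<lambda>z. coeff p i * z ^ i * exp (- c * z)) \<longlongrightarrow> 0) at_top" for i
  proof -
    have "filterlim (\<lambda>z. c * z) at_top at_top"
      using assms by (rule filterlim_tendsto_pos_mult_at_top[OF tendsto_const _ filterlim_ident])
    from tendsto_mult_right_zero[OF filterlim_compose[OF tendsto_power_div_exp_0[of i] this], of "coeff p i / c ^ i"]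
    have "((\<lambda>z. coeff p i / c ^ i * ((c * z) ^ i / exp (c * z))) \<longlongrightarrow> 0) at_top" .
    moreover have "coeff p i / c ^ i * ((c * z) ^ i / exp (c * z)) = coeff p i * z ^ i * exp (- c * z)" for z
      using assms by (simp add: power_mult_distrib exp_minus divide_inverse)
    ultimately show ?thesis by simp
  qed
  then have "((\<lambda>z. \<Sum>i\<le>degree p. coeff p i * z ^ i * exp (- c * z)) \<longlongrightarrow> 0) at_top"
    by (intro tendsto_null_sum)
  then show ?thesis by (simp add: poly_altdef sum_distrib_right)
qed

text \<open>With z = 1 / x, differentiation sends \<open>p\<close> to z^2 (c p - p'); the list
  polynomial is z^2.\<close>

lemma DERIV_flat:
  assumes c: "0 < c"
  shows "(flat p c has_real_derivative flat ([:0, 0, 1:] * (smult c p - pderiv p)) c x) (at x)"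
proof -
  consider "0 < x" | "x < 0" | "x = 0" by linarith
  then show ?thesis
  proof cases
    case 1
    have d: "((\<lambda>x. poly p (1 / x) * exp (- c / x)) has_real_derivative
        poly (pderiv p) (1 / x) * (- 1 / x\<^sup>2) * exp (- c / x) + exp (- c / x) * (c / x\<^sup>2) * poly p (1 / x)) (at x)"
    proof (rule DERIV_mult)
      show "((\<lambda>x. poly p (1 / x)) has_real_derivative poly (pderiv p) (1 / x) * (- 1 / x\<^sup>2)) (at x)"
        using 1 by (intro DERIV_chain2[OF poly_DERIV]) (auto intro!: derivative_eq_intros simp: power2_eq_square)
      show "((\<lambda>x. exp (- c / x)) has_real_derivative exp (- c / x) * (c / x\<^sup>2)) (at x)"
        using 1 by (auto intro!: derivative_eq_intros simp: power2_eq_square)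
    qed
    have ev: "eventually (\<lambda>y. flat p c y = poly p (1 / y) * exp (- c / y)) (nhds x)"
      using eventually_nhds_in_open[of "{0<..}" x] 1 by (auto simp: flat_def elim: eventually_mono)
    have eq: "flat ([:0, 0, 1:] * (smult c p - pderiv p)) c x =
        poly (pderiv p) (1 / x) * (- 1 / x\<^sup>2) * exp (- c / x) + exp (- c / x) * (c / x\<^sup>2) * poly p (1 / x)"
      using 1 by (simp add: flat_def power2_eq_square field_simps)
    show ?thesis by (rule iffD2[OF DERIV_cong_ev[OF refl ev eq] d])
  next
    case 2
    have "eventually (\<lambda>y. flat p c y = 0) (nhds x)"
      using eventually_nhds_in_open[of "{..<0}" x] 2 by (auto simp: flat_def elim: eventually_mono)
    then have "(flat p c has_real_derivative 0) (at x)"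
      using DERIV_cong_ev[OF refl, of "flat p c" "\<lambda>_. 0" x 0 0] by simp
    then show ?thesis using 2 by (simp add: flat_def)
  next
    case 3
    \<comment> \<open>The difference quotient at 0 is z p(z) exp (- c z) with z = 1 / y tending to
      infinity; \<open>pCons 0 p\<close> is the polynomial z p(z).\<close>
    have "((\<lambda>y. poly (pCons 0 p) (inverse y) * exp (- c * inverse y)) \<longlongrightarrow> 0) (at_right 0)"
      by (rule filterlim_compose[OF tendsto_poly_times_exp[OF c] filterlim_inverse_at_top_right])
    moreover have "eventually (\<lambda>y. poly (pCons 0 p) (inverse y) * exp (- c * inverse y) = (flat p c y - flat p c 0) / (y - 0)) (at_right 0)"
      by (rule eventually_at_rightI[of 0 1]) (auto simp: flat_def divide_inverse)
    ultimately have R: "((\<lambda>y. (flat p c y - flat p c 0) / (y - 0)) \<longlongrightarrow> 0) (at_right 0)"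
      by (rule Lim_transform_eventually)
    have L: "((\<lambda>y. (flat p c y - flat p c 0) / (y - 0)) \<longlongrightarrow> 0) (at_left 0)"
      by (rule tendsto_eventually, rule eventually_at_leftI[of "-1"]) (auto simp: flat_def)
    have "((\<lambda>y. (flat p c y - flat p c 0) / (y - 0)) \<longlongrightarrow> 0) (at 0)"
      using L R by (simp add: filterlim_at_split)
    then show ?thesis using 3 by (simp add: has_field_derivative_iff flat_def)
  qed
qed

lemma Ck_flat: "0 < c \<Longrightarrow> Ck k (flat p c)"
proof (induction k arbitrary: p)
  case 0
  then show ?case using DERIV_continuous_on_UNIV[OF DERIV_flat] by simp
next
  case (Suc k)
  then show ?case using DERIV_flat[of c p] by auto
qed

text \<open>The parameter \<open>c\<close> is a steepness. As \<open>c\<close> tends to 0 the bumps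
  increase to the indicator of the open interval, which serves the time variable; c = 1 gives the
  fixed profile used in space.\<close>

definition bump :: "real \<Rightarrow> real \<Rightarrow> real \<Rightarrow> real \<Rightarrow> real" where
  "bump a b c x = flat 1 c (x - a) * flat 1 c (b - x)"

lemma Ck_bump: "0 < c \<Longrightarrow> Ck k (bump a b c)"
  using Ck_mult[OF Ck_affine[OF Ck_flat, of c k 1 1 "- a"] Ck_affine[OF Ck_flat, of c k 1 "-1" b]]
  by (simp add: bump_def [abs_def])

lemma bump_nonneg: "0 \<le> bump a b c x"
  unfolding bump_def flat_def by auto

lemma bump_le_1: "0 < c \<Longrightarrow> bump a b c x \<le> 1"
  unfolding bump_def flat_def by (auto intro!: mult_le_one)

lemma bump_pos: "a < x \<Longrightarrow> x < b \<Longrightarrow> 0 < bump a b c x"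
  unfolding bump_def flat_def by auto

lemma bump_eq_0: "x \<le> a \<or> b \<le> x \<Longrightarrow> bump a b c x = 0"
  unfolding bump_def flat_def by auto

lemma bump_translate: "bump (a + y) (b + y) c x = bump a b c (x - y)"
  unfolding bump_def by (simp add: algebra_simps)

lemma bump_tendsto_indicator:
  "(\<lambda>n. bump a b (1 / real (Suc n)) x) \<longlonglongrightarrow> indicator {a<..<b} x"
proof (cases "a < x \<and> x < b")
  case True
  have e: "(\<lambda>n. exp (- (1 / real (Suc n)) / y)) \<longlonglongrightarrow> 1" for y
  proof -
    have "(\<lambda>n. exp (- (1 / real (Suc n)) / y)) \<longlonglongrightarrow> exp (- 0 * inverse y)"
      unfolding divide_inverse[of _ y]
      using LIMSEQ_Suc[OF lim_const_over_n[of "1::real"]] by (intro tendsto_intros) simp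
    then show ?thesis by simp
  qed
  show ?thesis using tendsto_mult[OF e[of "x - a"] e[of "b - x"]] True
    by (simp add: bump_def flat_def)
next
  case False
  then have "bump a b c x = 0" for c by (intro bump_eq_0) auto
  then show ?thesis using False by (auto simp: indicator_def)
qed

definition supported_in :: "real \<Rightarrow> (real \<Rightarrow> real) \<Rightarrow> bool" where
  "supported_in R f \<longleftrightarrow> (\<forall>x. R \<le> \<bar>x\<bar> \<longrightarrow> f x = 0)"

lemma supported_in_mono: "supported_in R f \<Longrightarrow> R \<le> R' \<Longrightarrow> supported_in R' f"
  unfolding supported_in_def by auto

text \<open>Enlarging the radius by 1 places the point inside the open set where \<open>f\<close>
  vanishes, so that the derivative there is that of a constant.\<close>

lemma supported_in_deriv:
  assumes "supported_in R f" "\<And>x. (f has_real_derivative f' x) (at x)"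
  shows "supported_in (R + 1) f'"
  unfolding supported_in_def
proof safe
  fix x assume x: "R + 1 \<le> \<bar>x\<bar>"
  have "open {y::real. R < \<bar>y\<bar>}" by (intro open_Collect_less continuous_intros)
  then have "eventually (\<lambda>y. R < \<bar>y\<bar>) (nhds x)"
    using eventually_nhds_in_open[of "{y. R < \<bar>y\<bar>}" x] x by simp
  then have "eventually (\<lambda>y. f y = 0) (nhds x)"
    by (rule eventually_mono) (use assms(1) in \<open>auto simp: supported_in_def\<close>)
  then have "(f has_real_derivative 0) (at x)"
    using DERIV_cong_ev[OF refl, of f "\<lambda>_. 0" x 0 0] by simp
  then show "f' x = 0" using assms(2) DERIV_unique by blast
qed

lemma supported_in_bump:
  assumes "0 \<le> R" "- R \<le> a" "b \<le> R"
  shows "supported_in R (bump a b c)"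
  unfolding supported_in_def using assms by (auto intro!: bump_eq_0)

lemma continuous_supported:
  assumes f: "continuous_on UNIV f" "supported_in R f"
  shows "f \<in> borel_measurable borel" "\<exists>B. \<forall>x. \<bar>f x\<bar> \<le> B"
    "integrable lborel (\<lambda>x. complex_of_real (f x))" "square_integrable f"
proof -
  show [measurable]: "f \<in> borel_measurable borel"
    using f(1) by (rule borel_measurable_continuous_onI)
  have "compact (f ` {- R..R})"
    by (intro compact_continuous_image continuous_on_subset[OF f(1)]) auto
  then obtain B where B: "\<And>x. x \<in> {- R..R} \<Longrightarrow> \<bar>f x\<bar> \<le> B"
    using compact_imp_bounded bounded_iff by (metis imageI real_norm_def)
  have B': "\<bar>f x\<bar> \<le> \<bar>B\<bar>" for x
  proof (cases "R \<le> \<bar>x\<bar>")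
    case False
    then have "x \<in> {- R..R}" by auto
    from B[OF this] show ?thesis by linarith
  qed (use f(2) in \<open>auto simp: supported_in_def\<close>)
  then show "\<exists>B. \<forall>x. \<bar>f x\<bar> \<le> B" by blast
  have bd: "\<bar>f x\<bar> \<le> \<bar>B\<bar> * indicator {- R..R} x" for x
    using B'[of x] f(2) by (auto simp: supported_in_def split: split_indicator)
  show "integrable lborel (\<lambda>x. complex_of_real (f x))"
  proof (rule Bochner_Integration.integrable_bound)
    have "integrable lborel (indicator {- R..R} :: real \<Rightarrow> real)"
      by (rule integrable_real_indicator) (auto simp: emeasure_lborel_Icc_eq)
    then show "integrable lborel (\<lambda>x. \<bar>B\<bar> * indicator {- R..R} x :: real)" by simp
  qed (use bd in auto)
  have "cmod (complex_of_real (f x)) \<le> \<bar>B\<bar> * cmod (indicator {- R..R} x)" for x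
  proof -
    have "cmod (indicator {- R..R} x) = indicator {- R..R} x" by (simp split: split_indicator)
    then show ?thesis using bd[of x] by simp
  qed
  then have "square_integrable (\<lambda>x. complex_of_real (f x))"
    by (rule square_integrable_bound[OF square_integrable_indicator_interval, rotated]) measurable
  then show "square_integrable f" by simp
qed

text \<open>The time factor has to vanish only for late times. It may be nonzero at t = 0, which is
  what lets the identity see the initial datum.\<close>

lemma test_function_product:
  assumes "\<And>k. Ck k \<theta>" "\<And>k. Ck k \<psi>" "\<And>t. T \<le> t \<Longrightarrow> \<theta> t = 0" "supported_in R \<psi>"
  shows "test_function (\<lambda>t x. \<theta> t * \<psi> x)"
proof -
  have "Ck_halfplane k (\<lambda>t x. f t * g x)" if "Ck k f" "Ck k g" for k f g
    using that
  proof (induction k arbitrary: f g)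
    case 0
    then have fg: "continuous_on UNIV f" "continuous_on UNIV g" by auto
    have "continuous_on ({0..} \<times> UNIV) (\<lambda>z. f (fst z) * g (snd z))"
      by (rule continuous_on_mult[OF continuous_on_compose2[OF fg(1) continuous_on_fst[OF continuous_on_id]]
            continuous_on_compose2[OF fg(2) continuous_on_snd[OF continuous_on_id]]]) auto
    then show ?case by (simp add: case_prod_beta')
  next
    case (Suc k)
    then obtain f' g' where *: "\<And>x. (f has_real_derivative f' x) (at x)" "Ck k f'"
      "\<And>x. (g has_real_derivative g' x) (at x)" "Ck k g'" by auto
    have 1: "((\<lambda>s. f s * g x) has_vector_derivative f' t * g x) (at t within {0..})" for t x
      using DERIV_subset[OF DERIV_cmult_right[OF *(1)]]
      by (auto simp flip: has_real_derivative_iff_has_vector_derivative)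
    have 2: "((\<lambda>y. f t * g y) has_vector_derivative f t * g' x) (at x)" for t x
      using DERIV_cmult[OF *(3)] by (auto simp flip: has_real_derivative_iff_has_vector_derivative)
    have 3: "Ck_halfplane k (\<lambda>t x. f' t * g x)" "Ck_halfplane k (\<lambda>t x. f t * g' x)"
      using Suc.IH[OF *(2) Suc.prems(2)[THEN Ck_Suc_D]] Suc.IH[OF Suc.prems(1)[THEN Ck_Suc_D] *(4)] by auto
    show ?case
      unfolding Ck_halfplane.simps
      by (rule exI[of _ "\<lambda>t x. f' t * g x"], rule exI[of _ "\<lambda>t x. f t * g' x"]) (use 1 2 3 in auto)
  qed
  moreover have "bounded {(t, x). t \<ge> 0 \<and> \<theta> t * \<psi> x \<noteq> 0}"
  proof (rule bounded_subset)
    show "bounded ({0..T} \<times> {- R..R})" by (intro bounded_Times) auto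
    show "{(t, x). t \<ge> 0 \<and> \<theta> t * \<psi> x \<noteq> 0} \<subseteq> {0..T} \<times> {- R..R}"
      using assms(3,4) by (auto simp: supported_in_def abs_le_iff not_le le_less; (meson linear less_le_not_le)?; smt (verit))
  qed
  ultimately show ?thesis
    unfolding test_function_def compact_closure using assms by auto
qed

text \<open>The time profiles fed into the weak formulation. The derivative is minus a bump, so it
  tests averages over (a, b); the profile vanishes after \<open>b\<close>, and its value at 0
  multiplies the initial datum.\<close>

lemma bump_primitive:
  fixes a b c t :: real
  assumes c: "0 < c"
  defines "\<theta> \<equiv> \<lambda>t. LINT s|lborel. indicator {t..} s * bump a b c s"
  shows "(\<theta> has_real_derivative - bump a b c t) (at t)" "Ck k \<theta>" "b \<le> t \<Longrightarrow> \<theta> t = 0"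
proof -
  let ?\<beta> = "bump a b c"
  have cont: "continuous_on A ?\<beta>" for A
    using Ck_continuous[OF Ck_bump[OF c, of 0]] continuous_on_subset by blast
  define B where "B u = (LBINT y=ereal 0..ereal u. ?\<beta> y)" for u
  have B: "(B has_real_derivative ?\<beta> x) (at x)" for x
  proof -
    have "(B has_vector_derivative ?\<beta> x) (at x within {min x 0 - 1..max x 0 + 1})"
      unfolding B_def by (rule interval_integral_FTC2) (auto intro: cont)
    then show ?thesis
      by (simp add: at_within_Icc_at has_real_derivative_iff_has_vector_derivative)
  qed
  have \<theta>: "\<theta> s = B M - B s" if "s \<le> M" "b \<le> M" for s M
  proof -
    have "\<theta> s = (LINT x|lborel. indicator {s..M} x *\<^sub>R ?\<beta> x)"
      unfolding \<theta>_def using that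
      by (intro Bochner_Integration.integral_cong refl) (auto split: split_indicator intro: bump_eq_0)
    also have "\<dots> = B M - B s"
      by (rule integral_FTC_Icc)
         (use that B cont in \<open>auto intro: DERIV_subset simp flip: has_real_derivative_iff_has_vector_derivative\<close>)
    finally show ?thesis .
  qed
  show D: "(\<theta> has_real_derivative - ?\<beta> t) (at t)" for t
  proof -
    have ev: "eventually (\<lambda>s. \<theta> s = B (max (t + 1) b) - B s) (nhds t)"
    proof (rule eventually_mono)
      show "eventually (\<lambda>s. s \<in> {..<t + 1}) (nhds t)" by (rule eventually_nhds_in_open) auto
    qed (auto intro!: \<theta>)
    have "((\<lambda>s. B (max (t + 1) b) - B s) has_real_derivative 0 - ?\<beta> t) (at t)"
      by (intro DERIV_diff DERIV_const B)
    then show ?thesis using DERIV_cong_ev[OF refl ev refl] by simp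
  qed
  show "Ck k \<theta>"
  proof -
    have "Ck k (\<lambda>x. - 1 * ?\<beta> x)" by (intro Ck_mult Ck_const Ck_bump c)
    then have "Ck (Suc k) \<theta>"
      unfolding Ck.simps using D by (intro exI[of _ "\<lambda>x. - 1 * ?\<beta> x"]) simp
    then show ?thesis by (rule Ck_Suc_D)
  qed
  show "\<theta> t = 0" if "b \<le> t" using \<theta>[of t t] that by simp
qed

section \<open>Decay and non-vanishing of transforms of test functions\<close>

lemma fourier_integral_deriv:
  assumes \<psi>: "\<And>x. (\<psi> has_real_derivative \<psi>' x) (at x)" "continuous_on UNIV \<psi>'" "supported_in R \<psi>"
  shows "fourier_integral (\<lambda>x. complex_of_real (\<psi>' x)) \<xi> = \<i> * \<xi> * fourier_integral (\<lambda>x. complex_of_real (\<psi> x)) \<xi>"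
proof -
  define M where "M = max (R + 1) 0"
  have s: "supported_in M \<psi>" "supported_in M \<psi>'" and M: "0 \<le> M"
    using supported_in_deriv[OF \<psi>(3,1)] \<psi>(3) unfolding M_def by (auto elim!: supported_in_mono)
  have c\<psi>: "continuous_on UNIV \<psi>" using \<psi>(1) by (rule DERIV_continuous_on_UNIV)
  let ?f = "\<lambda>x. complex_of_real (\<psi> x) * cis (- (x * \<xi>))"
  let ?f' = "\<lambda>x. complex_of_real (\<psi>' x) * cis (- (x * \<xi>)) - \<i> * \<xi> * (complex_of_real (\<psi> x) * cis (- (x * \<xi>)))"
  have "(LINT x|lborel. indicator {- M..M} x *\<^sub>R ?f' x) = ?f M - ?f (- M)"
  proof (rule integral_FTC_Icc)
    show "(?f has_vector_derivative ?f' x) (at x within {- M..M})" for x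
    proof -
      have "((\<lambda>x. exp (\<i> * complex_of_real (- (x * \<xi>)))) has_vector_derivative
          - \<i> * \<xi> * exp (\<i> * complex_of_real (- (x * \<xi>)))) (at x)"
        by (auto intro!: derivative_eq_intros has_vector_derivative_real_field)
      then have e: "((\<lambda>x. cis (- (x * \<xi>))) has_vector_derivative - \<i> * \<xi> * cis (- (x * \<xi>))) (at x)"
        by (simp add: cis_conv_exp)
      have p: "((\<lambda>x. complex_of_real (\<psi> x)) has_vector_derivative complex_of_real (\<psi>' x)) (at x)"
        using \<psi>(1)[of x] by (intro has_vector_derivative_of_real)
          (simp add: has_real_derivative_iff_has_vector_derivative)
      from has_vector_derivative_mult[OF p e]
      have "(?f has_vector_derivative ?f' x) (at x)" by (simp add: algebra_simps)
      then show ?thesis by (rule has_vector_derivative_at_within)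
    qed
    show "continuous_on {- M..M} ?f'"
      by (intro continuous_intros continuous_on_subset[OF \<psi>(2)] continuous_on_subset[OF c\<psi>]) auto
  qed (use M in auto)
  also have "\<dots> = 0" using s M by (simp add: supported_in_def)
  also have "(LINT x|lborel. indicator {- M..M} x *\<^sub>R ?f' x) = (LINT x|lborel. ?f' x)"
    by (intro Bochner_Integration.integral_cong refl)
       (use s in \<open>auto simp: supported_in_def abs_le_iff split: split_indicator; smt (verit)\<close>)
  also have "\<dots> = fourier_integral (\<lambda>x. complex_of_real (\<psi>' x)) \<xi> - \<i> * \<xi> * fourier_integral (\<lambda>x. complex_of_real (\<psi> x)) \<xi>"
    unfolding fourier_integral_def
    using continuous_supported(3)[OF c\<psi> s(1)] continuous_supported(3)[OF \<psi>(2) s(2)]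
    by (subst Bochner_Integration.integral_diff) (auto intro!: integrable_mult_cis)
  finally show ?thesis by simp
qed

lemma fourier_integral_decay:
  "Ck k \<psi> \<Longrightarrow> supported_in R \<psi> \<Longrightarrow>
    \<exists>C. \<forall>\<xi>. \<bar>\<xi>\<bar> ^ k * cmod (fourier_integral (\<lambda>x. complex_of_real (\<psi> x)) \<xi>) \<le> C"
proof (induction k arbitrary: \<psi> R)
  case 0
  then show ?case using norm_fourier_integral_le[of "\<lambda>x. complex_of_real (\<psi> x)"] by auto
next
  case (Suc k)
  then obtain \<psi>' where \<psi>': "\<And>x. (\<psi> has_real_derivative \<psi>' x) (at x)" "Ck k \<psi>'" by auto
  from Suc.IH[OF \<psi>'(2) supported_in_deriv[OF Suc.prems(2) \<psi>'(1)]]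
  obtain C where "\<And>\<xi>. \<bar>\<xi>\<bar> ^ k * cmod (fourier_integral (\<lambda>x. complex_of_real (\<psi>' x)) \<xi>) \<le> C" by auto
  then show ?case
    unfolding fourier_integral_deriv[OF \<psi>'(1) Ck_continuous[OF \<psi>'(2)] Suc.prems(2)]
    by (intro exI[of _ C]) (simp add: norm_mult mult_ac)
qed

text \<open>Fourth order is enough for every later use: two powers offset the quadratic bound on the
  symbol, and the other two secure integrability. The constant 16 is 2^4, from weight \<le> 2 max(1,
  |\<xi>|).\<close>

lemma fourier_integral_weight_decay:
  assumes "\<And>k. Ck k \<psi>" "supported_in R \<psi>"
  shows "\<exists>C. \<forall>\<xi>. weight \<xi> ^ 4 * cmod (fourier_integral (\<lambda>x. complex_of_real (\<psi> x)) \<xi>) \<le> C"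
proof -
  obtain C0 C4 where C: "\<And>\<xi>. cmod (fourier_integral (\<lambda>x. complex_of_real (\<psi> x)) \<xi>) \<le> C0"
     "\<And>\<xi>. \<bar>\<xi>\<bar> ^ 4 * cmod (fourier_integral (\<lambda>x. complex_of_real (\<psi> x)) \<xi>) \<le> C4"
    using fourier_integral_decay[OF assms, of 0] fourier_integral_decay[OF assms, of 4] by auto
  have "weight \<xi> ^ 4 * z \<le> 16 * z + 16 * (\<bar>\<xi>\<bar> ^ 4 * z)" if "0 \<le> z" for \<xi> z
  proof -
    have "weight \<xi> ^ 4 \<le> 16 + 16 * \<bar>\<xi>\<bar> ^ 4"
    proof (cases "\<bar>\<xi>\<bar> \<le> 1")
      case True
      then have "weight \<xi> ^ 4 \<le> 2 ^ 4" unfolding weight_def by (intro power_mono) auto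
      also have "2 ^ 4 \<le> 16 + 16 * \<bar>\<xi>\<bar> ^ 4" by simp
      finally show ?thesis .
    next
      case False
      then have "weight \<xi> ^ 4 \<le> (2 * \<bar>\<xi>\<bar>) ^ 4" unfolding weight_def by (intro power_mono) auto
      then show ?thesis by (simp add: power_mult_distrib)
    qed
    from mult_right_mono[OF this that] show ?thesis by (simp add: algebra_simps)
  qed
  from this[OF norm_ge_zero] have "weight \<xi> ^ 4 * cmod (fourier_integral (\<lambda>x. complex_of_real (\<psi> x)) \<xi>) \<le> 16 * C0 + 16 * C4" for \<xi>
    using C by (smt (verit, best))
  then show ?thesis by blast
qed

text \<open>On the support |x \<xi>| < 1, which is below pi / 2, so the cosine is positive there and
  the real part of the transform is the integral of a nonnegative function that is positive on (-h,
  h).\<close>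

lemma fourier_integral_bump_nonzero:
  assumes h: "0 < h" and \<xi>: "\<bar>\<xi>\<bar> * h < 1" and c: "0 < c"
  shows "fourier_integral (\<lambda>x. complex_of_real (bump (- h) h c x)) \<xi> \<noteq> 0"
proof -
  let ?\<beta> = "bump (- h) h c"
  have i: "integrable lborel (\<lambda>x. complex_of_real (?\<beta> x))"
    by (rule continuous_supported[OF Ck_continuous[OF Ck_bump[OF c, of 0]] supported_in_bump[of h]]) (use h in auto)
  have [measurable]: "?\<beta> \<in> borel_measurable borel"
    by (rule continuous_supported[OF Ck_continuous[OF Ck_bump[OF c, of 0]] supported_in_bump[of h]]) (use h in auto)
  have ic: "integrable lborel (\<lambda>x. complex_of_real (?\<beta> x) * cis (- (x * \<xi>)))"
    by (rule integrable_mult_cis[OF i]) measurable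
  have "Re (fourier_integral (\<lambda>x. complex_of_real (?\<beta> x)) \<xi>) = (LINT x|lborel. ?\<beta> x * cos (x * \<xi>))"
    unfolding fourier_integral_def using integral_Re[OF ic] by simp
  moreover have "integrable lborel (\<lambda>x. ?\<beta> x * cos (x * \<xi>))"
    using integrable_Re[OF ic] by simp
  moreover have pos: "0 \<le> ?\<beta> x * cos (x * \<xi>) \<and> (\<bar>x\<bar> < h \<longrightarrow> 0 < ?\<beta> x * cos (x * \<xi>))" for x
  proof (cases "\<bar>x\<bar> < h")
    case True
    have "\<bar>x * \<xi>\<bar> \<le> h * \<bar>\<xi>\<bar>" using True by (simp add: abs_mult mult_right_mono)
    then have "\<bar>x * \<xi>\<bar> < 1" using \<xi> by (simp add: mult.commute)
    then have "0 < cos (x * \<xi>)" using pi_gt3 by (intro cos_gt_zero_pi) auto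
    moreover have "0 < ?\<beta> x" using True by (intro bump_pos) auto
    ultimately show ?thesis by simp
  next
    case False
    then have "?\<beta> x = 0" by (intro bump_eq_0) auto
    then show ?thesis using False by simp
  qed
  moreover have "(LINT x|lborel. ?\<beta> x * cos (x * \<xi>)) \<noteq> 0"
  proof
    assume "(LINT x|lborel. ?\<beta> x * cos (x * \<xi>)) = 0"
    then have "AE x in lborel. ?\<beta> x * cos (x * \<xi>) = 0"
      using integral_nonneg_eq_0_iff_AE[of lborel "\<lambda>x. ?\<beta> x * cos (x * \<xi>)"] pos \<open>integrable lborel (\<lambda>x. ?\<beta> x * cos (x * \<xi>))\<close> by auto
    then have "AE x in lborel. x \<notin> {- h<..<h}"
      by eventually_elim (use pos in \<open>fastforce simp: abs_less_iff\<close>)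
    then have "emeasure lborel {- h<..<h} = 0"
      by (subst (asm) AE_iff_null) (auto simp: null_sets_def greaterThanLessThan_def lessThan_def greaterThan_def Int_def)
    then show False using h by simp
  qed
  ultimately show ?thesis by (metis zero_complex.sel(1))
qed

subsection \<open>Duhamel's inequality at a fixed frequency\<close>

lemma integrable_bounded_Icc:
  fixes k :: "real \<Rightarrow> complex"
  assumes [measurable]: "k \<in> borel_measurable borel" and k: "\<And>s. a \<le> s \<Longrightarrow> s \<le> b \<Longrightarrow> cmod (k s) \<le> B"
  shows "integrable lborel (\<lambda>s. indicator {a..b} s * k s)"
proof (rule Bochner_Integration.integrable_bound)
  have "integrable lborel (indicator {a..b} :: real \<Rightarrow> real)"
    by (rule integrable_real_indicator) (auto simp: emeasure_lborel_Icc_eq)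
  then show "integrable lborel (\<lambda>x. B * indicator {a..b} x :: real)" by simp
  show "AE x in lborel. norm (indicator {a..b} x * k x) \<le> norm (B * indicator {a..b} x)"
    using k by (intro AE_I2) (force split: split_indicator)
qed measurable

text \<open>Fubini on the triangle 0 < r \<le> s \<le> T. It replaces integration by parts for a
  primitive of the merely integrable function \<open>h\<close>.\<close>

lemma triangle_Fubini:
  fixes h k :: "real \<Rightarrow> complex"
  assumes [measurable]: "h \<in> borel_measurable borel" "k \<in> borel_measurable borel"
    and h: "integrable lborel (\<lambda>r. indicator {0<..T} r * h r)"
    and k: "\<And>s. 0 < s \<Longrightarrow> s \<le> T \<Longrightarrow> cmod (k s) \<le> B"
  shows "(LINT s|lborel. indicator {0<..T} s * k s * (LINT r|lborel. indicator {0<..s} r * h r)) =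
    (LINT r|lborel. indicator {0<..T} r * h r * (LINT s|lborel. indicator {r..T} s * k s))"
proof -
  let ?\<Phi> = "\<lambda>r s. indicator {0<..T} r * h r * (indicator {r..T} s * k s)"
  have ki: "integrable lborel (\<lambda>s. indicator {r..T} s * k s)" if "0 < r" for r
    by (rule integrable_bounded_Icc[where B=B]) (use that k in auto)
  have meas: "case_prod ?\<Phi> \<in> borel_measurable (lborel \<Otimes>\<^sub>M lborel)"
  proof -
    \<comment> \<open>The interval from \<open>r\<close> to \<open>T\<close> has a moving endpoint;
      its indicator is rewritten as a conditional so that joint measurability can be
      derived.\<close>
    have "(\<lambda>z. indicator {0<..T} (fst z) * h (fst z) * ((if fst z \<le> snd z \<and> snd z \<le> T then 1 else 0) * k (snd z)))
      \<in> borel_measurable (lborel \<Otimes>\<^sub>M lborel)" by measurable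
    then show ?thesis by (simp add: case_prod_beta' indicator_def of_bool_def)
  qed
  have int: "integrable (lborel \<Otimes>\<^sub>M lborel) (case_prod ?\<Phi>)"
  proof (rule lborel_pair.Fubini_integrable[OF meas])
    have [measurable]: "(\<lambda>r. LINT s|lborel. cmod (case (r, s) of (r, s) \<Rightarrow> ?\<Phi> r s)) \<in> borel_measurable lborel"
      by (rule lborel.borel_measurable_lebesgue_integral) (use measurable_compose[OF meas borel_measurable_norm] in \<open>simp add: case_prod_beta'\<close>)
    show "integrable lborel (\<lambda>r. LINT s|lborel. cmod (case (r, s) of (r, s) \<Rightarrow> ?\<Phi> r s))"
    proof (rule Bochner_Integration.integrable_bound)
      show "integrable lborel (\<lambda>r. complex_of_real (B * T) * (indicator {0<..T} r * h r))" using h by simp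
      show "AE r in lborel. norm (LINT s|lborel. cmod (case (r, s) of (r, s) \<Rightarrow> ?\<Phi> r s)) \<le>
          norm (complex_of_real (B * T) * (indicator {0<..T} r * h r))"
      proof (rule AE_I2)
        fix r
        show "norm (LINT s|lborel. cmod (case (r, s) of (r, s) \<Rightarrow> ?\<Phi> r s)) \<le>
          norm (complex_of_real (B * T) * (indicator {0<..T} r * h r))"
        proof (cases "0 < r \<and> r \<le> T")
          case True
          have B0: "0 \<le> B" using k[of r] True norm_ge_zero[of "k r"] by linarith
          have "(LINT s|lborel. cmod (indicator {r..T} s * k s)) \<le> (LINT s|lborel. B * indicator {r..T} s)"
          proof (rule integral_mono)
            show "integrable lborel (\<lambda>s. cmod (indicator {r..T} s * k s))" using ki True by simp
            have "integrable lborel (indicator {r..T} :: real \<Rightarrow> real)"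
              by (rule integrable_real_indicator) (auto simp: emeasure_lborel_Icc_eq)
            then show "integrable lborel (\<lambda>s. B * indicator {r..T} s :: real)" by simp
            show "cmod (indicator {r..T} s * k s) \<le> B * indicator {r..T} s" for s
              using k[of s] True by (auto split: split_indicator)
          qed
          also have "\<dots> = B * (T - r)" using True by simp
          also have "\<dots> \<le> B * T" using B0 True by (intro mult_left_mono) auto
          finally have "cmod (h r) * (LINT s|lborel. cmod (indicator {r..T} s * k s)) \<le> cmod (h r) * (B * T)"
            by (intro mult_left_mono) auto
          moreover have "(LINT s|lborel. cmod (?\<Phi> r s)) = cmod (h r) * (LINT s|lborel. cmod (indicator {r..T} s * k s))"
            using True by (simp add: norm_mult)
          moreover have "0 \<le> (LINT s|lborel. cmod (indicator {r..T} s * k s))" by simp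
          ultimately show ?thesis using True B0 by (simp add: norm_mult mult.commute abs_mult)
        qed auto
      qed
    qed measurable
    show "AE r in lborel. integrable lborel (\<lambda>s. case (r, s) of (r, s) \<Rightarrow> ?\<Phi> r s)"
    proof (rule AE_I2)
      fix r
      show "integrable lborel (\<lambda>s. case (r, s) of (r, s) \<Rightarrow> ?\<Phi> r s)"
        using ki[of r] by (cases "0 < r") simp_all
    qed
  qed
  have "(LINT s|lborel. indicator {0<..T} s * k s * (LINT r|lborel. indicator {0<..s} r * h r)) =
      (LINT s|lborel. LINT r|lborel. ?\<Phi> r s)"
  proof (intro Bochner_Integration.integral_cong refl)
    fix s
    have "indicator {0<..T} s * k s * (LINT r|lborel. indicator {0<..s} r * h r) =
        (LINT r|lborel. indicator {0<..T} s * k s * (indicator {0<..s} r * h r))"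
      by (rule integral_mult_right_zero[symmetric])
    also have "\<dots> = (LINT r|lborel. ?\<Phi> r s)"
      by (intro Bochner_Integration.integral_cong refl) (auto split: split_indicator)
    finally show "indicator {0<..T} s * k s * (LINT r|lborel. indicator {0<..s} r * h r) = (LINT r|lborel. ?\<Phi> r s)" .
  qed
  also have "\<dots> = (LINT r|lborel. LINT s|lborel. ?\<Phi> r s)"
    by (rule lborel_pair.Fubini_integral[OF int])
  also have "\<dots> = (LINT r|lborel. indicator {0<..T} r * h r * (LINT s|lborel. indicator {r..T} s * k s))"
    by (intro Bochner_Integration.integral_cong refl integral_mult_right_zero)
  finally show ?thesis .
qed

text \<open>Dominated convergence as the bumps steepen. Their limit is the open interval, and the
  two endpoints are null.\<close>

lemma interval_integral_zero_if_bump_integrals_zero: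
  fixes f :: "real \<Rightarrow> complex"
  assumes [measurable]: "f \<in> borel_measurable borel"
    and fi: "integrable lborel (\<lambda>t. indicator {a..b} t * f t)"
    and z: "\<And>n. (LINT t|lborel. complex_of_real (bump a b (1 / real (Suc n)) t) * f t) = 0"
  shows "(LINT t|lborel. indicator {a..b} t * f t) = 0"
proof -
  have "(\<lambda>n. LINT t|lborel. complex_of_real (bump a b (1 / real (Suc n)) t) * f t) \<longlonglongrightarrow>
      (LINT t|lborel. complex_of_real (indicator {a<..<b} t) * f t)"
  proof (rule Bochner_Integration.integral_dominated_convergence[where w="\<lambda>t. cmod (indicator {a..b} t * f t)"])
    show "integrable lborel (\<lambda>t. cmod (indicator {a..b} t * f t))" using fi by simp
    show "AE t in lborel. (\<lambda>n. complex_of_real (bump a b (1 / real (Suc n)) t) * f t) \<longlonglongrightarrow> complex_of_real (indicator {a<..<b} t) * f t"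
      by (intro AE_I2 tendsto_intros bump_tendsto_indicator)
    show "AE t in lborel. norm (complex_of_real (bump a b (1 / real (Suc n)) t) * f t) \<le> cmod (indicator {a..b} t * f t)" for n
    proof (rule AE_I2)
      fix t
      show "norm (complex_of_real (bump a b (1 / real (Suc n)) t) * f t) \<le> cmod (indicator {a..b} t * f t)"
      proof (cases "a \<le> t \<and> t \<le> b")
        case True
        then show ?thesis
          using mult_right_mono[OF bump_le_1[of "1 / real (Suc n)" a b t], of "cmod (f t)"] bump_nonneg[of a b "1 / real (Suc n)" t]
          by (simp add: norm_mult)
      next
        case False
        then have "bump a b (1 / real (Suc n)) t = 0" by (intro bump_eq_0) auto
        then show ?thesis by simp
      qed
    qed
    show "(\<lambda>t. complex_of_real (bump a b (1 / real (Suc n)) t) * f t) \<in> borel_measurable lborel" for n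
    proof -
      have "bump a b (1 / real (Suc n)) \<in> borel_measurable borel"
        by (rule borel_measurable_continuous_onI[OF Ck_continuous[OF Ck_bump[of _ 0]]]) simp
      then show ?thesis by measurable
    qed
  qed measurable
  then have "(LINT t|lborel. complex_of_real (indicator {a<..<b} t) * f t) = 0"
    unfolding z by (simp add: LIMSEQ_const_iff)
  moreover have "(LINT t|lborel. indicator {a..b} t * f t) = (LINT t|lborel. complex_of_real (indicator {a<..<b} t) * f t)"
  proof (rule integral_cong_AE)
    show "AE t in lborel. indicator {a..b} t * f t = complex_of_real (indicator {a<..<b} t) * f t"
      using AE_lborel_singleton[of a] AE_lborel_singleton[of b]
      by eventually_elim (auto split: split_indicator)
  qed measurable
  ultimately show ?thesis by simp
qed

text \<open>\<open>G\<close> is merely integrable, so Plancherel does not apply to it. A smooth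
  bump, however, is the transform of an integrable function by inversion; the multiplication formula
  moves that transform onto \<open>G\<close>, and all bump integrals of \<open>G\<close>
  vanish.\<close>

lemma AE_zero_if_fourier_integral_zero_L1:
  assumes G: "integrable lborel G" and z: "\<And>x. fourier_integral G x = 0"
  shows "AE \<xi> in lborel. G \<xi> = 0"
proof (rule AE_zero_if_interval_integrals_zero)
  show Gm[measurable]: "G \<in> borel_measurable borel" using G by simp
  have ind: "integrable lborel (\<lambda>x. indicator A x * G x)" if "A \<in> sets borel" for A
  proof -
    have "integrable lborel (\<lambda>x. indicator A x *\<^sub>R G x)"
      using that by (intro integrable_mult_indicator G) simp
    then show ?thesis
      by (rule Bochner_Integration.integrable_cong[THEN iffD1, rotated 2]) (auto split: split_indicator)
  qed
  show "integrable lborel (cutoff n G)" for n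
    unfolding cutoff_def [abs_def] by (rule ind) simp
  fix a b :: real assume "a < b"
  show "(LINT x|lborel. indicator {a..b} x * G x) = 0"
  proof (rule interval_integral_zero_if_bump_integrals_zero[OF Gm ind])
    fix n
    define \<beta> where "\<beta> x = complex_of_real (bump a b (1 / real (Suc n)) x)" for x
    define B where "B = fourier_integral \<beta>"
    have Ck: "Ck k (bump a b (1 / real (Suc n)))" for k by (rule Ck_bump) simp
    have sup: "supported_in (max \<bar>a\<bar> \<bar>b\<bar>) (bump a b (1 / real (Suc n)))"
      by (rule supported_in_bump) auto
    note cs = continuous_supported[OF Ck_continuous[OF Ck[of 0]] sup]
    have \<beta>: "integrable lborel \<beta>" "square_integrable \<beta>"
      using cs(3,4) unfolding \<beta>_def [abs_def] by simp_all
    note \<beta>m[measurable] = square_integrable_measurable[OF \<beta>(2)]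
    have Bsq: "square_integrable B" unfolding B_def by (rule fourier_integral_bessel[OF \<beta>])
    note [measurable] = square_integrable_measurable[OF Bsq]
    obtain C where C: "\<And>\<xi>. weight \<xi> ^ 4 * cmod (B \<xi>) \<le> C"
      using fourier_integral_weight_decay[OF Ck sup] unfolding B_def \<beta>_def [abs_def] by blast
    have Bi: "integrable lborel B"
    proof (rule integrableI_bounded)
      have "(\<integral>\<^sup>+\<xi>. ennreal (cmod (B \<xi>)) \<partial>lborel) \<le> (\<integral>\<^sup>+\<xi>. ennreal C * ennreal (weight \<xi> powr - 4) \<partial>lborel)"
      proof (intro nn_integral_mono)
        fix \<xi>
        have "cmod (B \<xi>) \<le> C / weight \<xi> ^ 4"
          using C[of \<xi>] by (subst pos_le_divide_eq[OF zero_less_power[OF weight_pos]]) (simp add: mult.commute)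
        also have "\<dots> = C * weight \<xi> powr - 4"
          by (simp add: powr_minus powr_numeral divide_inverse)
        finally have "cmod (B \<xi>) \<le> C * weight \<xi> powr - 4" .
        then show "ennreal (cmod (B \<xi>)) \<le> ennreal C * ennreal (weight \<xi> powr - 4)"
          by (subst ennreal_mult''[symmetric]) (auto intro: ennreal_leI)
      qed
      also have "\<dots> = ennreal C * (\<integral>\<^sup>+\<xi>. ennreal (weight \<xi> powr - 4) \<partial>lborel)"
        by (rule nn_integral_cmult) measurable
      also have "\<dots> < \<infinity>" using nn_integral_weight_powr[of 4] by (simp add: ennreal_mult_less_top)
      finally show "(\<integral>\<^sup>+\<xi>. ennreal (cmod (B \<xi>)) \<partial>lborel) < \<infinity>" .
    qed simp
    have cB: "integrable lborel (\<lambda>\<xi>. cnj (B \<xi>))" "square_integrable (\<lambda>\<xi>. cnj (B \<xi>))"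
      using Bi square_integrable_cnj[OF Bsq] by simp_all
    have feq: "fourier (\<lambda>\<xi>. cnj (fourier \<beta> \<xi>)) = fourier (\<lambda>\<xi>. cnj (B \<xi>))"
      by (intro fourier_cong_AE square_integrable_cnj square_integrable_fourier \<beta> Bsq)
         (use fourier_eq_fourier_integral[OF \<beta>(2,1)] in eventually_elim, simp add: B_def)
    from fourier_inversion[OF \<beta>(2)] fourier_eq_fourier_integral[OF cB(2,1)]
    \<comment> \<open>The integrals in this identity are ordinary ones, since the fourth-order decay
      makes \<open>B\<close> integrable. This is why smooth bumps are used in place of
      indicators.\<close>
    have inv: "AE x in lborel. fourier_integral (\<lambda>\<xi>. cnj (B \<xi>)) x = 2 * pi * \<beta> x"
    proof eventually_elim
      case (elim x)
      then have "cnj (fourier_integral (\<lambda>\<xi>. cnj (B \<xi>)) x) = 2 * pi * \<beta> x" by (simp add: feq)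
      then have "fourier_integral (\<lambda>\<xi>. cnj (B \<xi>)) x = cnj (2 * pi * \<beta> x)" by (metis complex_cnj_cnj)
      then show ?case by (simp add: \<beta>_def)
    qed
    have "0 = (LINT x|lborel. cnj (B x) * fourier_integral G x)" by (simp add: z)
    also have "\<dots> = (LINT x|lborel. G x * fourier_integral (\<lambda>\<xi>. cnj (B \<xi>)) x)"
      by (rule fourier_integral_multiplication_formula[OF G cB(1)])
    also have "\<dots> = (LINT x|lborel. 2 * pi * (\<beta> x * G x))"
      by (rule integral_cong_AE)
         (use inv measurable_fourier_integral[of "\<lambda>\<xi>. cnj (B \<xi>)"] in \<open>auto elim: eventually_mono\<close>)
    finally show "(LINT t|lborel. complex_of_real (bump a b (1 / real (Suc n)) t) * G t) = 0"
      unfolding \<beta>_def by (simp del: of_nat_Suc)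
  qed simp
qed

text \<open>The fundamental theorem for y' = h, y(0) = y0 in the distributional sense. Fubini
  converts the pairing of \<open>h\<close> with the profile into one of its primitive with the bump,
  so y - y0 minus that primitive is orthogonal to all bumps on positive times.\<close>

lemma weak_ode_integrated:
  fixes y h :: "real \<Rightarrow> complex"
  assumes ym[measurable]: "y \<in> borel_measurable borel" and hm[measurable]: "h \<in> borel_measurable borel"
    and yi: "\<And>n::nat. integrable lborel (\<lambda>t. indicator {0<..real n} t * y t)"
    and hi: "\<And>n::nat. integrable lborel (\<lambda>t. indicator {0<..real n} t * h t)"
    and weak: "\<And>a b n. a \<in> \<rat> \<Longrightarrow> b \<in> \<rat> \<Longrightarrow> 0 \<le> a \<Longrightarrow> a < b \<Longrightarrow>
      (LINT t|lborel. indicator {0<..} t * (- complex_of_real (bump a b (1 / real (Suc n)) t) * y t +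
        complex_of_real (LINT s|lborel. indicator {t..} s * bump a b (1 / real (Suc n)) s) * h t)) +
      complex_of_real (LINT s|lborel. indicator {0..} s * bump a b (1 / real (Suc n)) s) * y0 = 0"
  shows "AE t in lborel. 0 < t \<longrightarrow> y t = y0 + (LINT s|lborel. indicator {0<..t} s * h s)"
proof -
  have hT: "integrable lborel (\<lambda>t. indicator {0<..T} t * h t)" and yT: "integrable lborel (\<lambda>t. indicator {0<..T} t * y t)" for T
  proof -
    obtain n :: nat where n: "T \<le> real n" using real_arch_simple by blast
    have eq: "(\<lambda>t. indicator {0<..T} t * f t) = (\<lambda>t. indicator {0<..T} t *\<^sub>R (indicator {0<..real n} t * f t))" for f :: "real \<Rightarrow> complex"
      using n by (auto simp: fun_eq_iff split: split_indicator)
    show "integrable lborel (\<lambda>t. indicator {0<..T} t * h t)" "integrable lborel (\<lambda>t. indicator {0<..T} t * y t)"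
      unfolding eq[of h] eq[of y] by (intro integrable_mult_indicator hi yi; simp)+
  qed
  define z where "z t = (LINT s|lborel. indicator {0<..t} s * h s)" for t
  have zm[measurable]: "z \<in> borel_measurable borel"
  proof -
    have "(\<lambda>x. (if 0 < snd x \<and> snd x \<le> fst x then 1 else 0) * h (snd x)) \<in> borel_measurable (borel \<Otimes>\<^sub>M lborel)"
      by measurable
    then have "(\<lambda>t. LINT s|lborel. (if 0 < s \<and> s \<le> t then 1 else 0) * h s) \<in> borel_measurable borel"
      by (intro lborel.borel_measurable_lebesgue_integral) (simp add: case_prod_beta')
    then show ?thesis unfolding z_def [abs_def] by (simp add: indicator_def of_bool_def)
  qed
  have zb: "cmod (z t) \<le> (LINT s|lborel. cmod (indicator {0<..T} s * h s))" if "t \<le> T" for t T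
  proof -
    have "cmod (z t) \<le> (LINT s|lborel. cmod (indicator {0<..t} s * h s))"
      unfolding z_def by (rule integral_norm_bound)
    also have "\<dots> \<le> (LINT s|lborel. cmod (indicator {0<..T} s * h s))"
      by (intro integral_mono integrable_norm hT) (use that in \<open>auto split: split_indicator\<close>)
    finally show ?thesis .
  qed
  define f where "f t = indicator {0<..} t * (y t - y0 - z t)" for t
  have [measurable]: "f \<in> borel_measurable borel" unfolding f_def [abs_def] by measurable
  have fi: "integrable lborel (\<lambda>t. indicator {0<..T} t * f t)" for T
  proof -
    have "integrable lborel (\<lambda>t. indicator {0<..T} t *\<^sub>R (indicator {0..T} t * (y0 + z t)))"
    proof (rule integrable_mult_indicator)
      show "integrable lborel (\<lambda>t. indicator {0..T} t * (y0 + z t))"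
      proof (rule integrable_bounded_Icc)
        fix s assume "s \<le> T"
        from zb[OF this] norm_triangle_ineq[of y0 "z s"]
        show "cmod (y0 + z s) \<le> cmod y0 + (LINT s|lborel. cmod (indicator {0<..T} s * h s))" by linarith
      qed measurable
    qed simp
    from Bochner_Integration.integrable_diff[OF yT[of T] this]
    show ?thesis
      by (rule Bochner_Integration.integrable_cong[THEN iffD1, rotated 2])
         (auto simp: f_def algebra_simps split: split_indicator)
  qed
  have key: "(LINT t|lborel. complex_of_real (bump a b (1 / real (Suc n)) t) * f t) = 0"
    if ab: "a \<in> \<rat>" "b \<in> \<rat>" "0 \<le> a" "a < b" for a b n
  proof -
    let ?\<beta> = "\<lambda>t. complex_of_real (bump a b (1 / real (Suc n)) t)"
    let ?\<theta> = "\<lambda>t. complex_of_real (LINT s|lborel. indicator {t..} s * bump a b (1 / real (Suc n)) s)"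
    have c: "0 < 1 / real (Suc n)" by simp
    have cont: "continuous_on UNIV (bump a b (1 / real (Suc n)))" "supported_in b (bump a b (1 / real (Suc n)))"
      using ab by (rule_tac Ck_continuous[OF Ck_bump[OF c, of 0]], rule_tac supported_in_bump) auto
    note [measurable] = continuous_supported(1)[OF cont]
    have \<beta>1: "cmod (?\<beta> t) \<le> 1" for t
      using bump_nonneg bump_le_1[OF c] by simp
    have \<theta>: "?\<theta> t = (LINT s|lborel. indicator {t..b} s * ?\<beta> s)" for t
    proof -
      have "(LINT s|lborel. indicator {t..b} s * ?\<beta> s) = (LINT s|lborel. complex_of_real (indicator {t..} s * bump a b (1 / real (Suc n)) s))"
        by (intro Bochner_Integration.integral_cong refl) (auto intro!: bump_eq_0 split: split_indicator)
      then show ?thesis by (simp only: integral_complex_of_real)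
    qed
    have \<theta>m[measurable]: "(\<lambda>t. LINT s|lborel. indicator {t..} s * bump a b (1 / real (Suc n)) s) \<in> borel_measurable borel"
      by (rule borel_measurable_continuous_onI[OF DERIV_continuous_on_UNIV[OF bump_primitive(1)[OF c]]])
    have bd: "?\<beta> t = indicator {0<..b} t * ?\<beta> t" for t
      using ab bump_eq_0[of t a b] by (auto split: split_indicator)
    have bd\<theta>: "indicator {0<..} t * ?\<theta> t = indicator {0<..b} t * ?\<theta> t" for t
      using bump_primitive(3)[OF c, of b t a] by (auto split: split_indicator)
    have int\<beta>: "integrable lborel (\<lambda>t. ?\<beta> t * g t)" if g: "integrable lborel (\<lambda>t. indicator {0<..b} t * g t)"
      and [measurable]: "g \<in> borel_measurable borel" for g
    proof (rule Bochner_Integration.integrable_bound[OF g])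
      show "AE t in lborel. norm (?\<beta> t * g t) \<le> norm (indicator {0<..b} t * g t)"
      proof (rule AE_I2)
        fix t
        have "norm (?\<beta> t * g t) = cmod (?\<beta> t) * cmod (indicator {0<..b} t * g t)"
          using bd[of t] by (auto simp: norm_mult split: split_indicator)
        also have "\<dots> \<le> 1 * cmod (indicator {0<..b} t * g t)" by (intro mult_right_mono \<beta>1) simp
        finally show "norm (?\<beta> t * g t) \<le> norm (indicator {0<..b} t * g t)" by simp
      qed
    qed measurable
    have \<theta>b: "cmod (?\<theta> t) \<le> b" if "0 < t" for t
    proof -
      have "cmod (?\<theta> t) \<le> (LINT s|lborel. cmod (indicator {t..b} s * ?\<beta> s))"
        unfolding \<theta> by (rule integral_norm_bound)
      also have "\<dots> \<le> (LINT s|lborel. indicator {0..b} s)"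
      proof (rule integral_mono)
        show "integrable lborel (\<lambda>s. cmod (indicator {t..b} s * ?\<beta> s))"
          by (intro integrable_norm integrable_bounded_Icc[where B=1] \<beta>1) measurable
        show "integrable lborel (indicator {0..b} :: real \<Rightarrow> real)"
          by (rule integrable_real_indicator) (auto simp: emeasure_lborel_Icc_eq)
        show "cmod (indicator {t..b} s * ?\<beta> s) \<le> indicator {0..b} s" for s
          using \<beta>1[of s] that by (auto split: split_indicator)
      qed
      also have "\<dots> = b" using ab by simp
      finally show ?thesis .
    qed
    have int\<theta>: "integrable lborel (\<lambda>t. indicator {0<..} t * (?\<theta> t * h t))"
    proof (rule Bochner_Integration.integrable_bound)
      show "integrable lborel (\<lambda>t. complex_of_real b * (indicator {0<..b} t * h t))" using hT by simp
      show "AE t in lborel. norm (indicator {0<..} t * (?\<theta> t * h t)) \<le> norm (complex_of_real b * (indicator {0<..b} t * h t))"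
      proof (rule AE_I2)
        fix t
        show "norm (indicator {0<..} t * (?\<theta> t * h t)) \<le> norm (complex_of_real b * (indicator {0<..b} t * h t))"
        proof (cases "0 < t \<and> t \<le> b")
          case True
          then show ?thesis using mult_right_mono[OF \<theta>b[of t], of "cmod (h t)"] ab by (simp add: norm_mult)
        next
          case False
          then have "indicator {0<..} t * ?\<theta> t = 0" unfolding bd\<theta> by (simp add: indicator_def)
          then have "indicator {0<..} t * (?\<theta> t * h t) = 0" by (simp only: mult.assoc[symmetric] mult_zero_left)
          then show ?thesis by (simp only: norm_zero norm_ge_zero)
        qed
      qed
    qed measurable
    \<comment> \<open>Integration by parts in disguise: the profile is itself the integral of the
      bump over later times, and exchanging the order leaves the primitive \<open>z\<close>.\<close>
    have 1: "(LINT t|lborel. indicator {0<..} t * (?\<theta> t * h t)) = (LINT t|lborel. ?\<beta> t * z t)"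
    proof -
      have "(LINT t|lborel. indicator {0<..} t * (?\<theta> t * h t)) =
          (LINT r|lborel. indicator {0<..b} r * h r * (LINT s|lborel. indicator {r..b} s * ?\<beta> s))"
        unfolding \<theta>[symmetric]
      proof (intro Bochner_Integration.integral_cong refl)
        show "indicator {0<..} r * (?\<theta> r * h r) = indicator {0<..b} r * h r * ?\<theta> r" for r
          using arg_cong[OF bd\<theta>[of r], of "\<lambda>v. v * h r"] by (simp only: mult_ac)
      qed
      also have "\<dots> = (LINT s|lborel. indicator {0<..b} s * ?\<beta> s * (LINT r|lborel. indicator {0<..s} r * h r))"
        by (rule triangle_Fubini[symmetric, where B=1]) (use hT \<beta>1 in measurable)
      also have "\<dots> = (LINT t|lborel. ?\<beta> t * z t)"
        by (simp only: z_def bd[symmetric])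
      finally show ?thesis .
    qed
    \<comment> \<open>Because \<open>a\<close> is nonnegative, the bump lies in the positive
      half-line, so the profile at 0 is its total mass and the datum acts like a constant added to
      \<open>z\<close>.\<close>
    have 2: "?\<theta> 0 * y0 = (LINT t|lborel. ?\<beta> t * y0)"
    proof -
      have "?\<theta> 0 = (LINT t|lborel. ?\<beta> t)"
        unfolding \<theta> using ab
        by (intro Bochner_Integration.integral_cong refl) (auto intro!: bump_eq_0 simp: not_le split: split_indicator)
      then show ?thesis by simp
    qed
    have i0: "integrable lborel (\<lambda>t. ?\<beta> t * y0)" by (rule integrable_mult_left) (rule continuous_supported[OF cont])
    have iz: "integrable lborel (\<lambda>t. ?\<beta> t * z t)"
    proof (rule int\<beta>)
      have "integrable lborel (\<lambda>t. indicator {0<..b} t *\<^sub>R (indicator {0..b} t * z t))"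
        by (intro integrable_mult_indicator integrable_bounded_Icc[where B="LINT s|lborel. cmod (indicator {0<..b} s * h s)"] zb) measurable
      then show "integrable lborel (\<lambda>t. indicator {0<..b} t * z t)"
        by (rule Bochner_Integration.integrable_cong[THEN iffD1, rotated 2]) (auto split: split_indicator)
    qed measurable
    note iy = int\<beta>[OF yT ym]
    have \<beta>0: "bump a b (1 / real (Suc n)) t = 0" if "\<not> 0 < t" for t
      using that ab by (intro bump_eq_0) auto
    have "0 = (LINT t|lborel. indicator {0<..} t * (- ?\<beta> t * y t + ?\<theta> t * h t)) + ?\<theta> 0 * y0"
      using weak[OF ab] by simp
    also have "(LINT t|lborel. indicator {0<..} t * (- ?\<beta> t * y t + ?\<theta> t * h t)) =
       (LINT t|lborel. - (?\<beta> t * y t) + indicator {0<..} t * (?\<theta> t * h t))"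
      by (intro Bochner_Integration.integral_cong refl) (auto simp: \<beta>0 simp del: of_nat_Suc split: split_indicator)
    also have "\<dots> = - (LINT t|lborel. ?\<beta> t * y t) + (LINT t|lborel. indicator {0<..} t * (?\<theta> t * h t))"
      using iy int\<theta> by simp
    finally have "(LINT t|lborel. ?\<beta> t * y t) - (LINT t|lborel. ?\<beta> t * y0) - (LINT t|lborel. ?\<beta> t * z t) = 0"
      unfolding 1 2 by (simp add: algebra_simps)
    moreover have "(LINT t|lborel. ?\<beta> t * f t) = (LINT t|lborel. ?\<beta> t * y t - ?\<beta> t * y0 - ?\<beta> t * z t)"
      by (intro Bochner_Integration.integral_cong refl)
         (auto simp: f_def \<beta>0 right_diff_distrib simp del: of_nat_Suc split: split_indicator)
    ultimately show ?thesis using iy i0 iz by simp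
  qed
  have pos: "(LINT t|lborel. indicator {a..b} t * f t) = 0"
    if ab: "a \<in> \<rat>" "b \<in> \<rat>" "0 \<le> a" "a < b" for a b
  proof (rule interval_integral_zero_if_bump_integrals_zero[OF _ _ key[OF ab]])
    show "integrable lborel (\<lambda>t. indicator {a..b} t * f t)"
    proof -
      have "integrable lborel (\<lambda>t. indicator {a..b} t *\<^sub>R (indicator {0<..b} t * f t))"
        by (intro integrable_mult_indicator fi) simp
      then show ?thesis
        by (rule Bochner_Integration.integrable_cong[THEN iffD1, rotated 2])
           (use ab in \<open>auto simp: f_def split: split_indicator\<close>)
    qed
  qed measurable
  have "AE t in lborel. f t = 0"
  proof (rule AE_zero_if_interval_integrals_zero)
    show "f \<in> borel_measurable borel" by measurable
    show "integrable lborel (cutoff n f)" for n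
      using fi[of "real n"]
      by (rule Bochner_Integration.integrable_cong[THEN iffD1, rotated 2])
         (auto simp: cutoff_def f_def split: split_indicator)
    fix a b :: real assume ab: "a \<in> \<rat>" "b \<in> \<rat>" "a < b"
    show "(LINT t|lborel. indicator {a..b} t * f t) = 0"
    \<comment> \<open>\<open>f\<close> is zero for nonpositive times, so the left endpoint can be
      raised to 0, where the tested identities start.\<close>
    proof (cases "0 < b")
      case True
      have "(LINT t|lborel. indicator {a..b} t * f t) = (LINT t|lborel. indicator {max a 0..b} t * f t)"
        by (intro Bochner_Integration.integral_cong refl) (auto simp: f_def split: split_indicator)
      also have "\<dots> = 0" using True ab by (intro pos) (auto simp: max_def)
      finally show ?thesis .
    next
      case False
      then have "(LINT t|lborel. indicator {a..b} t * f t) = (LINT t::real|lborel. 0 :: complex)"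
        by (intro Bochner_Integration.integral_cong refl) (auto simp: f_def split: split_indicator)
      then show ?thesis by simp
    qed
  qed
  then show ?thesis
    by eventually_elim (auto simp: f_def z_def diff_eq_eq add.commute)
qed

text \<open>The integrating factor exp (L s) is applied without differentiating \<open>y\<close>,
  for which the equation is only available at almost every time. The product rule is replaced by
  Fubini on a triangle, at a fixed \<open>t\<close> where the equation does hold.\<close>

lemma duhamel_inequality:
  fixes y g :: "real \<Rightarrow> complex"
  assumes [measurable]: "y \<in> borel_measurable borel" "g \<in> borel_measurable borel"
    and yi: "\<And>n::nat. integrable lborel (\<lambda>t. indicator {0<..real n} t * y t)"
    and gi: "\<And>n::nat. integrable lborel (\<lambda>t. indicator {0<..real n} t * g t)"
    and L: "0 \<le> L"
    and eq: "AE t in lborel. 0 < t \<longrightarrow> y t = y0 + (LINT s|lborel. indicator {0<..t} s * (g s - complex_of_real L * y s))"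
  shows "AE t in lborel. 0 < t \<longrightarrow> ennreal (cmod (y t)) \<le> ennreal (cmod y0) +
     (\<integral>\<^sup>+s. ennreal (exp (- (t - s) * L) * cmod (g s)) * indicator {0<..<t} s \<partial>lborel)"
  using eq
proof eventually_elim
  case (elim t)
  show ?case
  proof
    assume t: "0 < t"
    define h where "h s = g s - complex_of_real L * y s" for s
    define z where "z t = y0 + (LINT s|lborel. indicator {0<..t} s * h s)" for t
    have [measurable]: "h \<in> borel_measurable borel" unfolding h_def [abs_def] by measurable
    have cut: "integrable lborel (\<lambda>s. indicator {0<..t} s * f s)"
      if "\<And>n::nat. integrable lborel (\<lambda>s. indicator {0<..real n} s * f s)" for f :: "real \<Rightarrow> complex"
    proof -
      obtain n :: nat where n: "t \<le> real n" using real_arch_simple by blast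
      have "integrable lborel (\<lambda>s. indicator {0<..t} s *\<^sub>R (indicator {0<..real n} s * f s))"
        by (intro integrable_mult_indicator that) simp
      then show ?thesis
        by (rule Bochner_Integration.integrable_cong[THEN iffD1, rotated 2]) (use n in \<open>auto split: split_indicator\<close>)
    qed
    note yt = cut[OF yi] and gt = cut[OF gi]
    have ht: "integrable lborel (\<lambda>s. indicator {0<..t} s * h s)"
      using Bochner_Integration.integrable_diff[OF gt integrable_mult_right[OF yt, of "complex_of_real L"]]
      by (rule Bochner_Integration.integrable_cong[THEN iffD1, rotated 2]) (auto simp: h_def algebra_simps)
    define E where "E s = complex_of_real (exp (L * s))" for s
    have [measurable]: "E \<in> borel_measurable borel" unfolding E_def [abs_def] by measurable
    have Eb: "cmod (E s) \<le> exp (L * t)" if "s \<le> t" for s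
      unfolding E_def using that L by (simp add: mult_left_mono)
    have Ei: "integrable lborel (\<lambda>s. E s * (indicator {0<..t} s * f s))"
      if "integrable lborel (\<lambda>s. indicator {0<..t} s * f s)" for f
    proof (rule Bochner_Integration.integrable_bound)
      show "integrable lborel (\<lambda>s. complex_of_real (exp (L * t)) * (indicator {0<..t} s * f s))" using that by simp
      have "(\<lambda>s. indicator {0<..t} s * f s) \<in> borel_measurable lborel" using that by simp
      then show "(\<lambda>s. E s * (indicator {0<..t} s * f s)) \<in> borel_measurable lborel" by measurable
      show "AE s in lborel. norm (E s * (indicator {0<..t} s * f s)) \<le> norm (complex_of_real (exp (L * t)) * (indicator {0<..t} s * f s))"
        using Eb by (intro AE_I2) (auto simp: norm_mult mult_right_mono split: split_indicator)
    qed
    have FTC: "(LINT s|lborel. indicator {r..t} s * (complex_of_real L * E s)) = E t - E r" if "r \<le> t" for r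
    proof -
      have "(LINT s|lborel. indicator {r..t} s * (complex_of_real L * E s)) = (LINT s|lborel. indicator {r..t} s *\<^sub>R (complex_of_real L * E s))"
        by (intro Bochner_Integration.integral_cong refl) (auto split: split_indicator)
      also have "\<dots> = E t - E r"
      proof (rule integral_FTC_Icc[OF that])
        show "(E has_vector_derivative complex_of_real L * E s) (at s within {r..t})" for s
        proof -
          have "((\<lambda>s. exp (L * s)) has_real_derivative L * exp (L * s)) (at s within {r..t})"
            by (auto intro!: derivative_eq_intros)
          from has_vector_derivative_of_real[OF this] show ?thesis unfolding E_def [abs_def] by simp
        qed
        show "continuous_on {r..t} (\<lambda>s. complex_of_real L * E s)"
          unfolding E_def [abs_def] by (intro continuous_intros)
      qed
      finally show ?thesis .
    qed
    let ?H = "LINT r|lborel. indicator {0<..t} r * h r"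
    \<comment> \<open>The derivative of \<open>E\<close> against the primitive of \<open>h\<close>
      equals boundary term minus integral of \<open>E * h\<close>, by exchanging the order of
      integration.\<close>
    have F: "(LINT s|lborel. indicator {0<..t} s * (complex_of_real L * E s) * (LINT r|lborel. indicator {0<..s} r * h r))
       = E t * ?H - (LINT r|lborel. E r * (indicator {0<..t} r * h r))"
    proof -
      have "(LINT s|lborel. indicator {0<..t} s * (complex_of_real L * E s) * (LINT r|lborel. indicator {0<..s} r * h r))
         = (LINT r|lborel. indicator {0<..t} r * h r * (LINT s|lborel. indicator {r..t} s * (complex_of_real L * E s)))"
      proof (rule triangle_Fubini)
        show "cmod (complex_of_real L * E s) \<le> L * exp (L * t)" if "s \<le> t" for s
          using Eb[OF that] L by (simp add: norm_mult mult_left_mono)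
      qed (use ht in measurable)
      also have "\<dots> = (LINT r|lborel. E t * (indicator {0<..t} r * h r) - E r * (indicator {0<..t} r * h r))"
      proof (intro Bochner_Integration.integral_cong refl)
        fix r
        show "indicator {0<..t} r * h r * (LINT s|lborel. indicator {r..t} s * (complex_of_real L * E s)) =
            E t * (indicator {0<..t} r * h r) - E r * (indicator {0<..t} r * h r)"
        proof (cases "0 < r \<and> r \<le> t")
          case True
          then have "r \<le> t" by simp
          show ?thesis unfolding FTC[OF \<open>r \<le> t\<close>] by (simp add: algebra_simps)
        next
          case False
          then have "indicator {0<..t} r = (0::complex)" by (auto simp: indicator_def)
          then show ?thesis by simp
        qed
      qed
      also have "\<dots> = E t * ?H - (LINT r|lborel. E r * (indicator {0<..t} r * h r))"
        using ht Ei[OF ht] by simp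
      finally show ?thesis .
    qed
    \<comment> \<open>The equation, valid for almost every \<open>s\<close>, replaces the primitive
      of \<open>h\<close> by y - y0; the exponential terms in \<open>y\<close> then cancel those
      hidden in \<open>h\<close>.\<close>
    have y_eq: "AE s in lborel. indicator {0<..t} s * (complex_of_real L * E s) * (LINT r|lborel. indicator {0<..s} r * h r) =
       complex_of_real L * (E s * (indicator {0<..t} s * y s)) - y0 * (indicator {0..t} s * (complex_of_real L * E s))"
      using eq AE_lborel_singleton[of "0::real"]
      by eventually_elim (auto simp: h_def algebra_simps split: split_indicator)
    have iE: "integrable lborel (\<lambda>s. indicator {0..t} s * (complex_of_real L * E s))"
    proof (rule integrable_bounded_Icc)
      show "cmod (complex_of_real L * E s) \<le> L * exp (L * t)" if "s \<le> t" for s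
        using Eb[OF that] L by (simp add: norm_mult mult_left_mono)
    qed measurable
    have "(LINT s|lborel. indicator {0<..t} s * (complex_of_real L * E s) * (LINT r|lborel. indicator {0<..s} r * h r))
      = (LINT s|lborel. complex_of_real L * (E s * (indicator {0<..t} s * y s)) - y0 * (indicator {0..t} s * (complex_of_real L * E s)))"
    proof (rule integral_cong_AE[OF _ _ y_eq])
      have "(\<lambda>x. (if 0 < snd x \<and> snd x \<le> fst x then 1 else 0) * h (snd x)) \<in> borel_measurable (borel \<Otimes>\<^sub>M lborel)"
        by measurable
      then have "(\<lambda>t. LINT s|lborel. (if 0 < s \<and> s \<le> t then 1 else 0) * h s) \<in> borel_measurable borel"
        by (intro lborel.borel_measurable_lebesgue_integral) (simp add: case_prod_beta')
      then have [measurable]: "(\<lambda>t. LINT s|lborel. indicator {0<..t} s * h s) \<in> borel_measurable borel"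
        by (simp add: indicator_def of_bool_def)
      show "(\<lambda>s. indicator {0<..t} s * (complex_of_real L * E s) * (LINT r|lborel. indicator {0<..s} r * h r)) \<in> borel_measurable lborel"
        by measurable
    qed measurable
    also have "\<dots> = complex_of_real L * (LINT s|lborel. E s * (indicator {0<..t} s * y s)) - y0 * (E t - E 0)"
      using Ei[OF yt] iE FTC[of 0] t by simp
    finally have "E t * (y0 + ?H) = y0 + ((LINT r|lborel. E r * (indicator {0<..t} r * h r)) +
        complex_of_real L * (LINT s|lborel. E s * (indicator {0<..t} s * y s)))"
      unfolding F by (simp add: algebra_simps E_def)
    also have "(LINT r|lborel. E r * (indicator {0<..t} r * h r)) + complex_of_real L * (LINT s|lborel. E s * (indicator {0<..t} s * y s)) =
      (LINT r|lborel. E r * (indicator {0<..t} r * h r) + complex_of_real L * (E r * (indicator {0<..t} r * y r)))"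
      using Ei[OF ht] Ei[OF yt] by simp
    also have "\<dots> = (LINT r|lborel. E r * (indicator {0<..t} r * g r))"
      by (intro Bochner_Integration.integral_cong refl) (simp add: h_def algebra_simps)
    \<comment> \<open>Duhamel's formula multiplied by exp (L t). Dividing by it and taking moduli
      finishes the proof, with exp (- L t) \<le> 1 in front of the datum.\<close>
    finally have "y t * E t = y0 + (LINT r|lborel. E r * (indicator {0<..t} r * g r))"
      using elim t by (simp add: h_def mult.commute)
    define G where "G = (LINT r|lborel. E r * (indicator {0<..t} r * g r))"
    define e where "e = complex_of_real (exp (- (L * t)))"
    have "E t * e = 1" unfolding E_def e_def by (simp flip: of_real_mult exp_add)
    then have "y t = (y t * E t) * e" by (simp add: mult.assoc)
    also have "\<dots> = e * y0 + e * G"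
      unfolding \<open>y t * E t = _\<close> G_def[symmetric] by (simp add: algebra_simps)
    also have "e * G = (LINT r|lborel. e * (E r * (indicator {0<..t} r * g r)))"
      unfolding G_def by (rule integral_mult_right_zero[symmetric])
    finally have yt_eq: "y t = complex_of_real (exp (- (L * t))) * y0 +
        (LINT r|lborel. complex_of_real (exp (- (L * t))) * (E r * (indicator {0<..t} r * g r)))"
      unfolding e_def .
    have "ennreal (cmod (y t)) \<le> ennreal (cmod (complex_of_real (exp (- (L * t))) * y0) +
        cmod (LINT r|lborel. complex_of_real (exp (- (L * t))) * (E r * (indicator {0<..t} r * g r))))"
      unfolding yt_eq by (intro ennreal_leI norm_triangle_ineq)
    also have "\<dots> = ennreal (cmod (complex_of_real (exp (- (L * t))) * y0)) +
        ennreal (cmod (LINT r|lborel. complex_of_real (exp (- (L * t))) * (E r * (indicator {0<..t} r * g r))))"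
      by (rule ennreal_plus) auto
    also have "\<dots> \<le> ennreal (cmod y0) + (\<integral>\<^sup>+r. ennreal (cmod (complex_of_real (exp (- (L * t))) * (E r * (indicator {0<..t} r * g r)))) \<partial>lborel)"
    proof (intro add_mono integral_norm_bound_ennreal' ennreal_leI)
      show "cmod (complex_of_real (exp (- (L * t))) * y0) \<le> cmod y0"
        using mult_right_mono[of "exp (- (L * t))" 1 "cmod y0"] L t by (simp add: norm_mult)
    qed
    also have "(\<integral>\<^sup>+r. ennreal (cmod (complex_of_real (exp (- (L * t))) * (E r * (indicator {0<..t} r * g r)))) \<partial>lborel) =
       (\<integral>\<^sup>+s. ennreal (exp (- (t - s) * L) * cmod (g s)) * indicator {0<..<t} s \<partial>lborel)"
    proof (rule nn_integral_cong_AE)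
      show "AE r in lborel. ennreal (cmod (complex_of_real (exp (- (L * t))) * (E r * (indicator {0<..t} r * g r)))) =
         ennreal (exp (- (t - r) * L) * cmod (g r)) * indicator {0<..<t} r"
        using AE_lborel_singleton[of t]
      proof eventually_elim
        case (elim r)
        have "exp (- (L * t)) * exp (L * r) = exp (- (t - r) * L)" by (simp add: algebra_simps flip: exp_add)
        then show ?case using elim
          by (auto simp: E_def norm_mult simp flip: mult.assoc split: split_indicator)
      qed
    qed
    finally show "ennreal (cmod (y t)) \<le> ennreal (cmod y0) +
     (\<integral>\<^sup>+s. ennreal (exp (- (t - s) * L) * cmod (g s)) * indicator {0<..<t} s \<partial>lborel)" .
  qed
qed

subsection \<open>Translation, modulation and the action of the operator on test functions\<close>

lemma fourier_integral_translate:
  "fourier_integral (\<lambda>x. f (x - y)) \<xi> = cis (- (y * \<xi>)) * fourier_integral f \<xi>"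
proof -
  have "fourier_integral (\<lambda>x. f (x - y)) \<xi> = (LINT x|lborel. f (y + 1 * x - y) * cis (- ((y + 1 * x) * \<xi>)))"
    unfolding fourier_integral_def
    using lborel_integral_real_affine[of 1 "\<lambda>x. f (x - y) * cis (- (x * \<xi>))" y] by simp
  also have "\<dots> = (LINT x|lborel. cis (- (y * \<xi>)) * (f x * cis (- (x * \<xi>))))"
  proof (intro Bochner_Integration.integral_cong refl)
    fix x
    have "cis (- ((y + 1 * x) * \<xi>)) = cis (- (y * \<xi>)) * cis (- (x * \<xi>))"
      by (simp add: cis_mult algebra_simps)
    then show "f (y + 1 * x - y) * cis (- ((y + 1 * x) * \<xi>)) = cis (- (y * \<xi>)) * (f x * cis (- (x * \<xi>)))" by simp
  qed
  finally show ?thesis unfolding fourier_integral_def by simp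
qed

lemma fourier_modulate:
  assumes f: "square_integrable f"
  shows "AE \<eta> in lborel. fourier (\<lambda>x. cis (x * \<xi>) * f x) \<eta> = fourier f (\<eta> - \<xi>)"
proof -
  have g: "square_integrable (\<lambda>x. cis (x * \<xi>) * f x)"
    by (rule square_integrable_mult_bounded[OF f, where C=1]) auto
  have shift: "sq_norm (\<lambda>\<eta>. h (\<eta> - \<xi>)) = sq_norm h" for h
    unfolding sq_norm_def using lborel_integral_real_affine[of 1 "\<lambda>\<eta>. (cmod (h \<eta>))\<^sup>2" "- \<xi>"] by simp
  have sq: "square_integrable (\<lambda>\<eta>. fourier f (\<eta> - \<xi>))"
    using lborel_integrable_real_affine[OF square_integrable_integrable[OF square_integrable_fourier[OF f]], of 1 "- \<xi>"]
      square_integrable_measurable[OF square_integrable_fourier[OF f]]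
    unfolding square_integrable_def by simp
  show ?thesis
  proof (rule fourier_unique[OF g sq])
    have eq: "truncated_fourier n (\<lambda>x. cis (x * \<xi>) * f x) \<eta> = truncated_fourier n f (\<eta> - \<xi>)" for n \<eta>
      unfolding truncated_fourier_eq fourier_integral_def cutoff_def
    proof (intro Bochner_Integration.integral_cong refl)
      fix x
      have "cis (x * \<xi>) * cis (- (x * \<eta>)) = cis (- (x * (\<eta> - \<xi>)))"
        by (simp add: cis_mult algebra_simps)
      then show "indicator {- real n..real n} x * (cis (x * \<xi>) * f x) * cis (- (x * \<eta>)) =
          indicator {- real n..real n} x * f x * cis (- (x * (\<eta> - \<xi>)))" by (simp add: mult_ac)
    qed
    show "(\<lambda>n. sq_norm (\<lambda>\<eta>. truncated_fourier n (\<lambda>x. cis (x * \<xi>) * f x) \<eta> - fourier f (\<eta> - \<xi>))) \<longlonglongrightarrow> 0"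
      unfolding eq using fourier_tendsto[OF f] shift[of "\<lambda>\<eta>. truncated_fourier _ f \<eta> - fourier f \<eta>"] by simp
  qed
qed

lemma square_integrable_weight_decay:
  fixes f :: "real \<Rightarrow> complex"
  assumes [measurable]: "f \<in> borel_measurable borel" and f: "\<And>\<xi>. weight \<xi> * cmod (f \<xi>) \<le> C"
  shows "square_integrable f"
proof (rule square_integrableI)
  have "(\<integral>\<^sup>+\<xi>. ennreal ((cmod (f \<xi>))\<^sup>2) \<partial>lborel) \<le> (\<integral>\<^sup>+\<xi>. ennreal (C\<^sup>2) * ennreal (weight \<xi> powr - 2) \<partial>lborel)"
  proof (intro nn_integral_mono)
    fix \<xi>
    have "cmod (f \<xi>) \<le> C / weight \<xi>"
      using f[of \<xi>] by (subst pos_le_divide_eq) (auto simp: mult.commute)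
    then have "(cmod (f \<xi>))\<^sup>2 \<le> (C / weight \<xi>)\<^sup>2" by (intro power_mono) auto
    also have "\<dots> = C\<^sup>2 * weight \<xi> powr - 2"
      by (simp add: powr_minus powr_numeral divide_inverse power_mult_distrib power_inverse)
    finally show "ennreal ((cmod (f \<xi>))\<^sup>2) \<le> ennreal (C\<^sup>2) * ennreal (weight \<xi> powr - 2)"
      by (subst ennreal_mult''[symmetric]) (auto intro: ennreal_leI)
  qed
  also have "\<dots> = ennreal (C\<^sup>2) * (\<integral>\<^sup>+\<xi>. ennreal (weight \<xi> powr - 2) \<partial>lborel)"
    by (rule nn_integral_cmult) measurable
  also have "\<dots> < \<infinity>" using nn_integral_weight_powr[of 2] by (simp add: ennreal_mult_less_top)
  finally show "(\<integral>\<^sup>+\<xi>. ennreal ((cmod (f \<xi>))\<^sup>2) \<partial>lborel) < \<infinity>" .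
qed simp

text \<open>\<open>sqrt_laplacian_M\<close> picks a representative afresh for every argument, so
  even homogeneity holds only almost everywhere. One \<open>g\<close> serving all multiples
  \<open>c\<close> lets the time factor of a product test function be pulled out.\<close>

lemma sqrt_laplacian_M_test_function:
  assumes \<psi>: "\<And>k. Ck k \<psi>" "supported_in R \<psi>"
  obtains g where "square_integrable g"
    "AE \<xi> in lborel. fourier (\<lambda>x. complex_of_real (g x)) \<xi> =
      complex_of_real (dissipation \<xi>) * fourier_integral (\<lambda>x. complex_of_real (\<psi> x)) \<xi>"
    "\<And>c. AE x in lborel. sqrt_laplacian_M (\<lambda>x. c * \<psi> x) x = c * g x"
proof -
  let ?\<psi> = "\<lambda>x. complex_of_real (\<psi> x)"
  let ?\<Psi> = "fourier_integral ?\<psi>"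
  note cs = continuous_supported[OF Ck_continuous[OF \<psi>(1)[of 0]] \<psi>(2)]
  have \<psi>sq: "square_integrable ?\<psi>" and \<psi>i: "integrable lborel ?\<psi>" using cs by simp_all
  note F\<psi> = fourier_eq_fourier_integral[OF \<psi>sq \<psi>i]
  note [measurable] = square_integrable_measurable[OF fourier_integral_bessel(1)[OF \<psi>i \<psi>sq]]
  obtain C where C: "\<And>\<xi>. weight \<xi> ^ 4 * cmod (?\<Psi> \<xi>) \<le> C"
    using fourier_integral_weight_decay[OF \<psi>] by blast
  have L\<Psi>: "square_integrable (\<lambda>\<xi>. complex_of_real (dissipation \<xi>) * ?\<Psi> \<xi>)"
  proof (rule square_integrable_weight_decay)
    fix \<xi>
    have "weight \<xi> * cmod (complex_of_real (dissipation \<xi>) * ?\<Psi> \<xi>) \<le> weight \<xi> ^ 4 * cmod (?\<Psi> \<xi>)"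
    proof -
      have "weight \<xi> * dissipation \<xi> \<le> weight \<xi> * (weight \<xi>)\<^sup>2"
        by (intro mult_left_mono dissipation_le) simp
      also have "\<dots> = weight \<xi> ^ 3" by (simp add: power2_eq_square power3_eq_cube)
      also have "\<dots> \<le> weight \<xi> ^ 4" by (intro power_increasing weight_ge_1) simp
      finally show ?thesis
        using dissipation_nonneg[of \<xi>] by (simp add: norm_mult mult_right_mono flip: mult.assoc)
    qed
    also note C
    finally show "weight \<xi> * cmod (complex_of_real (dissipation \<xi>) * ?\<Psi> \<xi>) \<le> C" .
  qed measurable
  have M: "is_multiplier dissipation f (multiplier dissipation f)"
    if f: "square_integrable f" and eq: "AE \<xi> in lborel. fourier f \<xi> = complex_of_real c * ?\<Psi> \<xi>" for f c
  proof (rule multiplier_exists[OF f])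
    have "(\<integral>\<^sup>+\<xi>. ennreal ((dissipation \<xi>)\<^sup>2 * (cmod (fourier f \<xi>))\<^sup>2) \<partial>lborel) =
       (\<integral>\<^sup>+\<xi>. ennreal ((cmod (complex_of_real c * (complex_of_real (dissipation \<xi>) * ?\<Psi> \<xi>)))\<^sup>2) \<partial>lborel)"
      by (intro nn_integral_cong_AE) (use eq in eventually_elim, simp add: norm_mult power_mult_distrib mult_ac)
    also have "\<dots> < \<infinity>" using square_integrable_nn[OF square_integrable_cmult[OF L\<Psi>]] by simp
    finally show "(\<integral>\<^sup>+\<xi>. ennreal ((dissipation \<xi>)\<^sup>2 * (cmod (fourier f \<xi>))\<^sup>2) \<partial>lborel) < \<infinity>" .
  qed measurable
  define G where "G = multiplier dissipation ?\<psi>"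
  have "is_multiplier dissipation ?\<psi> G"
    unfolding G_def by (rule M[OF \<psi>sq, of 1]) (use F\<psi> in simp)
  then have Gsq: "square_integrable G" and FG': "AE \<xi> in lborel. fourier G \<xi> = complex_of_real (dissipation \<xi>) * fourier ?\<psi> \<xi>"
    unfolding is_multiplier_def by auto
  have FG: "AE \<xi> in lborel. fourier G \<xi> = complex_of_real (dissipation \<xi>) * ?\<Psi> \<xi>"
    using FG' F\<psi> by eventually_elim simp
  note [measurable] = square_integrable_measurable[OF square_integrable_fourier[OF Gsq]] square_integrable_measurable[OF Gsq]
  have \<Psi>cnj: "cnj (?\<Psi> (- \<xi>)) = ?\<Psi> \<xi>" for \<xi>
    using fourier_integral_cnj[of ?\<psi> \<xi>] by simp
  \<comment> \<open>Conjugation reflects the frequency; the symbol is even and the transform of a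
    real function is conjugate-symmetric, so both sides have the same transform. Hence the
    \<open>Re\<close> in the definition loses nothing.\<close>
  have real: "AE x in lborel. cnj (G x) = G x"
  proof (rule fourier_inj[OF square_integrable_cnj[OF Gsq] Gsq])
    have "AE \<xi> in lborel. fourier G (0 + - 1 * \<xi>) = complex_of_real (dissipation (0 + - 1 * \<xi>)) * ?\<Psi> (0 + - 1 * \<xi>)"
      by (rule AE_borel_affine[OF _ _ FG]) measurable
    with fourier_cnj[OF Gsq] FG
    show "AE \<xi> in lborel. fourier (\<lambda>x. cnj (G x)) \<xi> = fourier G \<xi>"
      by eventually_elim (simp add: \<Psi>cnj dissipation_even)
  qed
  define g where "g x = Re (G x)" for x
  have Gg: "AE x in lborel. G x = complex_of_real (g x)"
    using real by eventually_elim (simp add: g_def complex_eq_iff)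
  have gsq: "square_integrable (\<lambda>x. complex_of_real (g x))"
    by (rule square_integrable_bound[OF Gsq, where C=1]) (auto simp: g_def abs_Re_le_cmod)
  show ?thesis
  proof (rule that)
    show "square_integrable g" using gsq by simp
    show "AE \<xi> in lborel. fourier (\<lambda>x. complex_of_real (g x)) \<xi> = complex_of_real (dissipation \<xi>) * ?\<Psi> \<xi>"
      using FG fourier_cong_AE[OF Gsq gsq Gg] by simp
    fix c
    let ?c = "\<lambda>x. complex_of_real (c * \<psi> x)"
    have csq: "square_integrable ?c" using square_integrable_cmult[OF \<psi>sq, of "complex_of_real c"] by simp
    have Fc: "AE \<xi> in lborel. fourier ?c \<xi> = complex_of_real c * ?\<Psi> \<xi>"
      using fourier_cmult[OF \<psi>sq, of "complex_of_real c"] F\<psi> by eventually_elim simp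
    have "is_multiplier dissipation ?c (multiplier dissipation ?c)" by (rule M[OF csq Fc])
    then have msq: "square_integrable (multiplier dissipation ?c)"
      and Fm: "AE \<xi> in lborel. fourier (multiplier dissipation ?c) \<xi> = complex_of_real (dissipation \<xi>) * fourier ?c \<xi>"
      unfolding is_multiplier_def by auto
    have "AE x in lborel. multiplier dissipation ?c x = complex_of_real c * G x"
    proof (rule fourier_inj[OF msq square_integrable_cmult[OF Gsq]])
      show "AE \<xi> in lborel. fourier (multiplier dissipation ?c) \<xi> = fourier (\<lambda>x. complex_of_real c * G x) \<xi>"
        using Fm Fc FG fourier_cmult[OF Gsq, of "complex_of_real c"] by eventually_elim simp
    qed
    then show "AE x in lborel. sqrt_laplacian_M (\<lambda>x. c * \<psi> x) x = c * g x"
      unfolding sqrt_laplacian_M_def dissipation_def [abs_def, symmetric]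
      by eventually_elim (simp add: g_def)
  qed
qed

subsection \<open>The equation on the Fourier side\<close>

text \<open>The weak formulation speaks about \<open>u\<close>; the analysis is done on
  \<open>v\<close>, equal to it almost everywhere, whose bounds hold at every time without
  exception. A single \<open>M\<close> bounds both the supremum and the L2 norm, and
  \<open>U\<close> is a jointly measurable transform of \<open>v\<close>.\<close>

locale bounded_solution =
  fixes M :: real and u\<^sub>0 :: "real \<Rightarrow> real" and u v :: "real \<Rightarrow> real \<Rightarrow> real" and U :: "real \<Rightarrow> real \<Rightarrow> complex"
  assumes M: "0 \<le> M"
    and v_meas [measurable]: "case_prod v \<in> borel_measurable (borel \<Otimes>\<^sub>M borel)"
    and v_bound: "\<And>t x. \<bar>v t x\<bar> \<le> M"
    and v_sq: "\<And>t. square_integrable (v t)"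
    and v_norm: "\<And>t. sq_norm (\<lambda>x. complex_of_real (v t x)) \<le> M\<^sup>2"
    and u\<^sub>0: "square_integrable u\<^sub>0"
    and U_meas [measurable]: "case_prod U \<in> borel_measurable (borel \<Otimes>\<^sub>M borel)"
    and U_fourier: "\<And>t. AE \<xi> in lborel. fourier (\<lambda>x. complex_of_real (v t x)) \<xi> = U t \<xi>"
    and U_sq: "\<And>t. square_integrable (U t)"
    and u_meas [measurable]: "case_prod u \<in> borel_measurable (time_measure \<Otimes>\<^sub>M lborel)"
    and u_eq_v: "AE t in time_measure. AE x in lborel. u t x = v t x"
    and weak: "weak_solution u\<^sub>0 u"
begin

text \<open>A genuine Fourier integral, not \<open>fourier\<close>: the square of \<open>v t\<close>
  is integrable, so there is a value at every frequency, joint measurability is immediate, and the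
  modulus is at most M^2.\<close>

definition F :: "real \<Rightarrow> real \<Rightarrow> complex" where
  "F t \<xi> = fourier_integral (\<lambda>x. complex_of_real ((v t x)\<^sup>2)) \<xi>"

definition U\<^sub>0 :: "real \<Rightarrow> complex" where
  "U\<^sub>0 = fourier (\<lambda>x. complex_of_real (u\<^sub>0 x))"

lemma v_measurable [measurable]: "v t \<in> borel_measurable borel"
  using v_sq[of t] by (rule square_integrable_measurable)

lemma U_measurable [measurable]: "U t \<in> borel_measurable borel"
  using U_sq[of t] by (rule square_integrable_measurable)

lemma v_sq': "square_integrable (\<lambda>x. complex_of_real (v t x))"
  using v_sq by simp

lemma v2_integrable: "integrable lborel (\<lambda>x. complex_of_real ((v t x)\<^sup>2))"
proof -
  have "integrable lborel (\<lambda>x. complex_of_real ((norm (v t x))\<^sup>2))"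
    by (rule integrable_of_real[OF square_integrable_integrable[OF v_sq]])
  then show ?thesis by simp
qed

lemma v2_sq: "square_integrable (\<lambda>x. complex_of_real ((v t x)\<^sup>2))"
proof (rule square_integrable_bound[OF v_sq[of t]])
  show "norm (complex_of_real ((v t x)\<^sup>2)) \<le> M * norm (v t x)" for x
    using mult_right_mono[OF v_bound[of t x], of "\<bar>v t x\<bar>"] by (simp add: power2_eq_square abs_mult norm_mult)
qed measurable

lemma F_meas [measurable]: "case_prod F \<in> borel_measurable (borel \<Otimes>\<^sub>M borel)"
proof -
  have "(\<lambda>z. LINT x|lborel. complex_of_real ((v (fst z) x)\<^sup>2) * cis (- (x * snd z))) \<in> borel_measurable (borel \<Otimes>\<^sub>M borel)"
    by (rule lborel.borel_measurable_lebesgue_integral) measurable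
  then show ?thesis unfolding F_def fourier_integral_def by (simp add: case_prod_beta')
qed

lemma F_bound: "cmod (F t \<xi>) \<le> M\<^sup>2"
proof -
  have "cmod (F t \<xi>) \<le> (LINT x|lborel. cmod (complex_of_real ((v t x)\<^sup>2)))"
    unfolding F_def by (rule norm_fourier_integral_le)
  also have "\<dots> = sq_norm (\<lambda>x. complex_of_real (v t x))"
    unfolding sq_norm_def by (simp add: norm_power)
  finally show ?thesis using v_norm[of t] by linarith
qed

lemma F_sq: "square_integrable (F t)"
  unfolding F_def [abs_def] by (rule fourier_integral_bessel[OF v2_integrable v2_sq])

lemma F_measurable [measurable]: "F t \<in> borel_measurable borel"
  using F_sq[of t] by (rule square_integrable_measurable)

lemma F_norm: "sq_norm (F t) \<le> 2 * pi * (M\<^sup>2 * M\<^sup>2)"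
proof -
  have "sq_norm (F t) \<le> 2 * pi * sq_norm (\<lambda>x. complex_of_real ((v t x)\<^sup>2))"
    unfolding F_def [abs_def] by (rule fourier_integral_bessel[OF v2_integrable v2_sq])
  also have "sq_norm (\<lambda>x. complex_of_real ((v t x)\<^sup>2)) \<le> M\<^sup>2 * sq_norm (\<lambda>x. complex_of_real (v t x))"
    unfolding sq_norm_def integral_mult_right_zero[symmetric]
  proof (rule integral_mono)
    show "integrable lborel (\<lambda>x. (cmod (complex_of_real ((v t x)\<^sup>2)))\<^sup>2)"
      using square_integrable_integrable[OF v2_sq[of t]] .
    show "integrable lborel (\<lambda>x. M\<^sup>2 * (cmod (complex_of_real (v t x)))\<^sup>2)"
      using square_integrable_integrable[OF v_sq'[of t]] by simp
    show "(cmod (complex_of_real ((v t x)\<^sup>2)))\<^sup>2 \<le> M\<^sup>2 * (cmod (complex_of_real (v t x)))\<^sup>2" for x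
    proof -
      have "(v t x)\<^sup>2 \<le> M\<^sup>2" using v_bound[of t x] M by (metis abs_ge_zero power2_abs power_mono)
      from mult_right_mono[OF this zero_le_power2, of "v t x"] show ?thesis
        by (simp only: norm_of_real abs_power2 power2_abs power2_eq_square[of "(v t x)\<^sup>2"])
    qed
  qed
  also have "M\<^sup>2 * sq_norm (\<lambda>x. complex_of_real (v t x)) \<le> M\<^sup>2 * M\<^sup>2"
    by (intro mult_left_mono v_norm) simp
  finally show ?thesis by simp
qed

lemma F_fourier: "AE \<xi> in lborel. fourier (\<lambda>x. complex_of_real ((v t x)\<^sup>2)) \<xi> = F t \<xi>"
  unfolding F_def by (rule fourier_eq_fourier_integral[OF v2_sq v2_integrable])

lemma U_norm: "sq_norm (U t) \<le> 2 * pi * M\<^sup>2"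
proof -
  have "sq_norm (U t) = sq_norm (fourier (\<lambda>x. complex_of_real (v t x)))"
    using U_fourier[of t] square_integrable_measurable[OF square_integrable_fourier[OF v_sq'[of t]]]
    by (intro sq_norm_cong_AE) auto
  then show ?thesis using plancherel[OF v_sq'[of t]] v_norm[of t] by simp
qed

lemma U\<^sub>0_sq: "square_integrable U\<^sub>0"
  unfolding U\<^sub>0_def using u\<^sub>0 by (intro square_integrable_fourier) simp

lemma U\<^sub>0_measurable [measurable]: "U\<^sub>0 \<in> borel_measurable borel"
  using U\<^sub>0_sq by (rule square_integrable_measurable)

text \<open>At a fixed frequency, \<open>F\<close> is the pairing of \<open>v\<close> with a
  modulated copy of itself; Parseval turns the modulation into a shift. The bound holds at every
  \<xi>, as the convolution estimate demands.\<close>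

lemma F_convolution:
  "ennreal (cmod (F t \<xi>)) \<le> (\<integral>\<^sup>+\<eta>. ennreal (cmod (U t \<eta>) * cmod (U t (\<xi> - \<eta>))) \<partial>lborel)"
proof -
  let ?v = "\<lambda>x. complex_of_real (v t x)"
  let ?g = "\<lambda>x. cis (x * \<xi>) * ?v x"
  note Fv = square_integrable_fourier[OF v_sq'[of t]]
  note [measurable] = square_integrable_measurable[OF Fv]
  have g: "square_integrable ?g"
    by (rule square_integrable_mult_bounded[OF v_sq', where C=1]) auto
  have e1: "AE \<eta> in lborel. fourier ?v (\<xi> + - 1 * \<eta>) = U t (\<xi> + - 1 * \<eta>)"
    by (rule AE_borel_affine[OF _ _ U_fourier]) measurable
  \<comment> \<open>As \<open>v\<close> is real, its transform has the same modulus at \<eta> -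
    \<xi> and \<xi> - \<eta>, which brings the shifted factor into convolution form.\<close>
  have "AE \<eta> in lborel. fourier ?v \<eta> = cnj (fourier ?v (- \<eta>))"
    using fourier_cnj[OF v_sq'[of t]] by simp
  then have e2: "AE \<eta> in lborel. fourier ?v (\<xi> + - 1 * \<eta>) = cnj (fourier ?v (- (\<xi> + - 1 * \<eta>)))"
    by (intro AE_borel_affine[where c="-1" and P="\<lambda>\<eta>. fourier ?v \<eta> = cnj (fourier ?v (- \<eta>))"]) measurable
  have "2 * pi * F t \<xi> = 2 * pi * L2_pairing ?v (\<lambda>x. cnj (?g x))"
    unfolding F_def fourier_integral_def L2_pairing_def
    by (simp add: cis_cnj power2_eq_square mult_ac)
  also have "\<dots> = L2_pairing (fourier ?v) (\<lambda>\<eta>. cnj (fourier ?g \<eta>))"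
    by (rule parseval[OF v_sq' g, symmetric])
  finally have "ennreal (cmod (2 * pi * F t \<xi>)) \<le> (\<integral>\<^sup>+\<eta>. ennreal (cmod (fourier ?v \<eta> * cnj (fourier ?g \<eta>))) \<partial>lborel)"
    unfolding L2_pairing_def by (simp only: integral_norm_bound_ennreal')
  also have "\<dots> = (\<integral>\<^sup>+\<eta>. ennreal (cmod (U t \<eta>) * cmod (U t (\<xi> - \<eta>))) \<partial>lborel)"
  proof (rule nn_integral_cong_AE)
    show "AE \<eta> in lborel. ennreal (cmod (fourier ?v \<eta> * cnj (fourier ?g \<eta>))) = ennreal (cmod (U t \<eta>) * cmod (U t (\<xi> - \<eta>)))"
      using U_fourier[of t] e1 e2 fourier_modulate[OF v_sq'[of t], of \<xi>]
    proof eventually_elim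
      case (elim \<eta>)
      have "cmod (fourier ?v (\<eta> - \<xi>)) = cmod (fourier ?v (\<xi> - \<eta>))" using elim(3) by simp
      then show ?case using elim by (simp add: norm_mult)
    qed
  qed
  finally have *: "ennreal (cmod (2 * pi * F t \<xi>)) \<le> (\<integral>\<^sup>+\<eta>. ennreal (cmod (U t \<eta>) * cmod (U t (\<xi> - \<eta>))) \<partial>lborel)" .
  \<comment> \<open>The factor 1 / (2 pi) from Parseval is at most 1 and is discarded.\<close>
  have "1 * cmod (F t \<xi>) \<le> 2 * pi * cmod (F t \<xi>)"
    using pi_gt3 by (intro mult_right_mono) auto
  then have "ennreal (cmod (F t \<xi>)) \<le> ennreal (cmod (2 * pi * F t \<xi>))"
    by (intro ennreal_leI) (simp add: norm_mult)
  then show ?thesis using * by (rule order_trans)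
qed

text \<open>The time derivative of \<open>U\<close> at frequency \<xi> that the equation prescribes:
  nonlinearity minus dissipation.\<close>

definition h :: "real \<Rightarrow> real \<Rightarrow> complex" where
  "h t \<xi> = \<i> * \<xi> / 2 * F t \<xi> - complex_of_real (dissipation \<xi>) * U t \<xi>"

lemma h_meas [measurable]: "case_prod h \<in> borel_measurable (borel \<Otimes>\<^sub>M borel)"
proof -
  have "(\<lambda>z. \<i> * complex_of_real (snd z) / 2 * F (fst z) (snd z) - complex_of_real (dissipation (snd z)) * U (fst z) (snd z))
    \<in> borel_measurable (borel \<Otimes>\<^sub>M borel)" by measurable
  then show ?thesis unfolding h_def by (simp add: case_prod_beta')
qed

text \<open>The weak form for product test functions, with each of its spatial pairings moved to
  frequency by Parseval. The factor 2 pi is common to all terms, and the conjugate falls on the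
  transform of the test function.\<close>

lemma weak_fourier:
  assumes \<theta>: "\<And>k. Ck k \<theta>" "\<And>t. (\<theta> has_real_derivative \<theta>' t) (at t)" "\<And>t. T \<le> t \<Longrightarrow> \<theta> t = 0"
    and \<psi>: "\<And>k. Ck k \<psi>" "supported_in R \<psi>"
  defines "\<Psi> \<equiv> fourier_integral (\<lambda>x. complex_of_real (\<psi> x))"
  shows "(LINT t|lborel. indicator {0<..} t *
      (LINT \<xi>|lborel. cnj (\<Psi> \<xi>) * (complex_of_real (\<theta>' t) * U t \<xi> + complex_of_real (\<theta> t) * h t \<xi>))) +
    complex_of_real (\<theta> 0) * (LINT \<xi>|lborel. cnj (\<Psi> \<xi>) * U\<^sub>0 \<xi>) = 0"
proof -
  let ?\<psi> = "\<lambda>x. complex_of_real (\<psi> x)"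
  note cs = continuous_supported[OF Ck_continuous[OF \<psi>(1)[of 0]] \<psi>(2)]
  have \<psi>sq: "square_integrable ?\<psi>" and \<psi>i: "integrable lborel ?\<psi>" using cs by simp_all
  have F\<psi>: "AE \<xi> in lborel. fourier ?\<psi> \<xi> = \<Psi> \<xi>"
    unfolding \<Psi>_def by (rule fourier_eq_fourier_integral[OF \<psi>sq \<psi>i])
  have \<Psi>sq: "square_integrable \<Psi>" unfolding \<Psi>_def by (rule fourier_integral_bessel[OF \<psi>i \<psi>sq])
  note [measurable] = square_integrable_measurable[OF \<Psi>sq]
  obtain \<psi>' where \<psi>': "\<And>x. (\<psi> has_real_derivative \<psi>' x) (at x)" "continuous_on UNIV \<psi>'"
    using \<psi>(1)[of "Suc 0"] by auto
  have \<psi>'s: "supported_in (R + 1) \<psi>'" by (rule supported_in_deriv[OF \<psi>(2) \<psi>'(1)])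
  note cs' = continuous_supported[OF \<psi>'(2) \<psi>'s]
  let ?\<psi>' = "\<lambda>x. complex_of_real (\<psi>' x)"
  have \<psi>'sq: "square_integrable ?\<psi>'" and \<psi>'i: "integrable lborel ?\<psi>'" using cs' by simp_all
  have F\<psi>': "AE \<xi> in lborel. fourier ?\<psi>' \<xi> = \<i> * \<xi> * \<Psi> \<xi>"
    using fourier_eq_fourier_integral[OF \<psi>'sq \<psi>'i] unfolding fourier_integral_deriv[OF \<psi>' \<psi>(2)] \<Psi>_def .
  obtain g where g: "square_integrable g"
    and Fg: "AE \<xi> in lborel. fourier (\<lambda>x. complex_of_real (g x)) \<xi> = complex_of_real (dissipation \<xi>) * \<Psi> \<xi>"
    and gM: "\<And>c. AE x in lborel. sqrt_laplacian_M (\<lambda>x. c * \<psi> x) x = c * g x"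
    by (rule sqrt_laplacian_M_test_function[OF \<psi>, folded \<Psi>_def]) (rule that, assumption+)
  have gsq: "square_integrable (\<lambda>x. complex_of_real (g x))" using g by simp
  have pair: "2 * pi * complex_of_real (LINT x|lborel. p x * q x) = (LINT \<xi>|lborel. P \<xi> * cnj (Q \<xi>))"
    if p: "square_integrable (\<lambda>x. complex_of_real (p x))" and q: "square_integrable (\<lambda>x. complex_of_real (q x))"
      and P: "AE \<xi> in lborel. fourier (\<lambda>x. complex_of_real (p x)) \<xi> = P \<xi>"
      and Q: "AE \<xi> in lborel. fourier (\<lambda>x. complex_of_real (q x)) \<xi> = Q \<xi>"
      and [measurable]: "P \<in> borel_measurable borel" "Q \<in> borel_measurable borel" for p q P Q
  proof -
    note [measurable] = square_integrable_measurable[OF square_integrable_fourier[OF p]]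
      square_integrable_measurable[OF square_integrable_fourier[OF q]]
    have "complex_of_real (LINT x|lborel. p x * q x) = L2_pairing (\<lambda>x. complex_of_real (p x)) (\<lambda>x. cnj (complex_of_real (q x)))"
      unfolding L2_pairing_def by (simp flip: of_real_mult)
    then have "2 * pi * complex_of_real (LINT x|lborel. p x * q x) =
        L2_pairing (fourier (\<lambda>x. complex_of_real (p x))) (\<lambda>\<xi>. cnj (fourier (\<lambda>x. complex_of_real (q x)) \<xi>))"
      using parseval[OF p q] by simp
    also have "\<dots> = L2_pairing P (\<lambda>\<xi>. cnj (Q \<xi>))"
      by (rule L2_pairing_cong_AE) (use P Q in \<open>auto elim: eventually_mono\<close>)
    finally show ?thesis unfolding L2_pairing_def .
  qed
  have real_int: "integrable lborel (\<lambda>x. p x * q x)"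
    if "square_integrable (\<lambda>x. complex_of_real (p x))" "square_integrable (\<lambda>x. complex_of_real (q x))" for p q :: "real \<Rightarrow> real"
    using integrable_Re[OF integrable_mult_square_integrable[OF that]] by simp
  have \<xi>\<Psi>m: "(\<lambda>\<xi>. \<i> * complex_of_real \<xi> * \<Psi> \<xi>) \<in> borel_measurable borel"
    "(\<lambda>\<xi>. complex_of_real (dissipation \<xi>) * \<Psi> \<xi>) \<in> borel_measurable borel" by measurable
  have \<xi>\<Psi>sq: "square_integrable (\<lambda>\<xi>. \<i> * complex_of_real \<xi> * \<Psi> \<xi>)"
    unfolding \<Psi>_def fourier_integral_deriv[OF \<psi>' \<psi>(2), symmetric] by (rule fourier_integral_bessel[OF \<psi>'i \<psi>'sq])
  have L\<Psi>sq: "square_integrable (\<lambda>\<xi>. complex_of_real (dissipation \<xi>) * \<Psi> \<xi>)"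
  proof -
    have "square_integrable (fourier (\<lambda>x. complex_of_real (g x)))" by (rule square_integrable_fourier[OF gsq])
    moreover have "(\<integral>\<^sup>+\<xi>. ennreal ((cmod (complex_of_real (dissipation \<xi>) * \<Psi> \<xi>))\<^sup>2) \<partial>lborel) =
        (\<integral>\<^sup>+\<xi>. ennreal ((cmod (fourier (\<lambda>x. complex_of_real (g x)) \<xi>))\<^sup>2) \<partial>lborel)"
      by (intro nn_integral_cong_AE) (use Fg in eventually_elim, simp)
    ultimately show ?thesis
      by (intro square_integrableI) (use square_integrable_nn \<xi>\<Psi>m in auto)
  qed
  let ?in = "\<lambda>w t. LINT x|lborel. w t x * vector_derivative (\<lambda>s. \<theta> s * \<psi> x) (at t within {0..})
         - w t x * sqrt_laplacian_M (\<lambda>x. \<theta> t * \<psi> x) x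
         - (w t x)\<^sup>2 / 2 * vector_derivative (\<lambda>x. \<theta> t * \<psi> x) (at x)"
  let ?J = "\<lambda>w t. LINT x|lborel. w t x * (\<theta>' t * \<psi> x) - w t x * (\<theta> t * g x) - (w t x)\<^sup>2 / 2 * (\<theta> t * \<psi>' x)"
  let ?out = "\<lambda>t. LINT \<xi>|lborel. cnj (\<Psi> \<xi>) * (complex_of_real (\<theta>' t) * U t \<xi> + complex_of_real (\<theta> t) * h t \<xi>)"
  have gm[measurable]: "g \<in> borel_measurable borel" by (rule square_integrable_measurable[OF g])
  note [measurable] = cs(1) cs'(1)
  \<comment> \<open>The inner integral contains a one-sided derivative, harmless at t > 0, and a
    representative of the operator chosen separately at each time. Both are replaced by explicit
    expressions, the latter through the single function \<open>g\<close>.\<close>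
  have in_J: "?in w t = ?J w t" if t: "0 < t" and [measurable]: "w t \<in> borel_measurable borel" for w t
  proof -
    have d1: "vector_derivative (\<lambda>s. \<theta> s * \<psi> x) (at t within {0..}) = \<theta>' t * \<psi> x" for x
    proof -
      have "((\<lambda>s. \<theta> s * \<psi> x) has_vector_derivative \<theta>' t * \<psi> x) (at t)"
        using DERIV_cmult_right[OF \<theta>(2)] by (simp flip: has_real_derivative_iff_has_vector_derivative)
      moreover have "at t within {0..} = at t" by (rule at_within_interior) (use t in \<open>simp add: interior_real_atLeast\<close>)
      ultimately show ?thesis by (simp add: vector_derivative_at)
    qed
    have d2: "vector_derivative (\<lambda>x. \<theta> t * \<psi> x) (at x) = \<theta> t * \<psi>' x" for x
      using DERIV_cmult[OF \<psi>'(1)] by (intro vector_derivative_at) (simp flip: has_real_derivative_iff_has_vector_derivative)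
    let ?m = "multiplier dissipation (\<lambda>x. complex_of_real (\<theta> t * \<psi> x))"
    have "is_multiplier dissipation (\<lambda>x. complex_of_real (\<theta> t * \<psi> x)) ?m"
    proof (rule multiplier_exists)
      show csq: "square_integrable (\<lambda>x. complex_of_real (\<theta> t * \<psi> x))"
        using square_integrable_cmult[OF \<psi>sq, of "complex_of_real (\<theta> t)"] by simp
      have "(\<integral>\<^sup>+\<xi>. ennreal ((dissipation \<xi>)\<^sup>2 * (cmod (fourier (\<lambda>x. complex_of_real (\<theta> t * \<psi> x)) \<xi>))\<^sup>2) \<partial>lborel) =
         (\<integral>\<^sup>+\<xi>. ennreal ((cmod (complex_of_real (\<theta> t) * (complex_of_real (dissipation \<xi>) * \<Psi> \<xi>)))\<^sup>2) \<partial>lborel)"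
      proof (intro nn_integral_cong_AE)
        show "AE \<xi> in lborel. ennreal ((dissipation \<xi>)\<^sup>2 * (cmod (fourier (\<lambda>x. complex_of_real (\<theta> t * \<psi> x)) \<xi>))\<^sup>2) =
           ennreal ((cmod (complex_of_real (\<theta> t) * (complex_of_real (dissipation \<xi>) * \<Psi> \<xi>)))\<^sup>2)"
          using fourier_cmult[OF \<psi>sq, of "complex_of_real (\<theta> t)"] F\<psi>
          by eventually_elim (simp add: norm_mult power_mult_distrib mult_ac)
      qed
      also have "\<dots> < \<infinity>" using square_integrable_nn[OF square_integrable_cmult[OF L\<Psi>sq]] by simp
      finally show "(\<integral>\<^sup>+\<xi>. ennreal ((dissipation \<xi>)\<^sup>2 * (cmod (fourier (\<lambda>x. complex_of_real (\<theta> t * \<psi> x)) \<xi>))\<^sup>2) \<partial>lborel) < \<infinity>" .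
    qed measurable
    then have "square_integrable ?m" unfolding is_multiplier_def by simp
    note [measurable] = square_integrable_measurable[OF this]
    have [measurable]: "sqrt_laplacian_M (\<lambda>x. \<theta> t * \<psi> x) \<in> borel_measurable borel"
      unfolding sqrt_laplacian_M_def [abs_def] dissipation_def [abs_def, symmetric] by measurable
    show ?thesis
      unfolding d1 d2
    proof (rule integral_cong_AE)
      show "AE x in lborel. w t x * (\<theta>' t * \<psi> x) - w t x * sqrt_laplacian_M (\<lambda>x. \<theta> t * \<psi> x) x - (w t x)\<^sup>2 / 2 * (\<theta> t * \<psi>' x) =
         w t x * (\<theta>' t * \<psi> x) - w t x * (\<theta> t * g x) - (w t x)\<^sup>2 / 2 * (\<theta> t * \<psi>' x)"
        using gM[of "\<theta> t"] by eventually_elim simp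
    qed measurable
  qed
  have inner: "2 * pi * complex_of_real (?in v t) = ?out t" if t: "0 < t" for t
  proof -
    have i1: "integrable lborel (\<lambda>x. v t x * \<psi> x)" by (rule real_int[OF v_sq' \<psi>sq])
    have i2: "integrable lborel (\<lambda>x. v t x * g x)" by (rule real_int[OF v_sq' gsq])
    have i3: "integrable lborel (\<lambda>x. (v t x)\<^sup>2 * \<psi>' x)" by (rule real_int[OF v2_sq \<psi>'sq])
    have in_eq: "?in v t = \<theta>' t * (LINT x|lborel. v t x * \<psi> x) - \<theta> t * (LINT x|lborel. v t x * g x)
        - \<theta> t / 2 * (LINT x|lborel. (v t x)\<^sup>2 * \<psi>' x)"
    proof -
      have "?in v t = ?J v t" by (rule in_J[OF t]) measurable
      also have "\<dots> = (LINT x|lborel. \<theta>' t * (v t x * \<psi> x) - \<theta> t * (v t x * g x) - \<theta> t / 2 * ((v t x)\<^sup>2 * \<psi>' x))"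
        by (intro Bochner_Integration.integral_cong refl) (simp add: algebra_simps)
      finally show ?thesis using i1 i2 i3 by simp
    qed
    have p1: "2 * pi * complex_of_real (LINT x|lborel. v t x * \<psi> x) = (LINT \<xi>|lborel. U t \<xi> * cnj (\<Psi> \<xi>))"
      by (rule pair[OF v_sq' \<psi>sq U_fourier F\<psi>]) measurable
    have p2: "2 * pi * complex_of_real (LINT x|lborel. v t x * g x) = (LINT \<xi>|lborel. U t \<xi> * cnj (complex_of_real (dissipation \<xi>) * \<Psi> \<xi>))"
      by (rule pair[OF v_sq' gsq U_fourier Fg]) measurable
    have p3: "2 * pi * complex_of_real (LINT x|lborel. (v t x)\<^sup>2 * \<psi>' x) = (LINT \<xi>|lborel. F t \<xi> * cnj (\<i> * \<xi> * \<Psi> \<xi>))"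
      by (rule pair[OF v2_sq \<psi>'sq F_fourier F\<psi>']) measurable
    note j1 = integrable_mult_square_integrable[OF U_sq square_integrable_cnj[OF \<Psi>sq], of t]
    note j2 = integrable_mult_square_integrable[OF U_sq square_integrable_cnj[OF L\<Psi>sq], of t]
    note j3 = integrable_mult_square_integrable[OF F_sq square_integrable_cnj[OF \<xi>\<Psi>sq], of t]
    have "2 * pi * complex_of_real (?in v t) = complex_of_real (\<theta>' t) * (2 * pi * complex_of_real (LINT x|lborel. v t x * \<psi> x))
        - complex_of_real (\<theta> t) * (2 * pi * complex_of_real (LINT x|lborel. v t x * g x))
        - complex_of_real (\<theta> t) / 2 * (2 * pi * complex_of_real (LINT x|lborel. (v t x)\<^sup>2 * \<psi>' x))"
      unfolding in_eq by (simp add: algebra_simps)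
    also have "\<dots> = (LINT \<xi>|lborel. complex_of_real (\<theta>' t) * (U t \<xi> * cnj (\<Psi> \<xi>))
        - complex_of_real (\<theta> t) * (U t \<xi> * cnj (complex_of_real (dissipation \<xi>) * \<Psi> \<xi>))
        - complex_of_real (\<theta> t) / 2 * (F t \<xi> * cnj (\<i> * \<xi> * \<Psi> \<xi>)))"
      unfolding p1 p2 p3 using j1 j2 j3 by simp
    also have "\<dots> = ?out t"
      by (intro Bochner_Integration.integral_cong refl) (simp add: h_def algebra_simps)
    finally show ?thesis .
  qed
  obtain \<theta>d where \<theta>d: "\<And>t. (\<theta> has_real_derivative \<theta>d t) (at t)" "continuous_on UNIV \<theta>d"
    using \<theta>(1)[of "Suc 0"] by auto
  then have "\<theta>' = \<theta>d" using \<theta>(2) DERIV_unique by blast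
  then have [measurable]: "\<theta>' \<in> borel_measurable borel" "\<theta> \<in> borel_measurable borel"
    using \<theta>d(2) Ck_continuous[OF \<theta>(1)[of 0]] by (auto intro: borel_measurable_continuous_onI)
  \<comment> \<open>Measurability in time is visible for \<open>?J\<close>, while \<open>?in\<close>
    still contains the choices made time by time. This is the reason for the detour through
    \<open>?J\<close> when \<open>u\<close> is exchanged for \<open>v\<close>.\<close>
  have J_meas: "?J w \<in> borel_measurable time_measure"
    if "case_prod w \<in> borel_measurable (time_measure \<Otimes>\<^sub>M lborel)" for w :: "real \<Rightarrow> real \<Rightarrow> real"
  proof -
    have id: "(\<lambda>t. t) \<in> measurable time_measure borel"
      unfolding time_measure_def by (rule measurable_restrict_space1) simp
    note [measurable] = that measurable_compose[OF id \<open>\<theta>' \<in> _\<close>] measurable_compose[OF id \<open>\<theta> \<in> _\<close>]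
    show ?thesis by (rule lborel.borel_measurable_lebesgue_integral) measurable
  qed
  have vm: "case_prod v \<in> borel_measurable (time_measure \<Otimes>\<^sub>M lborel)"
  proof -
    have "(\<lambda>z. (fst z, snd z)) \<in> measurable (time_measure \<Otimes>\<^sub>M lborel) (borel \<Otimes>\<^sub>M borel)"
    proof (rule measurable_Pair)
      have "(\<lambda>t. t) \<in> measurable time_measure borel"
        unfolding time_measure_def by (rule measurable_restrict_space1) simp
      from measurable_compose[OF measurable_fst this]
      show "fst \<in> measurable (time_measure \<Otimes>\<^sub>M lborel) borel" .
      show "snd \<in> measurable (time_measure \<Otimes>\<^sub>M lborel) borel" by simp
    qed
    from measurable_compose[OF this v_meas] show ?thesis by simp
  qed
  have in_uv: "(LINT t|time_measure. ?in u t) = (LINT t|time_measure. ?in v t)"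
  proof -
    have ut: "u t \<in> borel_measurable borel" if "0 < t" for t
      using measurable_compose[OF measurable_Pair1' u_meas, of t] that by simp
    have "(LINT t|time_measure. ?in u t) = (LINT t|time_measure. ?J u t)"
      by (intro Bochner_Integration.integral_cong refl in_J ut) simp_all
    also have "\<dots> = (LINT t|time_measure. ?J v t)"
    proof (rule integral_cong_AE[OF J_meas[OF u_meas] J_meas[OF vm]])
      have "AE t in time_measure. 0 < t" by (rule AE_I2) simp
      with u_eq_v show "AE t in time_measure. ?J u t = ?J v t"
      proof eventually_elim
        case (elim t)
        note [measurable] = ut[OF elim(2)]
        show ?case by (rule integral_cong_AE) (use elim(1) in \<open>auto elim: eventually_mono\<close>)
      qed
    qed
    also have "\<dots> = (LINT t|time_measure. ?in v t)"
      by (intro Bochner_Integration.integral_cong refl in_J[symmetric] v_measurable) simp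
    finally show ?thesis .
  qed
  have w: "(LINT t|time_measure. ?in v t) + (LINT x|lborel. u\<^sub>0 x * (\<theta> 0 * \<psi> x)) = 0"
    using weak test_function_product[OF \<theta>(1) \<psi>(1) \<theta>(3) \<psi>(2)] unfolding weak_solution_def in_uv[symmetric] by blast
  have "(LINT t|time_measure. ?in v t) = (LINT t|lborel. indicator {0<..} t * ?in v t)"
    unfolding time_measure_def by (subst integral_restrict_space) auto
  moreover have "(LINT x|lborel. u\<^sub>0 x * (\<theta> 0 * \<psi> x)) = \<theta> 0 * (LINT x|lborel. u\<^sub>0 x * \<psi> x)"
    by (subst integral_mult_right_zero[symmetric]) (simp add: mult_ac)
  ultimately have "2 * pi * complex_of_real ((LINT t|lborel. indicator {0<..} t * ?in v t) + \<theta> 0 * (LINT x|lborel. u\<^sub>0 x * \<psi> x)) = 0"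
    using w by simp
  then have "2 * pi * complex_of_real (LINT t|lborel. indicator {0<..} t * ?in v t) +
      complex_of_real (\<theta> 0) * (2 * pi * complex_of_real (LINT x|lborel. u\<^sub>0 x * \<psi> x)) = 0"
    by (simp only: of_real_add of_real_mult distrib_left mult.left_commute mult.assoc)
  moreover have "2 * pi * complex_of_real (LINT t|lborel. indicator {0<..} t * ?in v t) = (LINT t|lborel. indicator {0<..} t * ?out t)"
  proof -
    have "2 * pi * complex_of_real (LINT t|lborel. indicator {0<..} t * ?in v t) =
        (LINT t|lborel. 2 * pi * complex_of_real (indicator {0<..} t * ?in v t))"
      by (simp only: integral_complex_of_real integral_mult_right_zero)
    also have "\<dots> = (LINT t|lborel. indicator {0<..} t * ?out t)"
    proof (intro Bochner_Integration.integral_cong refl)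
      fix t :: real
      have "2 * pi * complex_of_real (indicator {0<..} t * p) = indicator {0<..} t * q"
        if "0 < t \<Longrightarrow> 2 * pi * complex_of_real p = q" for p q
        using that by (cases "0 < t") simp_all
      then show "2 * pi * complex_of_real (indicator {0<..} t * ?in v t) = indicator {0<..} t * ?out t"
        using inner by blast
    qed
    finally show ?thesis .
  qed
  moreover have "2 * pi * complex_of_real (LINT x|lborel. u\<^sub>0 x * \<psi> x) = (LINT \<xi>|lborel. U\<^sub>0 \<xi> * cnj (\<Psi> \<xi>))"
    by (rule pair[OF _ \<psi>sq _ F\<psi> U\<^sub>0_measurable square_integrable_measurable[OF \<Psi>sq]])
       (use u\<^sub>0 in \<open>simp_all add: U\<^sub>0_def\<close>)
  ultimately show ?thesis by (simp add: mult.commute)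
qed

end

context bounded_solution
begin

definition energy_bound :: real where
  "energy_bound = 2 * pi * M\<^sup>2 + 2 * pi * (M\<^sup>2 * M\<^sup>2)"

lemma nn_integral_U_le: "(\<integral>\<^sup>+\<xi>. ennreal ((cmod (U t \<xi>))\<^sup>2) \<partial>lborel) \<le> ennreal (2 * pi * M\<^sup>2)"
  unfolding square_integrable_nn[OF U_sq] using U_norm by (rule ennreal_leI)

lemma nn_integral_F_le: "(\<integral>\<^sup>+\<xi>. ennreal ((cmod (F t \<xi>))\<^sup>2) \<partial>lborel) \<le> ennreal (2 * pi * (M\<^sup>2 * M\<^sup>2))"
  unfolding square_integrable_nn[OF F_sq] using F_norm by (rule ennreal_leI)

lemma nn_integral_energy_le:
  "(\<integral>\<^sup>+\<xi>. ennreal ((cmod (U t \<xi>))\<^sup>2 + (cmod (F t \<xi>))\<^sup>2) \<partial>lborel) \<le> ennreal energy_bound"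
proof -
  have "(\<integral>\<^sup>+\<xi>. ennreal ((cmod (U t \<xi>))\<^sup>2 + (cmod (F t \<xi>))\<^sup>2) \<partial>lborel) =
      (\<integral>\<^sup>+\<xi>. ennreal ((cmod (U t \<xi>))\<^sup>2) \<partial>lborel) + (\<integral>\<^sup>+\<xi>. ennreal ((cmod (F t \<xi>))\<^sup>2) \<partial>lborel)"
    by (simp add: nn_integral_add)
  also have "\<dots> \<le> ennreal (2 * pi * M\<^sup>2) + ennreal (2 * pi * (M\<^sup>2 * M\<^sup>2))"
    by (intro add_mono nn_integral_U_le nn_integral_F_le)
  also have "\<dots> = ennreal energy_bound"
    unfolding energy_bound_def by (simp add: ennreal_plus)
  finally show ?thesis .
qed

lemma norm_h_le: "cmod (h t \<xi>) \<le> (weight \<xi>)\<^sup>2 * (cmod (U t \<xi>) + cmod (F t \<xi>))"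
proof -
  have w: "\<bar>\<xi>\<bar> / 2 \<le> (weight \<xi>)\<^sup>2"
    using power_increasing[OF _ weight_ge_1, of 1 2 \<xi>] by (simp add: weight_def)
  have "cmod (h t \<xi>) \<le> cmod (\<i> * \<xi> / 2 * F t \<xi>) + cmod (complex_of_real (dissipation \<xi>) * U t \<xi>)"
    unfolding h_def by (rule norm_triangle_ineq4)
  also have "\<dots> = \<bar>\<xi>\<bar> / 2 * cmod (F t \<xi>) + dissipation \<xi> * cmod (U t \<xi>)"
    using dissipation_nonneg[of \<xi>] by (simp add: norm_mult norm_divide)
  also have "\<dots> \<le> (weight \<xi>)\<^sup>2 * cmod (F t \<xi>) + (weight \<xi>)\<^sup>2 * cmod (U t \<xi>)"
    by (intro add_mono mult_right_mono w dissipation_le) auto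
  finally show ?thesis by (simp add: algebra_simps)
qed

text \<open>Pairing with all translates of one bump determines the transform wherever the
  transform of the bump does not vanish; shrinking the bump exhausts the line.\<close>

lemma weak_equation_at_frequency:
  assumes \<theta>: "\<And>k. Ck k \<theta>" "\<And>t. (\<theta> has_real_derivative \<theta>' t) (at t)" "\<And>t. T \<le> t \<Longrightarrow> \<theta> t = 0"
    and \<theta>': "continuous_on UNIV \<theta>'" "\<And>t. T \<le> t \<Longrightarrow> \<theta>' t = 0"
  shows "AE \<xi> in lborel. (LINT t|lborel. indicator {0<..} t *
      (complex_of_real (\<theta>' t) * U t \<xi> + complex_of_real (\<theta> t) * h t \<xi>)) + complex_of_real (\<theta> 0) * U\<^sub>0 \<xi> = 0"
proof -
  have \<theta>c: "continuous_on UNIV \<theta>" by (rule Ck_continuous[OF \<theta>(1)[of 0]])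
  have [measurable]: "\<theta> \<in> borel_measurable borel" "\<theta>' \<in> borel_measurable borel"
    using \<theta>c \<theta>'(1) by (auto intro: borel_measurable_continuous_onI)
  have "\<exists>B. \<forall>t>0. \<bar>f t\<bar> \<le> B" if f: "continuous_on UNIV f" "\<And>t. T \<le> t \<Longrightarrow> f t = 0" for f :: "real \<Rightarrow> real"
  proof -
    have "compact (f ` {0..T})"
      by (intro compact_continuous_image continuous_on_subset[OF f(1)]) auto
    then obtain B where B: "\<And>x. x \<in> {0..T} \<Longrightarrow> \<bar>f x\<bar> \<le> B"
      using compact_imp_bounded bounded_iff by (metis imageI real_norm_def)
    have "\<bar>f t\<bar> \<le> \<bar>B\<bar>" if "0 < t" for t
      using B[of t] f(2)[of t] that by (cases "t \<le> T") fastforce+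
    then show ?thesis by blast
  qed
  from this[OF \<theta>c \<theta>(3)] this[OF \<theta>'] obtain B1 B2 where
    B12: "\<And>t. 0 < t \<Longrightarrow> \<bar>\<theta> t\<bar> \<le> B1" "\<And>t. 0 < t \<Longrightarrow> \<bar>\<theta>' t\<bar> \<le> B2" by blast
  define B where "B = \<bar>B1\<bar> + \<bar>B2\<bar>"
  have B: "\<bar>\<theta> t\<bar> \<le> B" "\<bar>\<theta>' t\<bar> \<le> B" if "0 < t" for t
    using B12[OF that] unfolding B_def by linarith+
  have B0: "0 \<le> B" unfolding B_def by simp
  define K where "K t \<xi> = indicator {0<..} t * (complex_of_real (\<theta>' t) * U t \<xi> + complex_of_real (\<theta> t) * h t \<xi>)" for t \<xi>
  have Km[measurable]: "case_prod K \<in> borel_measurable (borel \<Otimes>\<^sub>M borel)"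
  proof -
    have "(\<lambda>z. indicator {0<..} (fst z) * (complex_of_real (\<theta>' (fst z)) * U (fst z) (snd z) + complex_of_real (\<theta> (fst z)) * h (fst z) (snd z)))
      \<in> borel_measurable (borel \<Otimes>\<^sub>M borel)" by measurable
    then show ?thesis unfolding K_def by (simp add: case_prod_beta')
  qed
  have Kb: "cmod (K t \<xi>) \<le> indicator {0<..T} t * (2 * B * ((weight \<xi>)\<^sup>2 * (cmod (U t \<xi>) + cmod (F t \<xi>))))" for t \<xi>
  proof (cases "0 < t \<and> t \<le> T")
    case True
    have w1: "1 \<le> (weight \<xi>)\<^sup>2" using weight_ge_1[of \<xi>] by (rule one_le_power)
    have "cmod (K t \<xi>) \<le> \<bar>\<theta>' t\<bar> * cmod (U t \<xi>) + \<bar>\<theta> t\<bar> * cmod (h t \<xi>)"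
      using True norm_triangle_ineq[of "complex_of_real (\<theta>' t) * U t \<xi>" "complex_of_real (\<theta> t) * h t \<xi>"]
      by (simp add: K_def norm_mult)
    also have "\<dots> \<le> B * (1 * (cmod (U t \<xi>) + cmod (F t \<xi>))) + B * ((weight \<xi>)\<^sup>2 * (cmod (U t \<xi>) + cmod (F t \<xi>)))"
      using B[of t] True norm_h_le[of t \<xi>] B0 by (intro add_mono mult_mono) auto
    also have "\<dots> \<le> B * ((weight \<xi>)\<^sup>2 * (cmod (U t \<xi>) + cmod (F t \<xi>))) + B * ((weight \<xi>)\<^sup>2 * (cmod (U t \<xi>) + cmod (F t \<xi>)))"
      using w1 B0 by (intro add_right_mono mult_left_mono mult_right_mono) auto
    finally show ?thesis using True by simp
  next
    case False
    then have "K t \<xi> = 0" using \<theta>(3)[of t] \<theta>'(2)[of t] by (auto simp: K_def indicator_def)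
    then show ?thesis using B0 by simp
  qed
  define H where "H \<xi> = (LINT t|lborel. K t \<xi>)" for \<xi>
  \<comment> \<open>The first part is what makes the product with the transform of a bump an L1
    function, so that the uniqueness theorem for L1 transforms applies to it.\<close>
  have pairing: "integrable lborel (\<lambda>\<xi>. cnj (\<Psi> \<xi>) * (H \<xi> + complex_of_real (\<theta> 0) * U\<^sub>0 \<xi>))"
      "(LINT \<xi>|lborel. cnj (\<Psi> \<xi>) * (H \<xi> + complex_of_real (\<theta> 0) * U\<^sub>0 \<xi>)) = 0"
    if \<psi>: "\<And>k. Ck k \<psi>" "supported_in R \<psi>" and \<Psi>: "\<Psi> = fourier_integral (\<lambda>x. complex_of_real (\<psi> x))" for \<psi> R \<Psi>
  proof -
    note cs = continuous_supported[OF Ck_continuous[OF \<psi>(1)[of 0]] \<psi>(2)]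
    have \<Psi>sq: "square_integrable \<Psi>"
      unfolding \<Psi> using cs by (intro fourier_integral_bessel) auto
    note [measurable] = square_integrable_measurable[OF \<Psi>sq]
    obtain C where C: "\<And>\<xi>. weight \<xi> ^ 4 * cmod (\<Psi> \<xi>) \<le> C"
      using fourier_integral_weight_decay[OF \<psi>] unfolding \<Psi> by blast
    have C0: "0 \<le> C" using C[of 0] by (rule order_trans[rotated]) simp
    have meas: "case_prod (\<lambda>t \<xi>. cnj (\<Psi> \<xi>) * K t \<xi>) \<in> borel_measurable (lborel \<Otimes>\<^sub>M lborel)"
    proof -
      have "(\<lambda>z. cnj (\<Psi> (snd z)) * K (fst z) (snd z)) \<in> borel_measurable (lborel \<Otimes>\<^sub>M lborel)" by measurable
      then show ?thesis by (simp add: case_prod_beta')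
    qed
    \<comment> \<open>The decay of order 4 beats the quadratic growth of \<open>h\<close> with
      weight^(-2) to spare. Bounding a product by a sum of squares leaves an integrable power and
      |U|^2 + |F|^2, which the energy bound controls uniformly in time.\<close>
    have pt: "cmod (cnj (\<Psi> \<xi>) * K t \<xi>) \<le>
        2 * B * C * (2 * weight \<xi> powr - 4 + ((cmod (U t \<xi>))\<^sup>2 + (cmod (F t \<xi>))\<^sup>2)) * indicator {0<..T} t" for t \<xi>
    proof -
      define w where "w = weight \<xi>"
      have w: "0 < w" unfolding w_def by simp
      have am: "w powr - 2 * x \<le> w powr - 4 + x\<^sup>2" for x
      proof -
        have "2 * (w powr - 2) * x \<le> (w powr - 2)\<^sup>2 + x\<^sup>2" by (rule sum_squares_bound)
        also have "(w powr - 2)\<^sup>2 = w powr - 4" by (simp add: powr_squared)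
        finally have 1: "2 * (w powr - 2 * x) \<le> w powr - 4 + x\<^sup>2" by simp
        have "0 \<le> w powr - 4 + x\<^sup>2" by simp
        then show ?thesis using 1 by linarith
      qed
      have "w ^ 4 * cmod (\<Psi> \<xi>) \<le> C" using C[of \<xi>] unfolding w_def .
      then have "cmod (\<Psi> \<xi>) \<le> C / w ^ 4" using w by (subst pos_le_divide_eq) (auto simp: mult.commute)
      then have "cmod (\<Psi> \<xi>) * w\<^sup>2 \<le> C / w ^ 4 * w\<^sup>2" by (rule mult_right_mono) simp
      also have "\<dots> = C * w powr - 2"
        using w by (simp add: powr_minus powr_numeral field_simps power2_eq_square power4_eq_xxxx)
      finally have \<Psi>w: "cmod (\<Psi> \<xi>) * w\<^sup>2 \<le> C * w powr - 2" .
      have "cmod (cnj (\<Psi> \<xi>) * K t \<xi>) \<le> cmod (\<Psi> \<xi>) * (indicator {0<..T} t * (2 * B * (w\<^sup>2 * (cmod (U t \<xi>) + cmod (F t \<xi>)))))"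
        unfolding norm_mult w_def using Kb[of t \<xi>] by (simp add: mult_left_mono)
      also have "\<dots> = indicator {0<..T} t * (2 * B) * ((cmod (\<Psi> \<xi>) * w\<^sup>2) * (cmod (U t \<xi>) + cmod (F t \<xi>)))"
        by (simp add: mult_ac)
      also have "\<dots> \<le> indicator {0<..T} t * (2 * B) * ((C * w powr - 2) * (cmod (U t \<xi>) + cmod (F t \<xi>)))"
        using B0 by (intro mult_left_mono mult_right_mono \<Psi>w) auto
      also have "\<dots> = indicator {0<..T} t * (2 * B * C) * (w powr - 2 * cmod (U t \<xi>) + w powr - 2 * cmod (F t \<xi>))"
        by (simp add: algebra_simps)
      also have "\<dots> \<le> indicator {0<..T} t * (2 * B * C) * ((w powr - 4 + (cmod (U t \<xi>))\<^sup>2) + (w powr - 4 + (cmod (F t \<xi>))\<^sup>2))"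
        using B0 C0 by (intro mult_left_mono add_mono am) auto
      finally show ?thesis unfolding w_def by (simp add: algebra_simps)
    qed
    have int: "integrable (lborel \<Otimes>\<^sub>M lborel) (case_prod (\<lambda>t \<xi>. cnj (\<Psi> \<xi>) * K t \<xi>))"
    proof (rule integrableI_bounded[OF meas])
      let ?k = "ennreal (2 * B * C)"
      let ?W = "\<integral>\<^sup>+\<xi>. ennreal (2 * weight \<xi> powr - 4) \<partial>lborel"
      have W: "?W < \<infinity>"
        using nn_integral_weight_powr[of 4] by (simp add: ennreal_mult' nn_integral_cmult ennreal_mult_less_top)
      have "(\<integral>\<^sup>+z. ennreal (norm (case_prod (\<lambda>t \<xi>. cnj (\<Psi> \<xi>) * K t \<xi>) z)) \<partial>(lborel \<Otimes>\<^sub>M lborel)) =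
          (\<integral>\<^sup>+t. \<integral>\<^sup>+\<xi>. ennreal (cmod (cnj (\<Psi> \<xi>) * K t \<xi>)) \<partial>lborel \<partial>lborel)"
        using measurable_compose[OF measurable_compose[OF meas borel_measurable_norm] measurable_ennreal]
        by (subst lborel.nn_integral_fst[symmetric]) (auto simp: case_prod_beta')
      also have "\<dots> \<le> (\<integral>\<^sup>+t. (?k * (?W + ennreal energy_bound)) * indicator {0<..T} t \<partial>lborel)"
      proof (intro nn_integral_mono)
        fix t
        have "(\<integral>\<^sup>+\<xi>. ennreal (cmod (cnj (\<Psi> \<xi>) * K t \<xi>)) \<partial>lborel) \<le>
            (\<integral>\<^sup>+\<xi>. ?k * (ennreal (2 * weight \<xi> powr - 4) + ennreal ((cmod (U t \<xi>))\<^sup>2 + (cmod (F t \<xi>))\<^sup>2)) * indicator {0<..T} t \<partial>lborel)"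
        proof (intro nn_integral_mono)
          fix \<xi>
          have "ennreal (cmod (cnj (\<Psi> \<xi>) * K t \<xi>)) \<le>
            ennreal (2 * B * C * (2 * weight \<xi> powr - 4 + ((cmod (U t \<xi>))\<^sup>2 + (cmod (F t \<xi>))\<^sup>2)) * indicator {0<..T} t)"
            by (intro ennreal_leI pt)
          also have "\<dots> = ?k * (ennreal (2 * weight \<xi> powr - 4) + ennreal ((cmod (U t \<xi>))\<^sup>2 + (cmod (F t \<xi>))\<^sup>2)) * indicator {0<..T} t"
          proof (cases "t \<in> {0<..T}")
            case True
            have "ennreal (2 * B * C * (2 * weight \<xi> powr - 4 + ((cmod (U t \<xi>))\<^sup>2 + (cmod (F t \<xi>))\<^sup>2))) =
              ?k * ennreal (2 * weight \<xi> powr - 4 + ((cmod (U t \<xi>))\<^sup>2 + (cmod (F t \<xi>))\<^sup>2))"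
              using B0 C0 by (intro ennreal_mult') simp
            also have "ennreal (2 * weight \<xi> powr - 4 + ((cmod (U t \<xi>))\<^sup>2 + (cmod (F t \<xi>))\<^sup>2)) =
              ennreal (2 * weight \<xi> powr - 4) + ennreal ((cmod (U t \<xi>))\<^sup>2 + (cmod (F t \<xi>))\<^sup>2)"
              by (rule ennreal_plus) auto
            finally show ?thesis using True by (simp only: indicator_simps mult_1_right)
          qed simp
          finally show "ennreal (cmod (cnj (\<Psi> \<xi>) * K t \<xi>)) \<le>
            ?k * (ennreal (2 * weight \<xi> powr - 4) + ennreal ((cmod (U t \<xi>))\<^sup>2 + (cmod (F t \<xi>))\<^sup>2)) * indicator {0<..T} t" .
        qed
        also have "\<dots> = ?k * (?W + (\<integral>\<^sup>+\<xi>. ennreal ((cmod (U t \<xi>))\<^sup>2 + (cmod (F t \<xi>))\<^sup>2) \<partial>lborel)) * indicator {0<..T} t"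
          by (subst nn_integral_multc, measurable, subst nn_integral_cmult, measurable, subst nn_integral_add, measurable)
        also have "\<dots> \<le> ?k * (?W + ennreal energy_bound) * indicator {0<..T} t"
          by (intro mult_right_mono mult_left_mono add_left_mono nn_integral_energy_le) auto
        finally show "(\<integral>\<^sup>+\<xi>. ennreal (cmod (cnj (\<Psi> \<xi>) * K t \<xi>)) \<partial>lborel) \<le> ?k * (?W + ennreal energy_bound) * indicator {0<..T} t" .
      qed
      also have "\<dots> = ?k * (?W + ennreal energy_bound) * emeasure lborel {0<..T}"
        by (rule nn_integral_cmult_indicator) simp
      also have "\<dots> < \<infinity>"
      proof -
        have "emeasure lborel {0<..T} < \<infinity>" by (cases "0 \<le> T") auto
        then show ?thesis using W by (simp add: ennreal_mult_less_top)
      qed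
      finally show "(\<integral>\<^sup>+z. ennreal (norm (case_prod (\<lambda>t \<xi>. cnj (\<Psi> \<xi>) * K t \<xi>) z)) \<partial>(lborel \<Otimes>\<^sub>M lborel)) < \<infinity>" .
    qed
    have HK: "(LINT t|lborel. cnj (\<Psi> \<xi>) * K t \<xi>) = cnj (\<Psi> \<xi>) * H \<xi>" for \<xi>
      unfolding H_def by (rule integral_mult_right_zero)
    have i1: "integrable lborel (\<lambda>\<xi>. cnj (\<Psi> \<xi>) * H \<xi>)"
      using lborel_pair.integrable_snd[OF int] unfolding HK .
    have i2: "integrable lborel (\<lambda>\<xi>. cnj (\<Psi> \<xi>) * U\<^sub>0 \<xi>)"
      by (rule integrable_mult_square_integrable[OF square_integrable_cnj[OF \<Psi>sq] U\<^sub>0_sq])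
    have split: "cnj (\<Psi> \<xi>) * (H \<xi> + complex_of_real (\<theta> 0) * U\<^sub>0 \<xi>) =
        cnj (\<Psi> \<xi>) * H \<xi> + complex_of_real (\<theta> 0) * (cnj (\<Psi> \<xi>) * U\<^sub>0 \<xi>)" for \<xi>
      by (simp add: algebra_simps)
    show "integrable lborel (\<lambda>\<xi>. cnj (\<Psi> \<xi>) * (H \<xi> + complex_of_real (\<theta> 0) * U\<^sub>0 \<xi>))"
      unfolding split using i1 i2 by simp
    have "(LINT \<xi>|lborel. cnj (\<Psi> \<xi>) * H \<xi>) = (LINT t|lborel. LINT \<xi>|lborel. cnj (\<Psi> \<xi>) * K t \<xi>)"
      unfolding HK[symmetric] by (rule lborel_pair.Fubini_integral[OF int])
    also have "\<dots> = (LINT t|lborel. indicator {0<..} t *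
        (LINT \<xi>|lborel. cnj (\<Psi> \<xi>) * (complex_of_real (\<theta>' t) * U t \<xi> + complex_of_real (\<theta> t) * h t \<xi>)))"
    proof (intro Bochner_Integration.integral_cong refl)
      fix t
      show "(LINT \<xi>|lborel. cnj (\<Psi> \<xi>) * K t \<xi>) = indicator {0<..} t *
        (LINT \<xi>|lborel. cnj (\<Psi> \<xi>) * (complex_of_real (\<theta>' t) * U t \<xi> + complex_of_real (\<theta> t) * h t \<xi>))"
        unfolding K_def by (cases "0 < t") simp_all
    qed
    finally show "(LINT \<xi>|lborel. cnj (\<Psi> \<xi>) * (H \<xi> + complex_of_real (\<theta> 0) * U\<^sub>0 \<xi>)) = 0"
      unfolding split using i1 i2 weak_fourier[OF \<theta> \<psi>] by (simp add: \<Psi>)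
  qed
  have "AE \<xi> in lborel. \<bar>\<xi>\<bar> * (1 / real (Suc n)) < 1 \<longrightarrow> H \<xi> + complex_of_real (\<theta> 0) * U\<^sub>0 \<xi> = 0" for n
  proof -
    define r where "r = 1 / real (Suc n)"
    have r: "0 < r" unfolding r_def by simp
    define \<Psi> where "\<Psi> = fourier_integral (\<lambda>x. complex_of_real (bump (- r) r 1 x))"
    define G where "G \<xi> = cnj (\<Psi> \<xi>) * (H \<xi> + complex_of_real (\<theta> 0) * U\<^sub>0 \<xi>)" for \<xi>
    have Gi: "integrable lborel G"
      unfolding G_def [abs_def]
      by (rule pairing(1)[OF Ck_bump supported_in_bump[of r] \<Psi>_def]) (use r in auto)
    have "fourier_integral G x = 0" for x
    proof -
      \<comment> \<open>Translating the bump by -x multiplies its transform by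
        \<open>cis (x * \<xi>)\<close>; conjugated, this is the kernel of the Fourier integral of
        \<open>G\<close> at x. The pairings with all translates are thus all the values of that
        transform.\<close>
      have "fourier_integral (\<lambda>s. complex_of_real (bump (- r + (- x)) (r + (- x)) 1 s)) \<xi> = cis (x * \<xi>) * \<Psi> \<xi>" for \<xi>
        unfolding bump_translate \<Psi>_def using fourier_integral_translate[of "\<lambda>s. complex_of_real (bump (- r) r 1 s)" "- x" \<xi>]
        by simp
      then have eq: "fourier_integral (\<lambda>s. complex_of_real (bump (- r + (- x)) (r + (- x)) 1 s)) = (\<lambda>\<xi>. cis (x * \<xi>) * \<Psi> \<xi>)" by blast
      have "(LINT \<xi>|lborel. cnj (cis (x * \<xi>) * \<Psi> \<xi>) * (H \<xi> + complex_of_real (\<theta> 0) * U\<^sub>0 \<xi>)) = 0"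
      proof (rule pairing(2)[OF Ck_bump supported_in_bump eq[symmetric]])
        show "0 \<le> r + \<bar>x\<bar>" "- (r + \<bar>x\<bar>) \<le> - r + - x" "r + - x \<le> r + \<bar>x\<bar>" using r by auto
      qed simp
      moreover have "cnj (cis (x * \<xi>) * \<Psi> \<xi>) * (H \<xi> + complex_of_real (\<theta> 0) * U\<^sub>0 \<xi>) = G \<xi> * cis (- (\<xi> * x))" for \<xi>
        unfolding G_def by (simp add: cis_cnj mult_ac)
      ultimately show ?thesis unfolding fourier_integral_def by simp
    qed
    from AE_zero_if_fourier_integral_zero_L1[OF Gi this]
    have "AE \<xi> in lborel. \<bar>\<xi>\<bar> * r < 1 \<longrightarrow> H \<xi> + complex_of_real (\<theta> 0) * U\<^sub>0 \<xi> = 0"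
      by eventually_elim (use fourier_integral_bump_nonzero[OF r, of _ 1] in \<open>auto simp: G_def \<Psi>_def\<close>)
    then show ?thesis unfolding r_def .
  qed
  then have "AE \<xi> in lborel. \<forall>n. \<bar>\<xi>\<bar> * (1 / real (Suc n)) < 1 \<longrightarrow> H \<xi> + complex_of_real (\<theta> 0) * U\<^sub>0 \<xi> = 0"
    by (intro AE_all_countable[THEN iffD2] allI)
  then show ?thesis
  proof eventually_elim
    fix \<xi> assume *: "\<forall>n. \<bar>\<xi>\<bar> * (1 / real (Suc n)) < 1 \<longrightarrow> H \<xi> + complex_of_real (\<theta> 0) * U\<^sub>0 \<xi> = 0"
    obtain n :: nat where "\<bar>\<xi>\<bar> < real n" using reals_Archimedean2 by blast
    then have "\<bar>\<xi>\<bar> * (1 / real (Suc n)) < 1" by simp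
    with * show "(LINT t|lborel. indicator {0<..} t *
      (complex_of_real (\<theta>' t) * U t \<xi> + complex_of_real (\<theta> t) * h t \<xi>)) + complex_of_real (\<theta> 0) * U\<^sub>0 \<xi> = 0"
      unfolding H_def K_def by blast
  qed
qed

text \<open>Unlike \<open>F\<close>, \<open>U\<close> has no bound at individual frequencies, only
  in L2. Fubini over a bounded time interval gives square integrability in time for almost every
  \<xi>, hence integrability.\<close>

lemma AE_locally_integrable_U:
  "AE \<xi> in lborel. \<forall>n::nat. integrable lborel (\<lambda>t. indicator {0<..real n} t * U t \<xi>)"
proof -
  have "AE \<xi> in lborel. integrable lborel (\<lambda>t. indicator {0<..real n} t * U t \<xi>)" for n
  proof -
    have "(\<integral>\<^sup>+\<xi>. \<integral>\<^sup>+t. ennreal ((cmod (U t \<xi>))\<^sup>2) * indicator {0<..real n} t \<partial>lborel \<partial>lborel) =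
        (\<integral>\<^sup>+t. \<integral>\<^sup>+\<xi>. ennreal ((cmod (U t \<xi>))\<^sup>2) * indicator {0<..real n} t \<partial>lborel \<partial>lborel)"
      by (rule lborel_pair.Fubini') measurable
    also have "\<dots> \<le> (\<integral>\<^sup>+t. ennreal (2 * pi * M\<^sup>2) * indicator {0<..real n} t \<partial>lborel)"
      by (intro nn_integral_mono) (subst nn_integral_multc, measurable, intro mult_right_mono nn_integral_U_le, simp)
    also have "\<dots> = ennreal (2 * pi * M\<^sup>2) * emeasure lborel {0<..real n}"
      by (rule nn_integral_cmult_indicator) simp
    also have "\<dots> < \<infinity>" by (simp add: ennreal_mult_less_top)
    finally have "AE \<xi> in lborel. (\<integral>\<^sup>+t. ennreal ((cmod (U t \<xi>))\<^sup>2) * indicator {0<..real n} t \<partial>lborel) \<noteq> \<infinity>"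
      by (intro nn_integral_PInf_AE) auto
    then show ?thesis
    proof eventually_elim
      fix \<xi> assume fin: "(\<integral>\<^sup>+t. ennreal ((cmod (U t \<xi>))\<^sup>2) * indicator {0<..real n} t \<partial>lborel) \<noteq> \<infinity>"
      have [measurable]: "(\<lambda>t. U t \<xi>) \<in> borel_measurable borel" by measurable
      show "integrable lborel (\<lambda>t. indicator {0<..real n} t * U t \<xi>)"
      proof (rule integrableI_bounded)
        have "(\<integral>\<^sup>+t. ennreal (norm (indicator {0<..real n} t * U t \<xi>)) \<partial>lborel) \<le>
            (\<integral>\<^sup>+t. indicator {0<..real n} t + ennreal ((cmod (U t \<xi>))\<^sup>2) * indicator {0<..real n} t \<partial>lborel)"
        proof (intro nn_integral_mono)
          fix t
          have "0 \<le> (cmod (U t \<xi>) - 1)\<^sup>2" by simp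
          then have "cmod (U t \<xi>) \<le> 1 + (cmod (U t \<xi>))\<^sup>2"
            using norm_ge_zero[of "U t \<xi>"] by (simp add: power2_diff del: norm_ge_zero)
          then have "ennreal (cmod (U t \<xi>)) \<le> ennreal (1 + (cmod (U t \<xi>))\<^sup>2)" by (rule ennreal_leI)
          also have "\<dots> = 1 + ennreal ((cmod (U t \<xi>))\<^sup>2)" by (simp add: ennreal_plus)
          finally show "ennreal (norm (indicator {0<..real n} t * U t \<xi>)) \<le>
              indicator {0<..real n} t + ennreal ((cmod (U t \<xi>))\<^sup>2) * indicator {0<..real n} t"
            by (simp split: split_indicator)
        qed
        also have "\<dots> = emeasure lborel {0<..real n} + (\<integral>\<^sup>+t. ennreal ((cmod (U t \<xi>))\<^sup>2) * indicator {0<..real n} t \<partial>lborel)"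
          by (subst nn_integral_add) auto
        also have "\<dots> < \<infinity>" using fin by (auto simp: less_top)
        finally show "(\<integral>\<^sup>+t. ennreal (norm (indicator {0<..real n} t * U t \<xi>)) \<partial>lborel) < \<infinity>" .
      qed measurable
    qed
  qed
  then show ?thesis by (simp add: AE_all_countable)
qed

text \<open>The exceptional set of frequencies depends on the time profile. With \<open>a\<close>
  and \<open>b\<close> rational and steepness 1 / (n + 1) there are countably many profiles, so one
  null set serves them all; on its complement the scalar lemmas apply.\<close>

lemma duhamel_AE:
  "AE t in lborel. 0 < t \<longrightarrow> (AE \<xi> in lborel. ennreal (cmod (U t \<xi>)) \<le> ennreal (cmod (U\<^sub>0 \<xi>)) +
    ennreal (\<bar>\<xi>\<bar> / 2) * (\<integral>\<^sup>+s. ennreal (exp (- (t - s) * dissipation \<xi>) * cmod (F s \<xi>)) * indicator {0<..<t} s \<partial>lborel))"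
proof -
  let ?\<beta> = "\<lambda>a b n. bump a b (1 / real (Suc n))"
  let ?\<theta> = "\<lambda>a b n t. LINT s|lborel. indicator {t..} s * ?\<beta> a b n s"
  let ?P = "\<lambda>a b n \<xi>. (LINT t|lborel. indicator {0<..} t * (- complex_of_real (?\<beta> a b n t) * U t \<xi> +
        complex_of_real (?\<theta> a b n t) * h t \<xi>)) + complex_of_real (?\<theta> a b n 0) * U\<^sub>0 \<xi> = 0"
  have P: "AE \<xi> in lborel. ?P a b n \<xi>" for a b n
  proof -
    have c: "0 < 1 / real (Suc n)" by simp
    have "continuous_on UNIV (\<lambda>t. - ?\<beta> a b n t)"
      by (intro continuous_on_minus Ck_continuous[OF Ck_bump[OF c, of 0]])
    moreover have "b \<le> t \<Longrightarrow> - ?\<beta> a b n t = 0" for t by (simp add: bump_eq_0 del: of_nat_Suc)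
    ultimately show ?thesis
      using weak_equation_at_frequency[OF bump_primitive(2)[OF c, where a=a and b=b] bump_primitive(1)[OF c] bump_primitive(3)[OF c]]
      by (simp only: of_real_minus)
  qed
  have "AE \<xi> in lborel. \<forall>a\<in>\<rat>. \<forall>b\<in>\<rat>. \<forall>n. ?P a b n \<xi>"
  proof (intro AE_ball_countable'[OF _ countable_rat])
    show "AE \<xi> in lborel. \<forall>n. ?P a b n \<xi>" for a b
      unfolding AE_all_countable using P by blast
  qed
  with AE_locally_integrable_U
  have "AE \<xi> in lborel. AE t in lborel. 0 < t \<longrightarrow> ennreal (cmod (U t \<xi>)) \<le> ennreal (cmod (U\<^sub>0 \<xi>)) +
    ennreal (\<bar>\<xi>\<bar> / 2) * (\<integral>\<^sup>+s. ennreal (exp (- (t - s) * dissipation \<xi>) * cmod (F s \<xi>)) * indicator {0<..<t} s \<partial>lborel)"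
  proof eventually_elim
    fix \<xi> assume Ui: "\<forall>n::nat. integrable lborel (\<lambda>t. indicator {0<..real n} t * U t \<xi>)"
      and weak: "\<forall>a\<in>\<rat>. \<forall>b\<in>\<rat>. \<forall>n. ?P a b n \<xi>"
    define g where "g t = \<i> * \<xi> / 2 * F t \<xi>" for t
    have Fm[measurable]: "(\<lambda>t. F t \<xi>) \<in> borel_measurable borel" and Um: "(\<lambda>t. U t \<xi>) \<in> borel_measurable borel"
      and hm: "(\<lambda>t. h t \<xi>) \<in> borel_measurable borel" by measurable
    have gm: "g \<in> borel_measurable borel" unfolding g_def [abs_def] by measurable
    have h_eq: "h t \<xi> = g t - complex_of_real (dissipation \<xi>) * U t \<xi>" for t
      unfolding h_def g_def by simp
    have gi: "integrable lborel (\<lambda>t. indicator {0<..real n} t * g t)" for n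
    proof -
      have "integrable lborel (\<lambda>t. indicator {0<..real n} t *\<^sub>R (indicator {0..real n} t * g t))"
      proof (intro integrable_mult_indicator integrable_bounded_Icc gm)
        show "cmod (g t) \<le> \<bar>\<xi>\<bar> / 2 * M\<^sup>2" for t
          using mult_left_mono[OF F_bound[of t \<xi>], of "\<bar>\<xi>\<bar> / 2"] by (simp add: g_def norm_mult norm_divide)
      qed simp
      then show ?thesis
        by (rule Bochner_Integration.integrable_cong[THEN iffD1, rotated 2]) (auto split: split_indicator)
    qed
    have hi: "integrable lborel (\<lambda>t. indicator {0<..real n} t * h t \<xi>)" for n
      using Bochner_Integration.integrable_diff[OF gi[of n] integrable_mult_right[OF Ui[rule_format, of n], of "complex_of_real (dissipation \<xi>)"]]
      by (rule Bochner_Integration.integrable_cong[THEN iffD1, rotated 2]) (auto simp: h_eq algebra_simps)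
    have "AE t in lborel. 0 < t \<longrightarrow> U t \<xi> = U\<^sub>0 \<xi> + (LINT s|lborel. indicator {0<..t} s * h s \<xi>)"
      by (rule weak_ode_integrated[OF Um hm _ hi]) (use Ui weak in blast)+
    then have eq: "AE t in lborel. 0 < t \<longrightarrow> U t \<xi> = U\<^sub>0 \<xi> +
        (LINT s|lborel. indicator {0<..t} s * (g s - complex_of_real (dissipation \<xi>) * U s \<xi>))"
      unfolding h_eq .
    have ge: "(\<integral>\<^sup>+s. ennreal (exp (- (t - s) * dissipation \<xi>) * cmod (g s)) * indicator {0<..<t} s \<partial>lborel) =
        ennreal (\<bar>\<xi>\<bar> / 2) * (\<integral>\<^sup>+s. ennreal (exp (- (t - s) * dissipation \<xi>) * cmod (F s \<xi>)) * indicator {0<..<t} s \<partial>lborel)" for t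
    proof -
      have "(\<integral>\<^sup>+s. ennreal (exp (- (t - s) * dissipation \<xi>) * cmod (g s)) * indicator {0<..<t} s \<partial>lborel) =
        (\<integral>\<^sup>+s. ennreal (\<bar>\<xi>\<bar> / 2) * (ennreal (exp (- (t - s) * dissipation \<xi>) * cmod (F s \<xi>)) * indicator {0<..<t} s) \<partial>lborel)"
      proof (intro nn_integral_cong)
        fix s
        have e: "exp (- (t - s) * dissipation \<xi>) * cmod (g s) = \<bar>\<xi>\<bar> / 2 * (exp (- (t - s) * dissipation \<xi>) * cmod (F s \<xi>))"
          by (simp add: g_def norm_mult norm_divide)
        show "ennreal (exp (- (t - s) * dissipation \<xi>) * cmod (g s)) * indicator {0<..<t} s =
          ennreal (\<bar>\<xi>\<bar> / 2) * (ennreal (exp (- (t - s) * dissipation \<xi>) * cmod (F s \<xi>)) * indicator {0<..<t} s)"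
          unfolding e by (subst ennreal_mult') (simp_all add: mult.assoc)
      qed
      also have "\<dots> = ennreal (\<bar>\<xi>\<bar> / 2) * (\<integral>\<^sup>+s. ennreal (exp (- (t - s) * dissipation \<xi>) * cmod (F s \<xi>)) * indicator {0<..<t} s \<partial>lborel)"
        by (intro nn_integral_cmult) measurable
      finally show ?thesis .
    qed
    have "AE t in lborel. 0 < t \<longrightarrow> ennreal (cmod (U t \<xi>)) \<le> ennreal (cmod (U\<^sub>0 \<xi>)) +
      (\<integral>\<^sup>+s. ennreal (exp (- (t - s) * dissipation \<xi>) * cmod (g s)) * indicator {0<..<t} s \<partial>lborel)"
      by (rule duhamel_inequality[OF Um gm _ gi dissipation_nonneg eq]) (use Ui in blast)
    then show "AE t in lborel. 0 < t \<longrightarrow> ennreal (cmod (U t \<xi>)) \<le> ennreal (cmod (U\<^sub>0 \<xi>)) +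
      ennreal (\<bar>\<xi>\<bar> / 2) * (\<integral>\<^sup>+s. ennreal (exp (- (t - s) * dissipation \<xi>) * cmod (F s \<xi>)) * indicator {0<..<t} s \<partial>lborel)"
      unfolding ge .
  qed
  \<comment> \<open>The scalar argument fixes the frequency; the energy estimate fixes the time and
    integrates over frequencies. Fubini for null sets exchanges the two, given measurability of the
    set where the inequality holds.\<close>
  then have "AE t in lborel. AE \<xi> in lborel. 0 < t \<longrightarrow> ennreal (cmod (U t \<xi>)) \<le> ennreal (cmod (U\<^sub>0 \<xi>)) +
    ennreal (\<bar>\<xi>\<bar> / 2) * (\<integral>\<^sup>+s. ennreal (exp (- (t - s) * dissipation \<xi>) * cmod (F s \<xi>)) * indicator {0<..<t} s \<partial>lborel)"
  proof (subst (asm) lborel_pair.AE_commute)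
    let ?I = "\<lambda>z. \<integral>\<^sup>+s. ennreal (exp (- (snd z - s) * dissipation (fst z)) * cmod (F s (fst z))) * (if 0 < s \<and> s < snd z then 1 else 0) \<partial>lborel"
    have [measurable]: "?I \<in> borel_measurable (lborel \<Otimes>\<^sub>M lborel)"
      by (rule lborel.borel_measurable_nn_integral) measurable
    have "{z \<in> space (lborel \<Otimes>\<^sub>M lborel). 0 < snd z \<longrightarrow> ennreal (cmod (U (snd z) (fst z))) \<le> ennreal (cmod (U\<^sub>0 (fst z))) +
      ennreal (\<bar>fst z\<bar> / 2) * ?I z} \<in> sets (lborel \<Otimes>\<^sub>M lborel)" by measurable
    then show "{z \<in> space (lborel \<Otimes>\<^sub>M lborel). 0 < snd z \<longrightarrow> ennreal (cmod (U (snd z) (fst z))) \<le> ennreal (cmod (U\<^sub>0 (fst z))) +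
      ennreal (\<bar>fst z\<bar> / 2) * (\<integral>\<^sup>+s. ennreal (exp (- (snd z - s) * dissipation (fst z)) * cmod (F s (fst z))) * indicator {0<..<snd z} s \<partial>lborel)}
      \<in> sets (lborel \<Otimes>\<^sub>M lborel)"
      by (simp only: indicator_def of_bool_def greaterThanLessThan_iff)
  qed
  then show ?thesis by eventually_elim simp
qed

text \<open>Each round of the bootstrap gains \<open>3/8\<close> from the smoothing and loses \<open>1/4\<close> in the
  product, a net gain of \<open>1/8\<close>.\<close>

lemma sobolev_bound:
  assumes \<rho>: "1/4 \<le> \<rho>"
    and U0: "(\<integral>\<^sup>+\<xi>. ennreal (\<bar>\<xi>\<bar> powr (2 * \<rho>) * (cmod (U\<^sub>0 \<xi>))\<^sup>2) \<partial>lborel) < \<infinity>"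
  shows "\<exists>C<\<infinity>. AE t in lborel. 0 < t \<longrightarrow> (\<integral>\<^sup>+\<xi>. ennreal (weight \<xi> powr (2 * \<rho>) * (cmod (U t \<xi>))\<^sup>2) \<partial>lborel) \<le> C"
proof -
  define A where "A \<sigma> \<longleftrightarrow> (\<exists>C<\<infinity>. AE t in lborel. 0 < t \<longrightarrow>
     (\<integral>\<^sup>+\<xi>. ennreal (weight \<xi> powr (2 * \<sigma>) * (cmod (U t \<xi>))\<^sup>2) \<partial>lborel) \<le> C)" for \<sigma>
  define Q where "Q a \<longleftrightarrow> (\<exists>C<\<infinity>. AE t in lborel. 0 < t \<longrightarrow>
     (\<integral>\<^sup>+\<xi>. ennreal (weight \<xi> powr (2 * a) * (cmod (F t \<xi>))\<^sup>2) \<partial>lborel) \<le> C)" for a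
  \<comment> \<open>The start of the bootstrap, where boundedness of the solution enters:
    \<open>F\<close> is bounded in L2 uniformly in time.\<close>
  have Q0: "Q 0"
    unfolding Q_def using nn_integral_F_le
    by (intro exI[of _ "ennreal (2 * pi * (M\<^sup>2 * M\<^sup>2))"]) (simp add: less_imp_neq[OF weight_pos, symmetric])
  have c: "0 < sqrt (tanh 1) / 2 powr (3/2 :: real)" by simp
  have QA: "A \<sigma>" if "Q a" "0 \<le> \<sigma>" "\<sigma> \<le> a + 3/8" "\<sigma> \<le> \<rho>" for a \<sigma>
  proof -
    let ?c = "sqrt (tanh 1) / 2 powr (3/2 :: real)"
    let ?\<kappa> = "\<integral>\<^sup>+\<tau>. ennreal (smoothing_kernel ?c \<tau>) * indicator {0<..} \<tau> \<partial>lborel"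
    let ?I = "\<integral>\<^sup>+\<xi>. ennreal (\<bar>\<xi>\<bar> powr (2 * \<rho>) * (cmod (U\<^sub>0 \<xi>))\<^sup>2) \<partial>lborel"
    obtain C where C: "C < \<infinity>" "AE t in lborel. 0 < t \<longrightarrow>
      (\<integral>\<^sup>+\<xi>. ennreal (weight \<xi> powr (2 * a) * (cmod (F t \<xi>))\<^sup>2) \<partial>lborel) \<le> C"
      using \<open>Q a\<close> unfolding Q_def by blast
    define C' where "C' = ennreal (4 powr \<rho>) * ennreal (2 * pi * M\<^sup>2) + ennreal (2 * 4 powr \<rho>) * ?I + C * ?\<kappa>"
    have "C' < \<infinity>"
      unfolding C'_def using C(1) U0 nn_integral_smoothing_kernel[OF c] by (simp add: ennreal_mult_less_top)
    moreover have "AE t in lborel. 0 < t \<longrightarrow> (\<integral>\<^sup>+\<xi>. ennreal (weight \<xi> powr (2 * \<sigma>) * (cmod (U t \<xi>))\<^sup>2) \<partial>lborel) \<le> C'"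
      using duhamel_AE
    proof eventually_elim
      fix t assume *: "0 < t \<longrightarrow> (AE \<xi> in lborel. ennreal (cmod (U t \<xi>)) \<le> ennreal (cmod (U\<^sub>0 \<xi>)) +
        ennreal (\<bar>\<xi>\<bar> / 2) * (\<integral>\<^sup>+s. ennreal (exp (- (t - s) * dissipation \<xi>) * cmod (F s \<xi>)) * indicator {0<..<t} s \<partial>lborel))"
      show "0 < t \<longrightarrow> (\<integral>\<^sup>+\<xi>. ennreal (weight \<xi> powr (2 * \<sigma>) * (cmod (U t \<xi>))\<^sup>2) \<partial>lborel) \<le> C'"
      proof
        assume "0 < t"
        have "(\<integral>\<^sup>+\<xi>. ennreal (weight \<xi> powr (2 * \<sigma>) * (cmod (U t \<xi>))\<^sup>2) \<partial>lborel) \<le>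
          ennreal (4 powr \<rho>) * (\<integral>\<^sup>+\<xi>. ennreal ((cmod (U t \<xi>))\<^sup>2) \<partial>lborel) + ennreal (2 * 4 powr \<rho>) * ?I + C * ?\<kappa>"
          by (rule duhamel_energy_estimate[OF U\<^sub>0_measurable U_measurable F_meas borel_measurable_dissipation c
                dissipation_ge _ that(2-4) C(2)]) (use * \<open>0 < t\<close> in auto)
        also have "\<dots> \<le> C'"
          unfolding C'_def by (intro add_right_mono mult_left_mono nn_integral_U_le) simp
        finally show "(\<integral>\<^sup>+\<xi>. ennreal (weight \<xi> powr (2 * \<sigma>) * (cmod (U t \<xi>))\<^sup>2) \<partial>lborel) \<le> C'" .
      qed
    qed
    ultimately show ?thesis unfolding A_def by blast
  qed
  have AQ: "Q a" if "A (a + 1/4)" "1/8 \<le> a" for a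
  proof -
    let ?K = "\<integral>\<^sup>+\<xi>. ennreal (weight \<xi> powr - (5/4)) \<partial>lborel"
    obtain C where C: "C < \<infinity>" "AE t in lborel. 0 < t \<longrightarrow>
      (\<integral>\<^sup>+\<xi>. ennreal (weight \<xi> powr (2 * (a + 1/4)) * (cmod (U t \<xi>))\<^sup>2) \<partial>lborel) \<le> C"
      using \<open>A (a + 1/4)\<close> unfolding A_def by blast
    have "ennreal (4 * 4 powr a) * ?K * C\<^sup>2 < \<infinity>"
      using C(1) nn_integral_weight_powr[of "5/4"] by (simp add: ennreal_mult_less_top power_less_top_ennreal)
    moreover have "AE t in lborel. 0 < t \<longrightarrow>
      (\<integral>\<^sup>+\<xi>. ennreal (weight \<xi> powr (2 * a) * (cmod (F t \<xi>))\<^sup>2) \<partial>lborel) \<le> ennreal (4 * 4 powr a) * ?K * C\<^sup>2"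
      using C(2)
    proof eventually_elim
      case (elim t)
      have "(\<integral>\<^sup>+\<xi>. ennreal (weight \<xi> powr (2 * a) * (cmod (F t \<xi>))\<^sup>2) \<partial>lborel) \<le> ennreal (4 * 4 powr a) * ?K *
        (\<integral>\<^sup>+\<xi>. ennreal (weight \<xi> powr (2 * (a + 1/4)) * (cmod (U t \<xi>))\<^sup>2) \<partial>lborel)\<^sup>2"
        by (rule weighted_convolution_estimate[OF U_measurable F_measurable F_convolution that(2)])
      moreover have "\<dots> \<le> ennreal (4 * 4 powr a) * ?K * C\<^sup>2" if "0 < t"
        using elim that by (intro mult_left_mono power_mono) auto
      ultimately show ?case using order_trans by blast
    qed
    ultimately show ?thesis unfolding Q_def by blast
  qed
  \<comment> \<open>From k/8 the smoothing reaches k/8 + 3/8, which is (k + 1)/8 + 1/4, and the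
    product returns (k + 1)/8. The side condition keeps the intermediate regularity below that of
    the initial datum.\<close>
  have Qk: "Q (real k / 8)" if "real k / 8 + 1/4 \<le> \<rho>" for k
    using that
  proof (induction k)
    case 0
    then show ?case using Q0 by simp
  next
    case (Suc k)
    have "Q (real k / 8)" by (rule Suc.IH) (use Suc.prems in \<open>simp add: field_simps\<close>)
    then have "A (real (Suc k) / 8 + 1/4)"
      by (rule QA) (use Suc.prems in \<open>simp_all add: field_simps\<close>)
    then show ?case by (rule AQ) simp
  qed
  \<comment> \<open>The largest number of rounds allowed by the side condition. One further
    smoothing step, without a product, covers the remaining gap: \<rho> \<le> k/8 + 3/8.\<close>
  define k where "k = nat \<lfloor>8 * \<rho> - 2\<rfloor>"
  have k: "real k \<le> 8 * \<rho> - 2" "8 * \<rho> - 3 < real k"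
    unfolding k_def using \<rho> by linarith+
  then have "A \<rho>" using \<rho> by (intro QA[OF Qk[of k]]) auto
  then show ?thesis unfolding A_def .
qed

end

subsection \<open>The regularity theorem\<close>

lemma esssup_finite_bound:
  fixes f :: "'a \<Rightarrow> ennreal"
  assumes "esssup N f < \<infinity>"
  obtains c where "0 \<le> c" "AE t in N. f t \<le> ennreal c"
proof -
  have "esssup N f = ennreal (enn2real (esssup N f))"
    using assms by (simp add: ennreal_enn2real_if)
  then have "AE t in N. f t \<le> ennreal (enn2real (esssup N f))"
    using esssup_AE[of f N] by simp
  then show ?thesis using that[of "enn2real (esssup N f)"] by simp
qed

lemma frac_laplacian_symbol_measurable [measurable]: "frac_laplacian_symbol a \<in> borel_measurable borel"
  unfolding frac_laplacian_symbol_def [abs_def] by measurable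

lemma frac_laplacian_symbol_squared: "(frac_laplacian_symbol (\<rho> / 2) \<xi>)\<^sup>2 = \<bar>\<xi>\<bar> powr (2 * \<rho>)"
  unfolding frac_laplacian_symbol_def by (simp add: powr_squared)

lemma Hdot_norm_finite_iff:
  assumes "square_integrable f"
  shows "Hdot_norm \<rho> f < \<infinity> \<longleftrightarrow>
    (\<integral>\<^sup>+\<xi>. ennreal (\<bar>\<xi>\<bar> powr (2 * \<rho>) * (cmod (fourier (\<lambda>x. complex_of_real (f x)) \<xi>))\<^sup>2) \<partial>lborel) < \<infinity>"
  using assms unfolding Hdot_norm_def
  by (subst multiplier_norm_eq) (auto simp: frac_laplacian_symbol_squared)

lemma Hdot_norm_le:
  assumes f: "square_integrable f" and C: "C < \<infinity>" and \<rho>: "0 \<le> \<rho>"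
    and le: "(\<integral>\<^sup>+\<xi>. ennreal (weight \<xi> powr (2 * \<rho>) * (cmod (fourier (\<lambda>x. complex_of_real (f x)) \<xi>))\<^sup>2) \<partial>lborel) \<le> C"
  shows "Hdot_norm \<rho> f \<le> ennreal (sqrt (enn2real C / (2 * pi)))"
proof -
  let ?E = "\<integral>\<^sup>+\<xi>. ennreal (\<bar>\<xi>\<bar> powr (2 * \<rho>) * (cmod (fourier (\<lambda>x. complex_of_real (f x)) \<xi>))\<^sup>2) \<partial>lborel"
  have "?E \<le> (\<integral>\<^sup>+\<xi>. ennreal (weight \<xi> powr (2 * \<rho>) * (cmod (fourier (\<lambda>x. complex_of_real (f x)) \<xi>))\<^sup>2) \<partial>lborel)"
    using \<rho> by (intro nn_integral_mono ennreal_leI mult_right_mono powr_mono2) (auto simp: weight_def)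
  then have E: "?E \<le> C" using le by (rule order_trans)
  then have "?E < \<infinity>" using C by (rule le_less_trans)
  then have "Hdot_norm \<rho> f = ennreal (sqrt (enn2real ?E / (2 * pi)))"
    using f unfolding Hdot_norm_def by (subst multiplier_norm_eq) (auto simp: frac_laplacian_symbol_squared)
  also have "\<dots> \<le> ennreal (sqrt (enn2real C / (2 * pi)))"
    using enn2real_mono[OF E] C by (intro ennreal_leI real_sqrt_le_mono divide_right_mono) auto
  finally show ?thesis .
qed

text \<open>Reduces the theorem to the locale: the hypotheses on \<open>u\<close> hold only at
  almost every time and up to null sets in space, so \<open>u\<close> is first truncated to a
  function that is bounded everywhere.\<close>

lemma regularity:
  assumes \<rho>: "1 \<le> \<rho>" and u0: "square_integrable u\<^sub>0" "Hdot_norm \<rho> u\<^sub>0 < \<infinity>"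
    and L2: "u \<in> Linf_time L2_norm" and weak: "weak_solution u\<^sub>0 u" and Linf: "u \<in> Linf_time Linf_norm"
  shows "u \<in> Linf_time (Hdot_norm \<rho>)"
proof -
  have um[measurable]: "case_prod u \<in> borel_measurable (time_measure \<Otimes>\<^sub>M lborel)"
    using L2 unfolding Linf_time_def by simp
  obtain c1 where c1: "0 \<le> c1" "AE t in time_measure. L2_norm (u t) \<le> ennreal c1"
    using L2 esssup_finite_bound[of time_measure "\<lambda>t. L2_norm (u t)"] unfolding Linf_time_def by blast
  obtain c2 where c2: "0 \<le> c2" "AE t in time_measure. Linf_norm (u t) \<le> ennreal c2"
    using Linf esssup_finite_bound[of time_measure "\<lambda>t. Linf_norm (u t)"] unfolding Linf_time_def by blast
  define M where "M = max c1 c2"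
  have M: "0 \<le> M" using c1 unfolding M_def by simp
  define w where "w t x = (if 0 < t then u t x else 0)" for t x
  have w[measurable]: "case_prod w \<in> borel_measurable (borel \<Otimes>\<^sub>M borel)"
    using measurable_extend_time[OF um] unfolding w_def .
  define N where "N t = (\<integral>\<^sup>+x. ennreal ((w t x)\<^sup>2) \<partial>lborel)" for t
  have [measurable]: "N \<in> borel_measurable borel" unfolding N_def [abs_def] by measurable
  \<comment> \<open>Values above \<open>M\<close>, and entire time slices with squared L2 norm above
    M^2, are set to zero. The condition is jointly measurable, the bounds hold at every time, and
    the two essential bounds say that almost nothing is removed.\<close>
  define v where "v t x = (if \<bar>w t x\<bar> \<le> M \<and> N t \<le> ennreal (M\<^sup>2) then w t x else 0)" for t x
  have v[measurable]: "case_prod v \<in> borel_measurable (borel \<Otimes>\<^sub>M borel)"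
  proof -
    have "(\<lambda>z. if \<bar>w (fst z) (snd z)\<bar> \<le> M \<and> N (fst z) \<le> ennreal (M\<^sup>2) then w (fst z) (snd z) else 0) \<in> borel_measurable (borel \<Otimes>\<^sub>M borel)"
      by measurable
    then show ?thesis unfolding v_def by (simp add: case_prod_beta')
  qed
  have vt[measurable]: "v t \<in> borel_measurable borel" for t
    using measurable_compose[OF measurable_Pair1' v, of t] by simp
  have vN: "(\<integral>\<^sup>+x. ennreal ((cmod (complex_of_real (v t x)))\<^sup>2) \<partial>lborel) \<le> ennreal (M\<^sup>2)" for t
  proof (cases "N t \<le> ennreal (M\<^sup>2)")
    case True
    have "(\<integral>\<^sup>+x. ennreal ((cmod (complex_of_real (v t x)))\<^sup>2) \<partial>lborel) \<le> N t"
      unfolding N_def by (intro nn_integral_mono) (simp add: v_def)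
    then show ?thesis using True by (rule order_trans)
  qed (simp add: v_def)
  have vsq: "square_integrable (\<lambda>x. complex_of_real (v t x))" for t
    by (rule square_integrableI) (measurable, use vN[of t] in \<open>auto simp: less_top[symmetric] top_unique\<close>)
  obtain U where U: "case_prod U \<in> borel_measurable (borel \<Otimes>\<^sub>M borel)"
    "\<And>t. AE \<xi> in lborel. fourier (\<lambda>x. complex_of_real (v t x)) \<xi> = U t \<xi>" "\<And>t. square_integrable (U t)"
  proof -
    have "case_prod (\<lambda>t x. complex_of_real (v t x)) \<in> borel_measurable (borel \<Otimes>\<^sub>M borel)"
      using measurable_compose[OF v, of complex_of_real borel] by (simp add: case_prod_beta')
    from jointly_measurable_fourier[OF this] that vsq show ?thesis by metis
  qed
  have eq: "AE t in time_measure. square_integrable (u t) \<and> (AE x in lborel. u t x = v t x)"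
  proof -
    have "AE t in time_measure. 0 < t" by (rule AE_I2) simp
    with c1(2) c2(2) show ?thesis
    proof eventually_elim
      case (elim t)
      have sq: "square_integrable (u t)"
        using elim(1) unfolding L2_norm_def by (auto simp: top_unique split: if_splits)
      then have "ennreal (sqrt (LINT x|lborel. (u t x)\<^sup>2)) \<le> ennreal M"
        using elim(1) c1(1) unfolding L2_norm_def M_def by (auto intro: order_trans ennreal_leI)
      then have "sqrt (LINT x|lborel. (u t x)\<^sup>2) \<le> M" using M by (simp add: ennreal_le_iff)
      then have "(LINT x|lborel. (u t x)\<^sup>2) \<le> M\<^sup>2" by (rule sqrt_le_D)
      moreover have "N t = ennreal (LINT x|lborel. (u t x)\<^sup>2)"
        unfolding N_def w_def using elim(3) square_integrable_integrable[OF sq]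
        by (simp add: nn_integral_eq_integral)
      ultimately have Nt: "N t \<le> ennreal (M\<^sup>2)" by (simp add: ennreal_leI)
      have "AE x in lborel. ennreal \<bar>u t x\<bar> \<le> Linf_norm (u t)"
        unfolding Linf_norm_def by (rule esssup_AE)
      then have "AE x in lborel. u t x = v t x"
      proof eventually_elim
        fix x assume "ennreal \<bar>u t x\<bar> \<le> Linf_norm (u t)"
        then have "ennreal \<bar>u t x\<bar> \<le> ennreal c2" using elim(2) by (rule order_trans)
        then have "\<bar>u t x\<bar> \<le> M" using c2(1) unfolding M_def by (simp add: ennreal_le_iff)
        then show "u t x = v t x" using Nt elim(3) by (simp add: v_def w_def)
      qed
      then show ?case using sq by simp
    qed
  qed
  interpret bounded_solution M u\<^sub>0 u v U
  proof
    show "0 \<le> M" "case_prod v \<in> borel_measurable (borel \<Otimes>\<^sub>M borel)" "square_integrable u\<^sub>0"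
      "case_prod U \<in> borel_measurable (borel \<Otimes>\<^sub>M borel)"
      "case_prod u \<in> borel_measurable (time_measure \<Otimes>\<^sub>M lborel)" "weak_solution u\<^sub>0 u" by fact+
    show "\<bar>v t x\<bar> \<le> M" for t x using M by (simp add: v_def)
    show "square_integrable (v t)" for t using vsq[of t] by simp
    show "sq_norm (\<lambda>x. complex_of_real (v t x)) \<le> M\<^sup>2" for t
      using vN[of t] unfolding square_integrable_nn[OF vsq] by (simp add: ennreal_le_iff)
    show "AE \<xi> in lborel. fourier (\<lambda>x. complex_of_real (v t x)) \<xi> = U t \<xi>" "square_integrable (U t)" for t
      by (rule U)+
    show "AE t in time_measure. AE x in lborel. u t x = v t x" using eq by eventually_elim simp
  qed
  have "(\<integral>\<^sup>+\<xi>. ennreal (\<bar>\<xi>\<bar> powr (2 * \<rho>) * (cmod (U\<^sub>0 \<xi>))\<^sup>2) \<partial>lborel) < \<infinity>"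
    using u0(2) unfolding Hdot_norm_finite_iff[OF u0(1)] U\<^sub>0_def .
  then obtain C where C: "C < \<infinity>" "AE t in lborel. 0 < t \<longrightarrow>
      (\<integral>\<^sup>+\<xi>. ennreal (weight \<xi> powr (2 * \<rho>) * (cmod (U t \<xi>))\<^sup>2) \<partial>lborel) \<le> C"
    using sobolev_bound[of \<rho>] \<rho> by auto
  have "AE t in time_measure. Hdot_norm \<rho> (u t) \<le> ennreal (sqrt (enn2real C / (2 * pi)))"
    using C(2)[folded AE_time_measure_iff] eq
  proof eventually_elim
    case (elim t)
    have "fourier (\<lambda>x. complex_of_real (u t x)) = fourier (\<lambda>x. complex_of_real (v t x))"
      using elim(2) vsq by (intro fourier_cong_AE) (auto elim: eventually_mono)
    then have "(\<integral>\<^sup>+\<xi>. ennreal (weight \<xi> powr (2 * \<rho>) * (cmod (fourier (\<lambda>x. complex_of_real (u t x)) \<xi>))\<^sup>2) \<partial>lborel) =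
       (\<integral>\<^sup>+\<xi>. ennreal (weight \<xi> powr (2 * \<rho>) * (cmod (U t \<xi>))\<^sup>2) \<partial>lborel)"
      by (intro nn_integral_cong_AE) (use U(2)[of t] in eventually_elim, simp)
    then show ?case
      using elim \<rho> by (intro Hdot_norm_le C(1)) auto
  qed
  \<comment> \<open>The almost everywhere bound becomes one for \<open>esssup\<close> only together
    with this measurability.\<close>
  moreover have "(\<lambda>t. Hdot_norm \<rho> (u t)) \<in> borel_measurable time_measure"
    unfolding Hdot_norm_def by (rule measurable_multiplier_norm[OF um]) measurable
  ultimately have "esssup time_measure (\<lambda>t. Hdot_norm \<rho> (u t)) \<le> ennreal (sqrt (enn2real C / (2 * pi)))"
    by (rule esssup_I[rotated])
  then have "esssup time_measure (\<lambda>t. Hdot_norm \<rho> (u t)) < \<infinity>"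
    by (auto simp: less_top[symmetric] top_unique)
  then show ?thesis using um unfolding Linf_time_def by simp
qed

theorem theorem2:
  shows "\<exists>\<rho>\<^sub>0>0::real. \<forall>\<rho>\<ge>\<rho>\<^sub>0. \<forall>(u\<^sub>0 :: real \<Rightarrow> real) (u :: real \<Rightarrow> real \<Rightarrow> real).
    square_integrable u\<^sub>0 \<longrightarrow> Hdot_norm \<rho> u\<^sub>0 < \<infinity> \<longrightarrow>
    u \<in> Linf_time L2_norm \<inter> L2_time N_norm \<longrightarrow>
    weak_solution u\<^sub>0 u \<longrightarrow>
    u \<in> Linf_time Linf_norm \<longrightarrow>
    u \<in> Linf_time (Hdot_norm \<rho>)"
  \<comment> \<open>The threshold 1 is the one assumed in \<open>regularity\<close>; it lies above
    the 1/4 from which \<open>sobolev_bound\<close> works.\<close>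
  by (rule exI[of _ 1]) (auto intro: regularity)

end
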